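(* Let $\Lambda$ be a row-finite $k$-graph with no sources. If $\pi: C^*(\Lambda) \to B(\mathcal{H})$, with $\pi(s_\lambda)=t_\lambda$, is a monic representation of $C^*(\Lambda)$ on a Hilbert space $\mathcal{H}$, then $\{t_\lambda\}_{\lambda\in \Lambda}$ is unitarily equivalent to the representation $\{S_\lambda\}_{\lambda\in \Lambda}$ associated to a $\Lambda$-projective system on $(\Lambda^\infty, \mu_\pi)$ whose prefixing and coding maps are the standard maps $\sigma_\lambda$ and $\sigma^n$. Conversely, if $\mu$ is a measure on $\Lambda^\infty$ with $\mu(Z(v)) < \infty$ for all $v\in \Lambda^0$, and $\pi$ is a representation of $C^*(\Lambda)$ on $L^2(\Lambda^\infty, \mu)$ which arises from a $\Lambda$-projective system on $(\Lambda^\infty,\mu)$ with the standard coding and prefixing maps $\sigma^n, \sigma_\lambda$, then $\pi$ is monic, and $L^2(\Lambda^\infty,\mu)$ is isometric with $L^2(\Lambda^\infty,\mu_\pi)$.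
   Context: A $k$-graph is a countable small category $\Lambda$ with a functor $d:\Lambda\to\mathbb{N}^k$ such that whenever $d(\lambda)=m+n$ there are unique $\mu,\nu$ with $\lambda=\mu\nu$, $d(\mu)=m$, $d(\nu)=n$. Objects are identified with identity morphisms (vertices, $\Lambda^0$); $r,s$ are range and source; $\Lambda^n=d^{-1}(n)$, $v\Lambda^n=\{\lambda\in\Lambda^n: r(\lambda)=v\}$. $\Lambda$ is row-finite if each $v\Lambda^n$ is finite and has no sources if each $v\Lambda^n$ is nonempty. $C^*(\Lambda)$ is the universal $C^*$-algebra generated by partial isometries $\{s_\lambda\}$ with: $\{s_v\}_{v\in\Lambda^0}$ mutually orthogonal projections; $s_\lambda s_\eta=s_{\lambda\eta}$ if $s(\lambda)=r(\eta)$; $s_\lambda^*s_\lambda=s_{s(\lambda)}$; $s_v=\sum_{\lambda\in v\Lambda^n}s_\lambda s_\lambda^*$ for all $v,n$. Let $\Omega_k$ be the $k$-graph with morphisms $\{(m,n)\in\mathbb{N}^k\times\mathbb{N}^k: m\le n\}$, $d(m,n)=n-m$. An infinite path is a degree-preserving functor $x:\Omega_k\to\Lambda$; $\Lambda^\infty$ is the set of infinite paths, $r(x)=x(0)$. Cylinder sets $Z(\lambda)=\{x: x(0,d(\lambda))=\lambda\}$ form a basis of compact open sets of a locally compact Hausdorff topology; the Borel $\sigma$-algebra is generated by them. Standard coding maps: $\sigma^m(x)(p,q)=x(p+m,q+m)$; standard prefixing maps $\sigma_\lambda: Z(s(\lambda))\to Z(\lambda)$, $x\mapsto \lambda x$.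 A semibranching function system on a measure space $(X,\mu)$: measurable $D_i\subseteq X$ ($i$ in a countable index set) with $0<\mu(D_i)<\infty$ and measurable $\sigma_i:D_i\to X$ such that, with $R_i=\sigma_i(D_i)$, $\mu(X\setminus\bigcup_i R_i)=0$, $\mu(R_i\cap R_j)=0$ for $i\ne j$, $\mu(R_i)<\infty$, and $d(\mu\circ\sigma_i)/d\mu>0$ a.e. on $D_i$; a coding map is a measurable $\sigma:X\to X$ with $\sigma\circ\sigma_i=\mathrm{id}_{D_i}$. A $\Lambda$-semibranching function system on $(X,\mu)$ consists of measurable sets $D_\lambda$, prefixing maps $\tau_\lambda:D_\lambda\to X$ and coding maps $\tau^m:X\to X$ ($m\in\mathbb{N}^k$) such that: for each $m$, $\{\tau_\lambda:d(\lambda)=m\}$ is a semibranching function system with coding map $\tau^m$; $\tau_v=\mathrm{id}$ for $v\in\Lambda^0$; with $R_\lambda=\tau_\lambda(D_\lambda)$, for $\nu\in s(\lambda)\Lambda$ we have $R_\nu\subseteq D_\lambda$ up to measure zero and $\tau_\lambda\tau_\nu=\tau_{\lambda\nu}$ a.e.; and $\tau^m\circ\tau^n=\tau^{m+n}$. A $\Lambda$-projective system is a $\Lambda$-semibranching function system together with functions $f_\lambda\in L^2(X,\mu)$ such that $0\ne d(\mu\circ\tau_\lambda^{-1})/d\mu=|f_\lambda|^2$ and $f_\lambda\cdot(f_\nu\circ\tau^{d(\lambda)})=f_{\lambda\nu}$; the associated representation is given by $T_\lambda f=f_\lambda\cdot(f\circ\tau^{d(\lambda)})$, which forms a Cuntz–Krieger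 family. A representation $\{t_\lambda\}$ of $C^*(\Lambda)$ on $\mathcal{H}$ is monic if $t_\lambda\ne0$ for all $\lambda$ and there is $\xi\in\mathcal H$ (a monic vector) with $\overline{\mathrm{span}}\{t_\lambda t_\lambda^*\xi:\lambda\in\Lambda\}=\mathcal H$. For a monic representation $\pi$ with monic vector $\xi$, $\mu_\pi$ is the Borel measure on $\Lambda^\infty$ determined by $\mu_\pi(Z(\lambda))=\langle \xi, t_\lambda t_\lambda^*\xi\rangle$. *)

theory Defs
  imports "HOL-Analysis.Analysis" "HOL-Probability.Probability"
begin

text \<open>Elements of N^k are modelled as functions nat => nat vanishing from k on;
  the order on them is the pointwise order of functions.\<close>

definition NK :: "nat \<Rightarrow> (nat \<Rightarrow> nat) set" where
  "NK k = {n. \<forall>i\<ge>k. n i = 0}"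

definition vadd :: "(nat \<Rightarrow> nat) \<Rightarrow> (nat \<Rightarrow> nat) \<Rightarrow> (nat \<Rightarrow> nat)" where
  "vadd m n = (\<lambda>i. m i + n i)"

definition vzero :: "nat \<Rightarrow> nat" where
  "vzero = (\<lambda>i. 0)"

definition vsub :: "(nat \<Rightarrow> nat) \<Rightarrow> (nat \<Rightarrow> nat) \<Rightarrow> (nat \<Rightarrow> nat)" where
  "vsub n m = (\<lambda>i. n i - m i)"

text \<open>A small category with a degree functor. Objects are identified with identity
  morphisms; cmp l m is the composite l m (defined when src l = rng m).\<close>

record 'a kgraph =
  mor :: "'a set"
  obj :: "'a set"
  rng :: "'a \<Rightarrow> 'a"
  src :: "'a \<Rightarrow> 'a"
  cmp :: "'a \<Rightarrow> 'a \<Rightarrow> 'a"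
  deg :: "'a \<Rightarrow> nat \<Rightarrow> nat"

definition is_kgraph :: "nat \<Rightarrow> 'a kgraph \<Rightarrow> bool" where
  "is_kgraph k G \<longleftrightarrow>
     countable (mor G) \<and>
     obj G \<subseteq> mor G \<and>
     (\<forall>l\<in>mor G. rng G l \<in> obj G \<and> src G l \<in> obj G) \<and>
     (\<forall>v\<in>obj G. rng G v = v \<and> src G v = v) \<and>
     (\<forall>l\<in>mor G. \<forall>m\<in>mor G. src G l = rng G m \<longrightarrow>
         cmp G l m \<in> mor G \<and> rng G (cmp G l m) = rng G l \<and> src G (cmp G l m) = src G m) \<and>
     (\<forall>l\<in>mor G. cmp G (rng G l) l = l \<and> cmp G l (src G l) = l) \<and>
     (\<forall>l\<in>mor G. \<forall>m\<in>mor G. \<forall>n\<in>mor G. src G l = rng G m \<longrightarrow> src G m = rng G n \<longrightarrow>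
         cmp G (cmp G l m) n = cmp G l (cmp G m n)) \<and>
     (\<forall>l\<in>mor G. deg G l \<in> NK k) \<and>
     (\<forall>l\<in>mor G. \<forall>m\<in>mor G. src G l = rng G m \<longrightarrow>
         deg G (cmp G l m) = vadd (deg G l) (deg G m)) \<and>
     (\<forall>l\<in>mor G. \<forall>m\<in>NK k. \<forall>n\<in>NK k. deg G l = vadd m n \<longrightarrow>
         (\<exists>!p. fst p \<in> mor G \<and> snd p \<in> mor G \<and> src G (fst p) = rng G (snd p) \<and>
               l = cmp G (fst p) (snd p) \<and> deg G (fst p) = m \<and> deg G (snd p) = n))"

definition vLn :: "'a kgraph \<Rightarrow> 'a \<Rightarrow> (nat \<Rightarrow> nat) \<Rightarrow> 'a set" where
  "vLn G v n = {l \<in> mor G. rng G l = v \<and> deg G l = n}"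

definition row_finite :: "nat \<Rightarrow> 'a kgraph \<Rightarrow> bool" where
  "row_finite k G \<longleftrightarrow> (\<forall>v\<in>obj G. \<forall>n\<in>NK k. finite (vLn G v n))"

definition no_sources :: "nat \<Rightarrow> 'a kgraph \<Rightarrow> bool" where
  "no_sources k G \<longleftrightarrow> (\<forall>v\<in>obj G. \<forall>n\<in>NK k. vLn G v n \<noteq> {})"

text \<open>An infinite path is a degree preserving functor x from Omega_k, written curried:
  x m n is the image of the morphism (m,n), m <= n in N^k. It is taken extensional
  (undefined off the morphisms of Omega_k).\<close>

type_synonym 'a ipath = "(nat \<Rightarrow> nat) \<Rightarrow> (nat \<Rightarrow> nat) \<Rightarrow> 'a"

definition infpaths :: "nat \<Rightarrow> 'a kgraph \<Rightarrow> 'a ipath set" where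
  "infpaths k G = {x.
     (\<forall>m n. \<not> (m \<in> NK k \<and> n \<in> NK k \<and> m \<le> n) \<longrightarrow> x m n = undefined) \<and>
     (\<forall>m\<in>NK k. \<forall>n\<in>NK k. m \<le> n \<longrightarrow> x m n \<in> mor G \<and> deg G (x m n) = vsub n m) \<and>
     (\<forall>m\<in>NK k. x m m \<in> obj G) \<and>
     (\<forall>m\<in>NK k. \<forall>n\<in>NK k. m \<le> n \<longrightarrow> rng G (x m n) = x m m \<and> src G (x m n) = x n n) \<and>
     (\<forall>m\<in>NK k. \<forall>n\<in>NK k. \<forall>p\<in>NK k. m \<le> n \<longrightarrow> n \<le> p \<longrightarrow>
         x m p = cmp G (x m n) (x n p))}"

definition cyl :: "nat \<Rightarrow> 'a kgraph \<Rightarrow> 'a \<Rightarrow> 'a ipath set" where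
  "cyl k G l = {x \<in> infpaths k G. x vzero (deg G l) = l}"

text \<open>The measurable space of infinite paths with the sigma-algebra generated by the
  cylinder sets (= the Borel sigma-algebra).\<close>
definition path_space :: "nat \<Rightarrow> 'a kgraph \<Rightarrow> 'a ipath measure" where
  "path_space k G = sigma (infpaths k G) (cyl k G ` mor G)"

definition shift :: "nat \<Rightarrow> (nat \<Rightarrow> nat) \<Rightarrow> 'a ipath \<Rightarrow> 'a ipath" where
  "shift k m x = (\<lambda>p q. if p \<in> NK k \<and> q \<in> NK k \<and> p \<le> q
                        then x (vadd p m) (vadd q m) else undefined)"

definition prefix :: "nat \<Rightarrow> 'a kgraph \<Rightarrow> 'a \<Rightarrow> 'a ipath \<Rightarrow> 'a ipath" where
  "prefix k G l x = (THE y. y \<in> infpaths k G \<and> y vzero (deg G l) = l \<and> shift k (deg G l) y = x)"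

definition hnorm :: "('h \<Rightarrow> 'h \<Rightarrow> complex) \<Rightarrow> 'h \<Rightarrow> real" where
  "hnorm ip x = sqrt (Re (ip x x))"

definition is_hilbert :: "(complex \<Rightarrow> 'h::ab_group_add \<Rightarrow> 'h) \<Rightarrow> ('h \<Rightarrow> 'h \<Rightarrow> complex) \<Rightarrow> bool" where
  "is_hilbert sm ip \<longleftrightarrow>
     (\<forall>a x y. sm a (x + y) = sm a x + sm a y) \<and>
     (\<forall>a b x. sm (a + b) x = sm a x + sm b x) \<and>
     (\<forall>a b x. sm (a * b) x = sm a (sm b x)) \<and>
     (\<forall>x. sm 1 x = x) \<and>
     (\<forall>x y z. ip (x + y) z = ip x z + ip y z) \<and>
     (\<forall>a x y. ip (sm a x) y = a * ip x y) \<and>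
     (\<forall>x y. ip y x = cnj (ip x y)) \<and>
     (\<forall>x. Im (ip x x) = 0 \<and> Re (ip x x) \<ge> 0) \<and>
     (\<forall>x. ip x x = 0 \<longrightarrow> x = 0) \<and>
     (\<forall>X::nat \<Rightarrow> 'h. (\<forall>e>0. \<exists>N. \<forall>m\<ge>N. \<forall>n\<ge>N. hnorm ip (X m - X n) < e) \<longrightarrow>
          (\<exists>L. \<forall>e>0. \<exists>N. \<forall>n\<ge>N. hnorm ip (X n - L) < e))"

definition hbounded :: "(complex \<Rightarrow> 'h::ab_group_add \<Rightarrow> 'h) \<Rightarrow> ('h \<Rightarrow> 'h \<Rightarrow> complex) \<Rightarrow> ('h \<Rightarrow> 'h) \<Rightarrow> bool" where
  "hbounded sm ip T \<longleftrightarrow>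
     (\<forall>x y. T (x + y) = T x + T y) \<and> (\<forall>a x. T (sm a x) = sm a (T x)) \<and>
     (\<exists>C. \<forall>x. hnorm ip (T x) \<le> C * hnorm ip x)"

text \<open>Adjoint operator (exists uniquely for bounded operators by Riesz).\<close>
definition hadj :: "('h \<Rightarrow> 'h \<Rightarrow> complex) \<Rightarrow> ('h \<Rightarrow> 'h) \<Rightarrow> ('h \<Rightarrow> 'h)" where
  "hadj ip T = (\<lambda>y. THE z. \<forall>x. ip (T x) y = ip x z)"

text \<open>A representation of C*(Lambda) on H, i.e. (by the universal property) a
  Cuntz--Krieger Lambda-family of bounded operators t_lambda = pi(s_lambda).\<close>
definition CK_family :: "nat \<Rightarrow> 'a kgraph \<Rightarrow> (complex \<Rightarrow> 'h::ab_group_add \<Rightarrow> 'h) \<Rightarrow>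
    ('h \<Rightarrow> 'h \<Rightarrow> complex) \<Rightarrow> ('a \<Rightarrow> 'h \<Rightarrow> 'h) \<Rightarrow> bool" where
  "CK_family k G sm ip t \<longleftrightarrow>
     (\<forall>l\<in>mor G. hbounded sm ip (t l)) \<and>
     (\<forall>v\<in>obj G. t v \<circ> t v = t v \<and> hadj ip (t v) = t v) \<and>
     (\<forall>v\<in>obj G. \<forall>w\<in>obj G. v \<noteq> w \<longrightarrow> t v \<circ> t w = (\<lambda>_. 0)) \<and>
     (\<forall>l\<in>mor G. \<forall>m\<in>mor G. src G l = rng G m \<longrightarrow> t l \<circ> t m = t (cmp G l m)) \<and>
     (\<forall>l\<in>mor G. hadj ip (t l) \<circ> t l = t (src G l)) \<and>
     (\<forall>v\<in>obj G. \<forall>n\<in>NK k. t v = (\<lambda>x. \<Sum>l\<in>vLn G v n. t l (hadj ip (t l) x)))"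

definition monic_vector :: "'a kgraph \<Rightarrow> (complex \<Rightarrow> 'h::ab_group_add \<Rightarrow> 'h) \<Rightarrow>
    ('h \<Rightarrow> 'h \<Rightarrow> complex) \<Rightarrow> ('a \<Rightarrow> 'h \<Rightarrow> 'h) \<Rightarrow> 'h \<Rightarrow> bool" where
  "monic_vector G sm ip t xi \<longleftrightarrow>
     (\<forall>x. \<forall>e>0. \<exists>F c. finite F \<and> F \<subseteq> mor G \<and>
        hnorm ip (x - (\<Sum>l\<in>F. sm (c l) (t l (hadj ip (t l) xi)))) < e)"

definition monic_rep :: "'a kgraph \<Rightarrow> (complex \<Rightarrow> 'h::ab_group_add \<Rightarrow> 'h) \<Rightarrow>
    ('h \<Rightarrow> 'h \<Rightarrow> complex) \<Rightarrow> ('a \<Rightarrow> 'h \<Rightarrow> 'h) \<Rightarrow> bool" where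
  "monic_rep G sm ip t \<longleftrightarrow> (\<forall>l\<in>mor G. t l \<noteq> (\<lambda>_. 0)) \<and> (\<exists>xi. monic_vector G sm ip t xi)"

section \<open>L^2 spaces (functions, identified modulo a.e. equality)\<close>

definition L2 :: "'p measure \<Rightarrow> ('p \<Rightarrow> complex) set" where
  "L2 M = {f. f \<in> borel_measurable M \<and> integrable M (\<lambda>x. (cmod (f x))\<^sup>2)}"

definition l2ip :: "'p measure \<Rightarrow> ('p \<Rightarrow> complex) \<Rightarrow> ('p \<Rightarrow> complex) \<Rightarrow> complex" where
  "l2ip M f g = (\<integral>x. f x * cnj (g x) \<partial>M)"

definition l2norm :: "'p measure \<Rightarrow> ('p \<Rightarrow> complex) \<Rightarrow> real" where
  "l2norm M f = sqrt (Re (l2ip M f f))"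

definition l2_adjoint :: "'p measure \<Rightarrow> (('p \<Rightarrow> complex) \<Rightarrow> ('p \<Rightarrow> complex)) \<Rightarrow>
    (('p \<Rightarrow> complex) \<Rightarrow> ('p \<Rightarrow> complex)) \<Rightarrow> bool" where
  "l2_adjoint M S S' \<longleftrightarrow> (\<forall>f\<in>L2 M. S' f \<in> L2 M) \<and>
     (\<forall>f\<in>L2 M. \<forall>g\<in>L2 M. l2ip M (S f) g = l2ip M f (S' g))"

definition l2_isometric :: "'p measure \<Rightarrow> 'q measure \<Rightarrow> bool" where
  "l2_isometric M N \<longleftrightarrow> (\<exists>U. (\<forall>f\<in>L2 M. U f \<in> L2 N) \<and>
     (\<forall>f\<in>L2 M. \<forall>g\<in>L2 M. AE y in N. U (\<lambda>x. f x + g x) y = U f y + U g y) \<and>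
     (\<forall>f\<in>L2 M. \<forall>a. AE y in N. U (\<lambda>x. a * f x) y = a * U f y) \<and>
     (\<forall>f\<in>L2 M. \<forall>g\<in>L2 M. l2ip N (U f) (U g) = l2ip M f g) \<and>
     (\<forall>h\<in>L2 N. \<exists>f\<in>L2 M. AE y in N. U f y = h y))"

definition comp_meas :: "'p measure \<Rightarrow> 'p set \<Rightarrow> ('p \<Rightarrow> 'p) \<Rightarrow> 'p measure" where
  "comp_meas M D f = measure_of D (sets (restrict_space M D)) (\<lambda>A. emeasure M (f ` A))"

definition sbfs :: "'p measure \<Rightarrow> 'i set \<Rightarrow> ('i \<Rightarrow> 'p set) \<Rightarrow> ('i \<Rightarrow> 'p \<Rightarrow> 'p) \<Rightarrow> ('p \<Rightarrow> 'p) \<Rightarrow> bool" where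
  "sbfs M I D tau cod \<longleftrightarrow> countable I \<and>
     (\<forall>i\<in>I. D i \<in> sets M \<and> 0 < emeasure M (D i) \<and> emeasure M (D i) < \<infinity>) \<and>
     (\<forall>i\<in>I. tau i \<in> measurable (restrict_space M (D i)) M) \<and>
     (\<forall>i\<in>I. tau i ` D i \<in> sets M \<and> emeasure M (tau i ` D i) < \<infinity>) \<and>
     emeasure M (space M - (\<Union>i\<in>I. tau i ` D i)) = 0 \<and>
     (\<forall>i\<in>I. \<forall>j\<in>I. i \<noteq> j \<longrightarrow> emeasure M (tau i ` D i \<inter> tau j ` D j) = 0) \<and>
     (\<forall>i\<in>I. \<exists>g. g \<in> borel_measurable (restrict_space M (D i)) \<and>
          density (restrict_space M (D i)) g = comp_meas M (D i) (tau i) \<and>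
          (AE x in restrict_space M (D i). g x > 0)) \<and>
     cod \<in> measurable M M \<and>
     (\<forall>i\<in>I. \<forall>x\<in>D i. cod (tau i x) = x)"

definition std_lambda_sbfs :: "nat \<Rightarrow> 'a kgraph \<Rightarrow> 'a ipath measure \<Rightarrow> bool" where
  "std_lambda_sbfs k G M \<longleftrightarrow>
     (\<forall>n\<in>NK k. sbfs M {l \<in> mor G. deg G l = n} (\<lambda>l. cyl k G (src G l))
                     (prefix k G) (shift k n)) \<and>
     (\<forall>v\<in>obj G. \<forall>x\<in>cyl k G (src G v). prefix k G v x = x) \<and>
     (\<forall>l\<in>mor G. \<forall>m\<in>mor G. src G l = rng G m \<longrightarrow>
        emeasure M (prefix k G m ` cyl k G (src G m) - cyl k G (src G l)) = 0 \<and>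
        (AE x in M. x \<in> cyl k G (src G m) \<longrightarrow>
            prefix k G l (prefix k G m x) = prefix k G (cmp G l m) x)) \<and>
     (\<forall>m\<in>NK k. \<forall>n\<in>NK k. (shift k m :: 'a ipath \<Rightarrow> 'a ipath) \<circ> shift k n = shift k (vadd m n))"

definition std_proj_system :: "nat \<Rightarrow> 'a kgraph \<Rightarrow> 'a ipath measure \<Rightarrow> ('a \<Rightarrow> 'a ipath \<Rightarrow> complex) \<Rightarrow> bool" where
  "std_proj_system k G M F \<longleftrightarrow>
     std_lambda_sbfs k G M \<and>
     (\<forall>l\<in>mor G. F l \<in> L2 M \<and>
        density M (\<lambda>x. ennreal ((cmod (F l x))\<^sup>2)) =
          distr (restrict_space M (cyl k G (src G l))) M (prefix k G l) \<and>
        \<not> (AE x in M. F l x = 0)) \<and>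
     (\<forall>l\<in>mor G. \<forall>m\<in>mor G. src G l = rng G m \<longrightarrow>
        (AE x in M. F l x * F m (shift k (deg G l) x) = F (cmp G l m) x))"

definition proj_rep :: "nat \<Rightarrow> 'a kgraph \<Rightarrow> ('a \<Rightarrow> 'a ipath \<Rightarrow> complex) \<Rightarrow> 'a \<Rightarrow>
    ('a ipath \<Rightarrow> complex) \<Rightarrow> ('a ipath \<Rightarrow> complex)" where
  "proj_rep k G F l f = (\<lambda>x. F l x * f (shift k (deg G l) x))"

definition unitarily_equiv :: "'a kgraph \<Rightarrow> (complex \<Rightarrow> 'h::ab_group_add \<Rightarrow> 'h) \<Rightarrow>
    ('h \<Rightarrow> 'h \<Rightarrow> complex) \<Rightarrow> ('a \<Rightarrow> 'h \<Rightarrow> 'h) \<Rightarrow> 'p measure \<Rightarrow>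
    ('a \<Rightarrow> ('p \<Rightarrow> complex) \<Rightarrow> ('p \<Rightarrow> complex)) \<Rightarrow> bool" where
  "unitarily_equiv G sm ip t M S \<longleftrightarrow> (\<exists>U :: 'h \<Rightarrow> 'p \<Rightarrow> complex.
     (\<forall>x. U x \<in> L2 M) \<and>
     (\<forall>x y. AE p in M. U (x + y) p = U x p + U y p) \<and>
     (\<forall>a x. AE p in M. U (sm a x) p = a * U x p) \<and>
     (\<forall>x y. l2ip M (U x) (U y) = ip x y) \<and>
     (\<forall>f\<in>L2 M. \<exists>x. AE p in M. U x p = f p) \<and>
     (\<forall>l\<in>mor G. \<forall>x. AE p in M. U (t l x) p = S l (U x) p))"

definition path_measure :: "nat \<Rightarrow> 'a kgraph \<Rightarrow> 'a ipath measure \<Rightarrow> bool" where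
  "path_measure k G M \<longleftrightarrow> space M = infpaths k G \<and> sets M = sets (path_space k G)"

definition is_mu_pi :: "nat \<Rightarrow> 'a kgraph \<Rightarrow> ('h \<Rightarrow> 'h \<Rightarrow> complex) \<Rightarrow> ('a \<Rightarrow> 'h \<Rightarrow> 'h) \<Rightarrow> 'h \<Rightarrow>
    'a ipath measure \<Rightarrow> bool" where
  "is_mu_pi k G ip t xi M \<longleftrightarrow> path_measure k G M \<and>
     (\<forall>l\<in>mor G. emeasure M (cyl k G l) = ennreal (Re (ip xi (t l (hadj ip (t l) xi)))))"

definition l2_monic_vector :: "'a kgraph \<Rightarrow> 'p measure \<Rightarrow> ('a \<Rightarrow> ('p \<Rightarrow> complex) \<Rightarrow> ('p \<Rightarrow> complex)) \<Rightarrow>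
    ('a \<Rightarrow> ('p \<Rightarrow> complex) \<Rightarrow> ('p \<Rightarrow> complex)) \<Rightarrow> ('p \<Rightarrow> complex) \<Rightarrow> bool" where
  "l2_monic_vector G M S S' xi \<longleftrightarrow> xi \<in> L2 M \<and>
     (\<forall>l\<in>mor G. l2_adjoint M (S l) (S' l)) \<and>
     (\<forall>f\<in>L2 M. \<forall>e>0. \<exists>F c. finite F \<and> F \<subseteq> mor G \<and>
        l2norm M (\<lambda>x. f x - (\<Sum>l\<in>F. c l * S l (S' l xi) x)) < e)"

definition is_mu_pi_l2 :: "nat \<Rightarrow> 'a kgraph \<Rightarrow> 'a ipath measure \<Rightarrow>
    ('a \<Rightarrow> ('a ipath \<Rightarrow> complex) \<Rightarrow> ('a ipath \<Rightarrow> complex)) \<Rightarrow>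
    ('a \<Rightarrow> ('a ipath \<Rightarrow> complex) \<Rightarrow> ('a ipath \<Rightarrow> complex)) \<Rightarrow> ('a ipath \<Rightarrow> complex) \<Rightarrow>
    'a ipath measure \<Rightarrow> bool" where
  "is_mu_pi_l2 k G M S S' xi N \<longleftrightarrow> path_measure k G N \<and>
     (\<forall>l\<in>mor G. emeasure N (cyl k G l) = ennreal (Re (l2ip M xi (S l (S' l xi)))))"

end

theory Submission
  imports Defs
begin

text \<open>
  The projections \<open>t\<^sub>l t\<^sub>l\<^sup>*\<close> of a Cuntz--Krieger family multiply like the cylinder sets intersect.
  So for a monic vector \<open>\<xi>\<close> the vectors \<open>t\<^sub>l t\<^sub>l\<^sup>* \<xi>\<close> and the indicators of the cylinders \<open>Z(l)\<close> have the same
  Gram matrix with respect to \<open>\<mu>\<^sub>\<pi>\<close>, and \<open>t\<^sub>l t\<^sub>l\<^sup>* \<xi> \<mapsto> 1\<^sub>Z\<^sub>(\<^sub>l\<^sub>)\<close> extends to a unitary \<open>U\<close> because both families are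
  total. It turns \<open>t\<^sub>l t\<^sub>l\<^sup>*\<close> into multiplication by the indicator of \<open>Z(l)\<close>, which forces
  \<open>U t\<^sub>l U\<^sup>* h = f\<^sub>l (h \<circ> \<sigma>\<^sup>d\<^sup>(\<^sup>l\<^sup>))\<close> with \<open>f\<^sub>l = U t\<^sub>l \<xi>\<close>; the Radon--Nikodym condition is checked on cylinders.
  The measure \<open>\<mu>\<^sub>\<pi>\<close> exists by Caratheodory's theorem, since cylinders are compact (row-finiteness and
  Koenig's lemma).

  Conversely the adjoint of \<open>h \<mapsto> f\<^sub>l (h \<circ> \<sigma>\<^sup>d\<^sup>(\<^sup>l\<^sup>))\<close> is explicit, and its product with the operator is again
  multiplication by the indicator of \<open>Z(l)\<close>. Hence any nowhere vanishing \<open>\<xi>\<close> in \<open>L\<^sup>2\<close> is monic, with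
  \<open>\<mu>\<^sub>\<pi> = \<bar>\<xi>\<bar>\<^sup>2 \<mu>\<close> and isometry \<open>h \<mapsto> h / \<xi>\<close>.
\<close>

section \<open>Hilbert spaces\<close>

text \<open>Three obstacles shape the development. Elements of \<open>L2 M\<close> are functions
  that matter only up to null sets, so the unitary is built as a closed graph and becomes a map only
  by choosing representatives. For k at least 2, two cylinders of incomparable degrees meet in a
  finite union of cylinders, in general not in one, so the family of all cylinders is neither
  intersection-stable nor a semiring; restricting the degrees to d + n(1, ..., 1) makes cylinders
  nested or disjoint, and since these degrees are cofinal nothing is lost. Finally the vertices may
  be infinite in number, so the path space need not be compact and there is no unit: \<mu>_\<pi> is
  finite only by Bessel's inequality, and the measure in the converse may be infinite. A projective
  system ties two conditions together: \<open>|f_l|^2\<close> is the density of a pushforward, and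
  the composed measure has an a.e. positive density. The link is that \<open>f_l\<close> is nonzero
  almost everywhere on Z(l); it is proved separately in the two directions, from monicity in one and
  from absolute continuity in the other.\<close>

locale hilbert =
  fixes sm :: "complex \<Rightarrow> 'h::ab_group_add \<Rightarrow> 'h" and ip :: "'h \<Rightarrow> 'h \<Rightarrow> complex"
  assumes hilbert: "is_hilbert sm ip"
begin

lemma hilbert_conjuncts:
  "\<forall>a x y. sm a (x + y) = sm a x + sm a y"
  "\<forall>a b x. sm (a + b) x = sm a x + sm b x"
  "\<forall>a b x. sm (a * b) x = sm a (sm b x)"
  "\<forall>x. sm 1 x = x"
  "\<forall>x y z. ip (x + y) z = ip x z + ip y z"
  "\<forall>a x y. ip (sm a x) y = a * ip x y"
  "\<forall>x y. ip y x = cnj (ip x y)"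
  "\<forall>x. Im (ip x x) = 0 \<and> Re (ip x x) \<ge> 0"
  "\<forall>x. ip x x = 0 \<longrightarrow> x = 0"
  "\<forall>X::nat \<Rightarrow> 'h. (\<forall>e>0. \<exists>N. \<forall>m\<ge>N. \<forall>n\<ge>N. hnorm ip (X m - X n) < e) \<longrightarrow>
          (\<exists>L. \<forall>e>0. \<exists>N. \<forall>n\<ge>N. hnorm ip (X n - L) < e)"
  by (insert hilbert[unfolded is_hilbert_def]; (elim conjE)?; assumption)+

lemmas sm_add = hilbert_conjuncts(1)[rule_format]
  and add_sm = hilbert_conjuncts(2)[rule_format]
  and sm_sm = hilbert_conjuncts(3)[rule_format, symmetric]
  and sm_one [simp] = hilbert_conjuncts(4)[rule_format]
  and ip_add_left = hilbert_conjuncts(5)[rule_format]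
  and ip_sm_left = hilbert_conjuncts(6)[rule_format]
  and ip_cnj = hilbert_conjuncts(7)[rule_format]

text \<open>Squared norms are polynomial in the inner product, so square roots stay out of the
  estimates; the price is the factor 2 in \<open>nsq_add_le\<close>, which comes from the
  parallelogram law.\<close>

definition nsq :: "'h \<Rightarrow> real" where "nsq x = Re (ip x x)"

lemma nsq_nonneg [simp]: "nsq x \<ge> 0" using hilbert_conjuncts(8) by (simp add: nsq_def)
lemma ip_self: "ip x x = of_real (nsq x)" using hilbert_conjuncts(8) by (simp add: nsq_def complex_eq_iff)
lemma nsq_eq_0: "nsq x = 0 \<Longrightarrow> x = 0" using hilbert_conjuncts(9) by (simp add: ip_self)
lemma hnorm_eq: "hnorm ip x = sqrt (nsq x)" by (simp add: hnorm_def nsq_def)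

lemma sm_zero_left [simp]: "sm 0 x = 0" using add_sm[of 0 0 x] by simp
lemma sm_zero_right [simp]: "sm a 0 = 0" using sm_add[of a 0 0] by simp
lemma sm_minus_left: "sm (- a) x = - sm a x" using add_sm[of a "- a" x] by (simp add: eq_neg_iff_add_eq_0 add.commute)
lemma sm_minus_right: "sm a (- x) = - sm a x" using sm_add[of a x "- x"] by (simp add: eq_neg_iff_add_eq_0 add.commute)
lemma sm_diff: "sm a (x - y) = sm a x - sm a y" using sm_add[of a x "- y"] by (simp add: sm_minus_right)
lemma ip_zero_left [simp]: "ip 0 x = 0" using ip_add_left[of 0 0 x] by simp
lemma ip_zero_right [simp]: "ip x 0 = 0" using ip_cnj[of 0 x] by simp
lemma ip_add_right: "ip x (y + z) = ip x y + ip x z"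
  by (metis ip_add_left ip_cnj complex_cnj_add)
lemma ip_sm_right: "ip x (sm a y) = cnj a * ip x y"
  by (metis ip_sm_left ip_cnj complex_cnj_mult)
lemma ip_minus_left: "ip (- x) y = - ip x y" using ip_add_left[of x "- x" y] by (simp add: eq_neg_iff_add_eq_0 add.commute)
lemma ip_minus_right: "ip x (- y) = - ip x y" using ip_add_right[of x y "- y"] by (simp add: eq_neg_iff_add_eq_0 add.commute)
lemma ip_diff_left: "ip (x - y) z = ip x z - ip y z" using ip_add_left[of x "- y" z] by (simp add: ip_minus_left)
lemma ip_diff_right: "ip x (y - z) = ip x y - ip x z" using ip_add_right[of x y "- z"] by (simp add: ip_minus_right)
lemma ip_sum_left: "ip (\<Sum>i\<in>A. f i) y = (\<Sum>i\<in>A. ip (f i) y)"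
  by (induction A rule: infinite_finite_induct) (auto simp: ip_add_left)
lemma ip_sum_right: "ip y (\<Sum>i\<in>A. f i) = (\<Sum>i\<in>A. ip y (f i))"
  by (induction A rule: infinite_finite_induct) (auto simp: ip_add_right)

lemma Re_ip_commute: "Re (ip y x) = Re (ip x y)" using ip_cnj[of y x] by simp

lemma nsq_add: "nsq (x + y) = nsq x + nsq y + 2 * Re (ip x y)"
  using Re_ip_commute[of x y] by (simp add: nsq_def ip_add_left ip_add_right)
lemma nsq_diff: "nsq (x - y) = nsq x + nsq y - 2 * Re (ip x y)"
  using Re_ip_commute[of x y] by (simp add: nsq_def ip_diff_left ip_diff_right)
lemma nsq_sm: "nsq (sm a x) = (cmod a)\<^sup>2 * nsq x"
proof -
  have "ip (sm a x) (sm a x) = (a * cnj a) * ip x x" by (simp add: ip_sm_left ip_sm_right)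
  then show ?thesis unfolding complex_norm_square[symmetric] by (simp add: nsq_def)
qed
lemma nsq_zero [simp]: "nsq 0 = 0" by (simp add: nsq_def)
lemma nsq_minus [simp]: "nsq (- x) = nsq x" by (simp add: nsq_def ip_minus_left ip_minus_right)
lemma nsq_diff_commute: "nsq (x - y) = nsq (y - x)" using nsq_minus[of "x - y"] by simp
lemma nsq_add_le: "nsq (x + y) \<le> 2 * nsq x + 2 * nsq y"
  using nsq_nonneg[of "x - y"] by (simp add: nsq_add nsq_diff del: nsq_nonneg)

text \<open>Young's inequality for the cross term. Unlike in the version with the factor 2, the
  coefficient of \<open>nsq x\<close> tends to 1 with \<delta>; this is what lets norms survive an
  approximation exactly.\<close>

lemma nsq_add_le_delta:
  assumes "\<delta> > 0" shows "nsq (x + y) \<le> (1 + \<delta>) * nsq x + (1 + 1/\<delta>) * nsq y"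
proof -
  have "0 \<le> nsq (sm (of_real \<delta>) x - y)" by (rule nsq_nonneg)
  then have "0 \<le> \<delta> * (\<delta> * nsq x + nsq y / \<delta> - 2 * Re (ip x y))"
    using assms by (simp add: nsq_diff nsq_sm ip_sm_left algebra_simps power2_eq_square)
  then have "0 \<le> \<delta> * nsq x + nsq y / \<delta> - 2 * Re (ip x y)"
    using assms by (simp add: zero_le_mult_iff)
  then show ?thesis by (simp add: nsq_add algebra_simps)
qed

lemma Cauchy_Schwarz: "(cmod (ip x y))\<^sup>2 \<le> nsq x * nsq y"
proof (cases "nsq y = 0")
  case True
  then show ?thesis using nsq_eq_0[of y] by simp
next
  case False
  then have y: "nsq y > 0" using nsq_nonneg[of y] by linarith
  \<comment> \<open>The coefficient of the orthogonal projection of \<open>x\<close> onto the line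
    through \<open>y\<close>.\<close>
  define c where "c = ip x y / of_real (nsq y)"
  have "ip x (sm c y) = of_real ((cmod (ip x y))\<^sup>2 / nsq y)"
    using complex_norm_square[of "ip x y"] by (simp add: ip_sm_right c_def mult.commute)
  then have 1: "Re (ip x (sm c y)) = (cmod (ip x y))\<^sup>2 / nsq y" by simp
  have "nsq (sm c y) = (cmod (ip x y))\<^sup>2 / nsq y"
    using y by (simp add: nsq_sm c_def norm_divide power_divide power2_eq_square)
  then have "0 \<le> nsq x - (cmod (ip x y))\<^sup>2 / nsq y"
    using nsq_nonneg[of "x - sm c y"] 1 by (simp add: nsq_diff del: nsq_nonneg)
  then show ?thesis using y by (simp add: field_simps)
qed

section \<open>Completeness and the Riesz representation theorem\<close>

lemma nsq_complete:
  fixes X :: "nat \<Rightarrow> 'h"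
  assumes "\<And>e. e > 0 \<Longrightarrow> \<exists>N. \<forall>m\<ge>N. \<forall>n\<ge>N. nsq (X m - X n) < e"
  shows "\<exists>L. (\<lambda>n. nsq (X n - L)) \<longlonglongrightarrow> 0"
proof -
  have "\<exists>N. \<forall>m\<ge>N. \<forall>n\<ge>N. hnorm ip (X m - X n) < e" if e: "e > 0" for e
  proof -
    obtain N where "\<And>m n. m \<ge> N \<Longrightarrow> n \<ge> N \<Longrightarrow> nsq (X m - X n) < e\<^sup>2" using assms[of "e\<^sup>2"] e by auto
    then show ?thesis using e by (intro exI[of _ N]) (auto simp: hnorm_eq intro!: real_less_lsqrt)
  qed
  then obtain L where L: "\<And>e. e > 0 \<Longrightarrow> \<exists>N. \<forall>n\<ge>N. hnorm ip (X n - L) < e" using hilbert_conjuncts(10) by metis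
  have "(\<lambda>n. nsq (X n - L)) \<longlonglongrightarrow> 0"
  proof (rule LIMSEQ_I)
    fix e :: real assume e: "e > 0"
    obtain N where "\<And>n. n \<ge> N \<Longrightarrow> hnorm ip (X n - L) < sqrt e" using L[of "sqrt e"] e by auto
    then show "\<exists>N. \<forall>n\<ge>N. norm (nsq (X n - L) - 0) < e" by (intro exI[of _ N]) (auto simp: hnorm_eq)
  qed
  then show ?thesis by blast
qed

lemma tendsto_ip_left:
  assumes "(\<lambda>n. nsq (X n - L)) \<longlonglongrightarrow> 0" shows "(\<lambda>n. ip (X n) y) \<longlonglongrightarrow> ip L y"
proof -
  have "(\<lambda>n. sqrt (nsq (X n - L) * nsq y)) \<longlonglongrightarrow> sqrt (0 * nsq y)"
    by (intro tendsto_intros assms)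
  then have "(\<lambda>n. sqrt (nsq (X n - L) * nsq y)) \<longlonglongrightarrow> 0" by simp
  moreover have "norm (ip (X n) y - ip L y) \<le> sqrt (nsq (X n - L) * nsq y)" for n
    using Cauchy_Schwarz[of "X n - L" y] by (intro real_le_rsqrt) (simp add: ip_diff_left)
  ultimately have "(\<lambda>n. ip (X n) y - ip L y) \<longlonglongrightarrow> 0"
    by (rule Lim_null_comparison[OF always_eventually[rule_format], rotated])
  then show ?thesis by (simp add: LIM_zero_iff)
qed

text \<open>The representing vector is the minimiser of the quadratic functional \<open>J\<close>: a
  minimising sequence is Cauchy by the parallelogram law, and stationarity of \<open>J\<close> at
  its limit is the claimed identity. Required because \<open>hadj\<close> is a definite description,
  which says nothing until an adjoint is known to exist.\<close>

lemma Riesz: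
  assumes add: "\<And>x y. \<phi> (x + y) = \<phi> x + \<phi> y" and sm: "\<And>a x. \<phi> (sm a x) = a * \<phi> x"
    and bound: "\<And>x. (cmod (\<phi> x))\<^sup>2 \<le> C * nsq x"
  shows "\<exists>z. \<forall>x. \<phi> x = ip x z"
proof -
  define J where "J x = nsq x - 2 * Re (\<phi> x)" for x
  have C: "C * nsq x \<ge> 0" for x using bound[of x] by (meson order_trans zero_le_power2)
  have bdd: "- \<bar>C\<bar> \<le> J x" for x
  proof -
    have "(cmod (\<phi> x))\<^sup>2 \<le> \<bar>C\<bar> * nsq x" using bound[of x] C[of x]
      by (metis abs_mult abs_of_nonneg nsq_nonneg)
    then have "cmod (\<phi> x) \<le> sqrt (\<bar>C\<bar> * nsq x)" by (rule real_le_rsqrt)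
    moreover have "0 \<le> (sqrt \<bar>C\<bar> - sqrt (nsq x))\<^sup>2" by simp
    then have "2 * sqrt (\<bar>C\<bar> * nsq x) \<le> \<bar>C\<bar> + nsq x"
      by (simp add: power2_diff real_sqrt_mult)
    ultimately show ?thesis using complex_Re_le_cmod[of "\<phi> x"] by (simp add: J_def)
  qed
  define m where "m = (INF x. J x)"
  have bb: "bdd_below (range J)" using bdd by (auto intro!: bdd_belowI)
  have m_le: "m \<le> J x" for x unfolding m_def by (rule cINF_lower[OF bb]) simp
  have "\<exists>x. J x < m + 1 / real (Suc n)" for n
    using cINF_less_iff[OF UNIV_not_empty bb, of "m + 1 / real (Suc n)"] by (auto simp: m_def[symmetric])
  then obtain X where X: "\<And>n. J (X n) < m + 1 / real (Suc n)" by metis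
  \<comment> \<open>The midpoint cannot lie below the infimum \<open>m\<close>, so the parallelogram
    identity forces two near-minimisers to be close.\<close>
  have par: "nsq (x - y) \<le> 2 * (J x - m) + 2 * (J y - m)" for x y
  proof -
    have h: "4 * J (sm (1/2) (x + y)) = nsq (x + y) - 4 * (Re (\<phi> x) + Re (\<phi> y))"
      using sm[of "1/2" "x + y"] by (simp add: J_def nsq_sm add power2_eq_square norm_divide add_divide_distrib)
    have "nsq (x - y) = 2 * J x + 2 * J y - 4 * J (sm (1/2) (x + y))"
      unfolding h by (simp add: nsq_add nsq_diff J_def)
    then show ?thesis using m_le[of "sm (1/2) (x + y)"] by simp
  qed
  have "\<exists>N. \<forall>i\<ge>N. \<forall>j\<ge>N. nsq (X i - X j) < e" if e: "e > 0" for e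
  proof -
    obtain N where N: "1 / real (Suc N) < e / 4" using nat_approx_posE[of "e/4"] e by auto
    have "nsq (X i - X j) < e" if ij: "i \<ge> N" "j \<ge> N" for i j
    proof -
      have "1 / real (Suc i) \<le> 1 / real (Suc N)" "1 / real (Suc j) \<le> 1 / real (Suc N)"
        using ij by (auto simp: frac_le)
      then show ?thesis using par[of "X i" "X j"] X[of i] X[of j] N by simp
    qed
    then show ?thesis by blast
  qed
  from nsq_complete[OF this] obtain L where L: "(\<lambda>n. nsq (X n - L)) \<longlonglongrightarrow> 0" by blast
  \<comment> \<open>\<open>J (X n + h)\<close> is at least \<open>m\<close>, while
    \<open>J (X n)\<close> exceeds \<open>m\<close> by less than \<open>1 / Suc n\<close>; expand
    the difference and let \<open>n\<close> tend to infinity.\<close>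
  have pos: "0 \<le> nsq h + 2 * (Re (ip L h) - Re (\<phi> h))" for h
  proof -
    have lim: "(\<lambda>n. nsq h + 2 * (Re (ip (X n) h) - Re (\<phi> h)) + 1 / real (Suc n))
        \<longlonglongrightarrow> nsq h + 2 * (Re (ip L h) - Re (\<phi> h)) + 0"
      by (intro tendsto_intros tendsto_ip_left L LIMSEQ_Suc[OF lim_1_over_n])
    have "0 \<le> nsq h + 2 * (Re (ip (X n) h) - Re (\<phi> h)) + 1 / real (Suc n)" for n
      using m_le[of "X n + h"] X[of n] by (simp add: J_def nsq_add add)
    then show ?thesis using LIMSEQ_le_const[OF lim, of 0] by auto
  qed
  have Re0: "Re (\<phi> h) = Re (ip h L)" for h
  proof -
    define c where "c = Re (ip L h) - Re (\<phi> h)"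
    \<comment> \<open>A quadratic in the real variable \<open>t\<close> without constant term that
      is never negative has no linear term; \<open>- c / nsq h\<close> is where it attains its
      minimum.\<close>
    have q: "0 \<le> t\<^sup>2 * nsq h + 2 * t * c" for t
      using pos[of "sm (of_real t) h"] by (simp add: nsq_sm ip_sm_right sm c_def algebra_simps)
    have "c = 0"
    proof (cases "nsq h = 0")
      case True
      then show ?thesis using q[of 1] q[of "-1"] by simp
    next
      case False
      then have h: "nsq h > 0" using nsq_nonneg[of h] by linarith
      have *: "(- c / nsq h)\<^sup>2 * nsq h + 2 * (- c / nsq h) * c = - (c\<^sup>2 / nsq h)"
        using h by (simp add: field_simps power2_eq_square)
      have "0 \<le> - (c\<^sup>2 / nsq h)" using q[of "- c / nsq h"] unfolding * .
      then have "c\<^sup>2 \<le> 0" using h by (simp add: divide_le_0_iff)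
      then show ?thesis by simp
    qed
    then show ?thesis using Re_ip_commute[of L h] by (simp add: c_def)
  qed
  \<comment> \<open>The imaginary part at \<open>x\<close> is, up to sign, the real part at
    \<open>sm \<i> x\<close>.\<close>
  have "\<phi> x = ip x L" for x
    using Re0[of x] Re0[of "sm \<i> x"] by (simp add: sm ip_sm_left complex_eq_iff)
  then show ?thesis by blast
qed

section \<open>Bounded operators and their adjoints\<close>

lemma bounded_nsq:
  assumes "hbounded sm ip T" shows "\<exists>C\<ge>0. \<forall>x. nsq (T x) \<le> C * nsq x"
proof -
  obtain C where C: "\<And>x. sqrt (nsq (T x)) \<le> C * sqrt (nsq x)"
    using assms by (auto simp: hbounded_def hnorm_eq)
  have "nsq (T x) \<le> C\<^sup>2 * nsq x" for x
    using power_mono[OF C[of x], of 2] by (simp add: power_mult_distrib)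
  then show ?thesis by (intro exI[of _ "C\<^sup>2"]) auto
qed

lemma ip_ext: "(\<And>x. ip x y = ip x z) \<Longrightarrow> y = z"
  using nsq_eq_0[of "y - z"] by (simp add: nsq_def ip_diff_right)

lemma ip_ext_left: "(\<And>x. ip y x = ip z x) \<Longrightarrow> y = z"
  using nsq_eq_0[of "y - z"] by (simp add: nsq_def ip_diff_left)

lemma hadj:
  assumes T: "hbounded sm ip T" shows "ip (T x) y = ip x (hadj ip T y)"
proof -
  obtain C where C: "C \<ge> 0" "\<And>x. nsq (T x) \<le> C * nsq x" using bounded_nsq[OF T] by blast
  have "\<exists>z. \<forall>x. ip (T x) y = ip x z"
  proof (rule Riesz)
    show "ip (T (a + b)) y = ip (T a) y + ip (T b) y" for a b
      using T by (simp add: hbounded_def ip_add_left)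
    show "ip (T (sm a b)) y = a * ip (T b) y" for a b
      using T by (simp add: hbounded_def ip_sm_left)
    show "(cmod (ip (T x) y))\<^sup>2 \<le> (C * nsq y) * nsq x" for x
    proof -
      have "(cmod (ip (T x) y))\<^sup>2 \<le> nsq (T x) * nsq y" by (rule Cauchy_Schwarz)
      also have "\<dots> \<le> (C * nsq x) * nsq y" using C by (intro mult_right_mono) auto
      finally show ?thesis by (simp add: ac_simps)
    qed
  qed
  then obtain z where z: "\<And>x. ip (T x) y = ip x z" by blast
  have "hadj ip T y = z" unfolding hadj_def
    by (rule the_equality) (auto simp: z intro: ip_ext)
  then show ?thesis by (simp add: z)
qed

lemma hadj_left: "hbounded sm ip T \<Longrightarrow> ip (hadj ip T y) x = ip y (T x)"
  using hadj[of T x y] ip_cnj[of "hadj ip T y" x] ip_cnj[of y "T x"] by simp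

end

section \<open>Square integrable functions\<close>

definition l2sq :: "'p measure \<Rightarrow> ('p \<Rightarrow> complex) \<Rightarrow> real" where
  "l2sq M f = (\<integral>x. (cmod (f x))\<^sup>2 \<partial>M)"

lemma l2sq_nonneg [simp]: "l2sq M f \<ge> 0" by (simp add: l2sq_def)

lemma l2ip_self: "l2ip M f f = of_real (l2sq M f)"
  unfolding l2ip_def l2sq_def complex_norm_square[symmetric] by (simp only: integral_complex_of_real)

lemma l2norm_eq: "l2norm M f = sqrt (l2sq M f)"
  by (simp add: l2norm_def l2ip_self)

lemma L2D: "f \<in> L2 M \<Longrightarrow> f \<in> borel_measurable M" "f \<in> L2 M \<Longrightarrow> integrable M (\<lambda>x. (cmod (f x))\<^sup>2)"
  by (auto simp: L2_def)

lemma cmod_add_le_delta: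
  assumes "\<delta> > 0" shows "(cmod (a + b))\<^sup>2 \<le> (1 + \<delta>) * (cmod a)\<^sup>2 + (1 + 1/\<delta>) * (cmod b)\<^sup>2"
proof -
  have "(cmod (a + b))\<^sup>2 \<le> (cmod a + cmod b)\<^sup>2" by (intro power_mono norm_triangle_ineq) auto
  moreover have "0 \<le> (\<delta> * cmod a - cmod b)\<^sup>2 / \<delta>" using assms by simp
  moreover have "(\<delta> * cmod a - cmod b)\<^sup>2 / \<delta> = \<delta> * (cmod a)\<^sup>2 + (cmod b)\<^sup>2 / \<delta> - 2 * cmod a * cmod b"
    using assms by (simp add: field_simps power2_eq_square)
  ultimately show ?thesis by (simp add: power2_sum algebra_simps)
qed

lemma L2_add:
  assumes "f \<in> L2 M" "g \<in> L2 M" shows "(\<lambda>x. f x + g x) \<in> L2 M"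
proof -
  note [measurable] = L2D(1)[OF assms(1)] L2D(1)[OF assms(2)]
  have "integrable M (\<lambda>x. (cmod (f x + g x))\<^sup>2)"
  proof (rule Bochner_Integration.integrable_bound)
    show "integrable M (\<lambda>x. 2 * (cmod (f x))\<^sup>2 + 2 * (cmod (g x))\<^sup>2)"
      using assms by (intro Bochner_Integration.integrable_add integrable_mult_right) (auto dest: L2D)
    show "AE x in M. norm ((cmod (f x + g x))\<^sup>2) \<le> norm (2 * (cmod (f x))\<^sup>2 + 2 * (cmod (g x))\<^sup>2)"
      using cmod_add_le_delta[of 1] by (intro AE_I2) auto
  qed measurable
  then show ?thesis by (simp add: L2_def)
qed

lemma L2_scale: "f \<in> L2 M \<Longrightarrow> (\<lambda>x. c * f x) \<in> L2 M"
  by (auto simp: L2_def norm_mult power_mult_distrib)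

lemma L2_diff: "f \<in> L2 M \<Longrightarrow> g \<in> L2 M \<Longrightarrow> (\<lambda>x. f x - g x) \<in> L2 M"
  using L2_add[of f M "\<lambda>x. (-1) * g x"] L2_scale[of g M "-1"] by simp

lemma L2_zero [simp]: "(\<lambda>_. 0) \<in> L2 M" by (simp add: L2_def)

lemma L2_sum: "(\<And>i. i \<in> A \<Longrightarrow> f i \<in> L2 M) \<Longrightarrow> (\<lambda>x. \<Sum>i\<in>A. f i x) \<in> L2 M"
  by (induction A rule: infinite_finite_induct) (auto intro: L2_add)

lemma L2_bound:
  assumes "g \<in> L2 M" "f \<in> borel_measurable M" "AE x in M. cmod (f x) \<le> cmod (g x)" shows "f \<in> L2 M"
proof -
  note [measurable] = assms(2)
  have "integrable M (\<lambda>x. (cmod (f x))\<^sup>2)"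
    by (rule Bochner_Integration.integrable_bound[OF L2D(2)[OF assms(1)]])
      (use assms(3) in \<open>auto elim!: eventually_mono intro: power_mono\<close>)
  then show ?thesis using assms by (simp add: L2_def)
qed

lemma L2_indicator_mult: "f \<in> L2 M \<Longrightarrow> A \<in> sets M \<Longrightarrow> (\<lambda>x. indicator A x * f x) \<in> L2 M"
  by (rule L2_bound[of f]) (auto dest: L2D(1) simp: indicator_def)

lemma l2sq_indicator_mult_le:
  assumes "f \<in> L2 M" "A \<in> sets M" shows "l2sq M (\<lambda>x. indicator A x * f x) \<le> l2sq M f"
  unfolding l2sq_def using L2D(2)[OF assms(1)] L2D(2)[OF L2_indicator_mult[OF assms]]
  by (intro integral_mono) (auto simp: indicator_def)

lemma integrable_L2_prod:
  assumes "f \<in> L2 M" "g \<in> L2 M" shows "integrable M (\<lambda>x. f x * cnj (g x))"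
proof (rule Bochner_Integration.integrable_bound)
  note [measurable] = L2D(1)[OF assms(1)] L2D(1)[OF assms(2)]
  show "integrable M (\<lambda>x. (cmod (f x))\<^sup>2 + (cmod (g x))\<^sup>2)"
    using assms by (auto dest: L2D)
  have "cnj \<in> borel_measurable borel" by (intro borel_measurable_continuous_onI continuous_intros)
  then show "(\<lambda>x. f x * cnj (g x)) \<in> borel_measurable M" by measurable
  have "cmod a * cmod b \<le> (cmod a)\<^sup>2 + (cmod b)\<^sup>2" for a b
    using sum_squares_bound[of "cmod a" "cmod b"] mult_nonneg_nonneg[OF norm_ge_zero[of a] norm_ge_zero[of b]] by linarith
  then show "AE x in M. norm (f x * cnj (g x)) \<le> norm ((cmod (f x))\<^sup>2 + (cmod (g x))\<^sup>2)"
    by (intro AE_I2) (simp add: norm_mult)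
qed

lemma l2ip_add_left: "f \<in> L2 M \<Longrightarrow> g \<in> L2 M \<Longrightarrow> h \<in> L2 M \<Longrightarrow>
    l2ip M (\<lambda>x. f x + g x) h = l2ip M f h + l2ip M g h"
  unfolding l2ip_def using integrable_L2_prod[of f M h] integrable_L2_prod[of g M h]
  by (simp add: distrib_right)

lemma l2ip_scale_left: "l2ip M (\<lambda>x. c * f x) h = c * l2ip M f h"
  by (simp add: l2ip_def mult.assoc)

lemma l2ip_cnj: "l2ip M g f = cnj (l2ip M f g)"
  unfolding l2ip_def Bochner_Integration.integral_cnj[symmetric]
  by (simp add: mult.commute)

lemma l2ip_add_right: "f \<in> L2 M \<Longrightarrow> g \<in> L2 M \<Longrightarrow> h \<in> L2 M \<Longrightarrow>
    l2ip M h (\<lambda>x. f x + g x) = l2ip M h f + l2ip M h g"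
  using l2ip_add_left[of f M g h] l2ip_cnj[of M h] by simp

lemma l2ip_scale_right: "l2ip M h (\<lambda>x. c * f x) = cnj c * l2ip M h f"
  using l2ip_scale_left[of M c f h] l2ip_cnj[of M h] by simp

lemma l2sq_add: "f \<in> L2 M \<Longrightarrow> g \<in> L2 M \<Longrightarrow> l2sq M (\<lambda>x. f x + g x) = l2sq M f + l2sq M g + 2 * Re (l2ip M f g)"
proof -
  assume fg: "f \<in> L2 M" "g \<in> L2 M"
  have "l2ip M (\<lambda>x. f x + g x) (\<lambda>x. f x + g x) = l2ip M f f + l2ip M g g + (l2ip M f g + cnj (l2ip M f g))"
    using fg l2ip_cnj[of M g f] by (simp add: l2ip_add_left l2ip_add_right L2_add)
  then have "Re (complex_of_real (l2sq M (\<lambda>x. f x + g x))) = Re (of_real (l2sq M f) + of_real (l2sq M g) + (l2ip M f g + cnj (l2ip M f g)))"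
    by (simp only: l2ip_self)
  then show ?thesis by simp
qed

lemma l2sq_scale: "l2sq M (\<lambda>x. c * f x) = (cmod c)\<^sup>2 * l2sq M f"
  by (simp add: l2sq_def norm_mult power_mult_distrib)

lemma l2sq_add_le_delta:
  assumes "\<delta> > 0" "f \<in> L2 M" "g \<in> L2 M"
  shows "l2sq M (\<lambda>x. f x + g x) \<le> (1 + \<delta>) * l2sq M f + (1 + 1/\<delta>) * l2sq M g"
proof -
  have "l2sq M (\<lambda>x. f x + g x) \<le> (\<integral>x. (1 + \<delta>) * (cmod (f x))\<^sup>2 + (1 + 1/\<delta>) * (cmod (g x))\<^sup>2 \<partial>M)"
    unfolding l2sq_def using L2D(2)[OF assms(2)] L2D(2)[OF assms(3)] L2D(2)[OF L2_add[OF assms(2,3)]]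
    by (intro integral_mono cmod_add_le_delta assms) auto
  then show ?thesis using L2D(2)[OF assms(2)] L2D(2)[OF assms(3)] by (simp add: l2sq_def)
qed

lemma l2sq_add_le: "f \<in> L2 M \<Longrightarrow> g \<in> L2 M \<Longrightarrow> l2sq M (\<lambda>x. f x + g x) \<le> 2 * l2sq M f + 2 * l2sq M g"
  using l2sq_add_le_delta[of 1 f M g] by simp

lemma l2sq_diff_commute: "l2sq M (\<lambda>x. f x - g x) = l2sq M (\<lambda>x. g x - f x)"
  by (simp add: l2sq_def norm_minus_commute)

lemma l2sq_triangle:
  assumes "f \<in> L2 M" "g \<in> L2 M" "h \<in> L2 M"
  shows "l2sq M (\<lambda>x. f x - h x) \<le> 2 * l2sq M (\<lambda>x. f x - g x) + 2 * l2sq M (\<lambda>x. g x - h x)"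
  using l2sq_add_le[OF L2_diff[OF assms(1,2)] L2_diff[OF assms(2,3)]] by simp

lemma l2sq_cong_AE: "AE x in M. f x = g x \<Longrightarrow> f \<in> borel_measurable M \<Longrightarrow> g \<in> borel_measurable M \<Longrightarrow> l2sq M f = l2sq M g"
  unfolding l2sq_def by (intro integral_cong_AE) auto

lemma l2sq_eq_0_AE: "f \<in> L2 M \<Longrightarrow> l2sq M f = 0 \<Longrightarrow> AE x in M. f x = 0"
  unfolding l2sq_def using integral_nonneg_eq_0_iff_AE[of M "\<lambda>x. (cmod (f x))\<^sup>2"] by (auto dest: L2D)

lemma nn_integral_l2sq: "f \<in> L2 M \<Longrightarrow> (\<integral>\<^sup>+x. ennreal ((cmod (f x))\<^sup>2) \<partial>M) = ennreal (l2sq M f)"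
  unfolding l2sq_def by (intro nn_integral_eq_integral) (auto dest: L2D)

lemma L2_I_nn_integral:
  assumes "f \<in> borel_measurable M" "(\<integral>\<^sup>+x. ennreal ((cmod (f x))\<^sup>2) \<partial>M) \<le> ennreal C" "C \<ge> 0"
  shows "f \<in> L2 M" "l2sq M f \<le> C"
proof -
  have "integrable M (\<lambda>x. (cmod (f x))\<^sup>2)"
    using assms by (intro integrableI_bounded) (auto intro: le_less_trans)
  then show f: "f \<in> L2 M" using assms by (simp add: L2_def)
  show "l2sq M f \<le> C" using nn_integral_l2sq[OF f] assms by simp
qed

text \<open>Riesz-Fischer: a subsequence with geometrically small steps converges almost everywhere
  because its steps have summable integrals, and Fatou's lemma bounds the distance to the limit. The
  finite mass of \<open>M\<close> bounds the integral of the steps by their L2 norms.\<close>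

lemma L2_complete:
  assumes fin: "finite_measure M" and X: "\<And>n. X n \<in> L2 M"
    and Cauchy: "\<And>e. e > 0 \<Longrightarrow> \<exists>N. \<forall>m\<ge>N. \<forall>n\<ge>N. l2sq M (\<lambda>x. X m x - X n x) < e"
  shows "\<exists>g\<in>L2 M. (\<lambda>n. l2sq M (\<lambda>x. X n x - g x)) \<longlonglongrightarrow> 0"
proof -
  interpret finite_measure M by fact
  have "\<exists>N. \<forall>i\<ge>N. \<forall>j\<ge>N. l2sq M (\<lambda>x. X i x - X j x) < (1/4)^n" for n :: nat
    using Cauchy[of "(1/4)^n"] by simp
  then obtain N where N: "\<And>n i j. i \<ge> N n \<Longrightarrow> j \<ge> N n \<Longrightarrow> l2sq M (\<lambda>x. X i x - X j x) < (1/4)^n" by metis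
  \<comment> \<open>Cumulative sums make the subsequence monotone while keeping \<open>r n\<close>
    above \<open>N n\<close>.\<close>
  define r where "r n = (\<Sum>i\<le>n. N i)" for n
  have r: "r n \<ge> N n" for n unfolding r_def by (rule member_le_sum) auto
  have r_mono: "r m \<le> r n" if "m \<le> n" for m n unfolding r_def using that by (intro sum_mono2) auto
  define Y where "Y n = X (r n)" for n
  have Y: "Y n \<in> L2 M" for n using X by (simp add: Y_def)
  note [measurable] = L2D(1)[OF Y]
  have XY: "l2sq M (\<lambda>x. X i x - Y n x) < (1/4)^n" if "i \<ge> r n" for i n
    unfolding Y_def using N[of n i "r n"] r[of n] that by auto
  define D where "D n x = Y (Suc n) x - Y n x" for n x
  have D: "D n \<in> L2 M" for n unfolding D_def[abs_def] by (intro L2_diff Y)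
  note [measurable] = L2D(1)[OF D]
  have nD: "l2sq M (D n) < (1/4)^n" for n
    using XY[of n "r (Suc n)"] r_mono[of n "Suc n"] by (simp add: D_def[abs_def] Y_def)
  define c where "c = (1 + measure M (space M)) / 2"
  have intD: "(\<integral>\<^sup>+x. ennreal (cmod (D n x)) \<partial>M) \<le> ennreal (c * (1/2)^n)" for n
  proof -
    have i: "integrable M (\<lambda>x. (2^n * (cmod (D n x))\<^sup>2 + (1/2)^n) / 2)"
      using L2D(2)[OF D[of n]] by auto
    \<comment> \<open>Young's inequality with weight \<open>2^n\<close>: after integration the first
      term is at most \<open>2^n * (1/4)^n\<close> and the second is \<open>(1/2)^n\<close> times
      the total mass, so both are summable.\<close>
    have pw: "cmod (D n x) \<le> (2^n * (cmod (D n x))\<^sup>2 + (1/2)^n) / 2" for x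
    proof -
      have "0 \<le> (2^n * cmod (D n x) - 1)\<^sup>2 * (1/2)^n" by simp
      also have "\<dots> = 2^n * (cmod (D n x))\<^sup>2 + (1/2)^n - 2 * cmod (D n x)"
        by (simp add: power2_diff algebra_simps power_mult_distrib power_one_over power2_eq_square)
      finally show ?thesis by simp
    qed
    have "(\<integral>\<^sup>+x. ennreal (cmod (D n x)) \<partial>M) \<le> (\<integral>\<^sup>+x. ennreal ((2^n * (cmod (D n x))\<^sup>2 + (1/2)^n) / 2) \<partial>M)"
      using pw by (intro nn_integral_mono) (auto intro!: ennreal_leI)
    also have "\<dots> = ennreal (\<integral>x. (2^n * (cmod (D n x))\<^sup>2 + (1/2)^n) / 2 \<partial>M)"
      by (intro nn_integral_eq_integral i AE_I2) auto
    also have "(\<integral>x. (2^n * (cmod (D n x))\<^sup>2 + (1/2)^n) / 2 \<partial>M) = (2^n * l2sq M (D n) + (1/2)^n * measure M (space M)) / 2"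
      using L2D(2)[OF D[of n]] by (simp add: l2sq_def mult.commute)
    also have "\<dots> \<le> (2^n * (1/4)^n + (1/2)^n * measure M (space M)) / 2"
      using nD[of n] by simp
    also have "\<dots> = c * (1/2)^n"
      by (simp add: c_def field_simps power_mult_distrib[symmetric])
    finally show ?thesis by (simp add: ennreal_leI)
  qed
  have c: "c \<ge> 0" by (simp add: c_def)
  have "(\<integral>\<^sup>+x. (\<Sum>n. ennreal (cmod (D n x))) \<partial>M) = (\<Sum>n. \<integral>\<^sup>+x. ennreal (cmod (D n x)) \<partial>M)"
    by (intro nn_integral_suminf) measurable
  also have "\<dots> \<le> (\<Sum>n. ennreal (c * (1/2)^n))" by (intro suminf_le intD) auto
  also have "\<dots> = ennreal (\<Sum>n. c * (1/2)^n)"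
    using c by (intro suminf_ennreal2) (auto intro!: summable_mult summable_geometric)
  also have "\<dots> < \<infinity>" by simp
  finally have "AE x in M. (\<Sum>n. ennreal (cmod (D n x))) \<noteq> \<infinity>"
    by (intro nn_integral_noteq_infinite) auto
  then have conv: "AE x in M. (\<lambda>n. Y n x) \<longlonglongrightarrow> lim (\<lambda>n. Y n x)"
  proof (rule eventually_mono)
    fix x assume "(\<Sum>n. ennreal (cmod (D n x))) \<noteq> \<infinity>"
    then have "summable (\<lambda>n. cmod (D n x))" by (intro summable_suminf_not_top) auto
    then have "summable (\<lambda>n. D n x)" by (rule summable_norm_cancel)
    then have "(\<lambda>n. Y 0 x + (\<Sum>i<n. D i x)) \<longlonglongrightarrow> Y 0 x + (\<Sum>i. D i x)"
      by (intro tendsto_intros summable_LIMSEQ)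
    moreover have "Y 0 x + (\<Sum>i<n. D i x) = Y n x" for n
      unfolding D_def by (subst sum_lessThan_telescope) simp
    ultimately show "(\<lambda>n. Y n x) \<longlonglongrightarrow> lim (\<lambda>n. Y n x)" by (simp add: limI)
  qed
  define g where "g x = lim (\<lambda>n. Y n x)" for x
  have [measurable]: "g \<in> borel_measurable M" unfolding g_def[abs_def] by measurable
  \<comment> \<open>Almost everywhere the distance from \<open>Y n\<close> to \<open>g\<close> is
    the limit of the distances to \<open>Y m\<close>, each small for large \<open>m\<close>; Fatou's
    lemma carries the bound over.\<close>
  have Yg: "(\<lambda>x. Y n x - g x) \<in> L2 M" "l2sq M (\<lambda>x. Y n x - g x) \<le> (1/4)^n" for n
  proof -
    have "(\<integral>\<^sup>+x. ennreal ((cmod (Y n x - g x))\<^sup>2) \<partial>M) = (\<integral>\<^sup>+x. liminf (\<lambda>m. ennreal ((cmod (Y n x - Y m x))\<^sup>2)) \<partial>M)"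
    proof (rule nn_integral_cong_AE)
      show "AE x in M. ennreal ((cmod (Y n x - g x))\<^sup>2) = liminf (\<lambda>m. ennreal ((cmod (Y n x - Y m x))\<^sup>2))"
        using conv
      proof (rule eventually_mono)
        fix x assume "(\<lambda>n. Y n x) \<longlonglongrightarrow> lim (\<lambda>n. Y n x)"
        then have "(\<lambda>m. ennreal ((cmod (Y n x - Y m x))\<^sup>2)) \<longlonglongrightarrow> ennreal ((cmod (Y n x - g x))\<^sup>2)"
          unfolding g_def by (intro tendsto_intros)
        then show "ennreal ((cmod (Y n x - g x))\<^sup>2) = liminf (\<lambda>m. ennreal ((cmod (Y n x - Y m x))\<^sup>2))"
          by (intro lim_imp_Liminf[symmetric]) auto
      qed
    qed
    also have "\<dots> \<le> liminf (\<lambda>m. \<integral>\<^sup>+x. ennreal ((cmod (Y n x - Y m x))\<^sup>2) \<partial>M)"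
      by (intro nn_integral_liminf) measurable
    also have "\<dots> \<le> liminf (\<lambda>m. ennreal ((1/4)^n))"
    proof (rule Liminf_mono, rule eventually_sequentiallyI[of n])
      fix m assume m: "n \<le> m"
      have "l2sq M (\<lambda>x. Y n x - Y m x) < (1/4)^n"
        using XY[of n "r m"] r_mono[OF m] l2sq_diff_commute[of M "Y n" "Y m"] by (simp add: Y_def)
      then show "(\<integral>\<^sup>+x. ennreal ((cmod (Y n x - Y m x))\<^sup>2) \<partial>M) \<le> ennreal ((1/4)^n)"
        unfolding nn_integral_l2sq[OF L2_diff[OF Y Y]] by (intro ennreal_leI) simp
    qed
    also have "\<dots> = ennreal ((1/4)^n)" by (intro Liminf_const) auto
    finally show "(\<lambda>x. Y n x - g x) \<in> L2 M" "l2sq M (\<lambda>x. Y n x - g x) \<le> (1/4)^n"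
      by (auto intro!: L2_I_nn_integral)
  qed
  have g: "g \<in> L2 M" using L2_diff[OF Y[of 0] Yg(1)[of 0]] by simp
  have "(\<lambda>n. l2sq M (\<lambda>x. X n x - g x)) \<longlonglongrightarrow> 0"
  proof (rule LIMSEQ_I)
    fix e :: real assume "e > 0"
    then obtain n where n: "(1/4)^n < e/4" using real_arch_pow_inv[of "e/4" "1/4"] by auto
    have "l2sq M (\<lambda>x. X i x - g x) < e" if "i \<ge> r n" for i
      using l2sq_triangle[OF X[of i] Y[of n] g] XY[OF that] Yg(2)[of n] n by linarith
    then show "\<exists>N. \<forall>i\<ge>N. norm (l2sq M (\<lambda>x. X i x - g x) - 0) < e" by auto
  qed
  then show ?thesis using g by blast
qed

section \<open>Linear spans and their closures in L2\<close>

inductive_set lspan :: "'i set \<Rightarrow> ('i \<Rightarrow> 'p \<Rightarrow> complex) \<Rightarrow> ('p \<Rightarrow> complex) set"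
  for I :: "'i set" and u :: "'i \<Rightarrow> 'p \<Rightarrow> complex" where
  zero: "(\<lambda>_. 0) \<in> lspan I u"
| step: "\<phi> \<in> lspan I u \<Longrightarrow> i \<in> I \<Longrightarrow> (\<lambda>x. \<phi> x + c * u i x) \<in> lspan I u"

lemma lspan_add:
  assumes "\<psi> \<in> lspan I u" "\<phi> \<in> lspan I u" shows "(\<lambda>x. \<phi> x + \<psi> x) \<in> lspan I u"
  using assms
proof (induction rule: lspan.induct)
  case (step \<psi> i c)
  then show ?case using lspan.step[of "\<lambda>x. \<phi> x + \<psi> x" I u i c] by (simp add: add.assoc)
qed simp

lemma lspan_scale: "\<phi> \<in> lspan I u \<Longrightarrow> (\<lambda>x. a * \<phi> x) \<in> lspan I u"
proof (induction rule: lspan.induct)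
  case zero
  then show ?case using lspan.zero by simp
next
  case (step \<phi> i c)
  then show ?case using lspan.step[of "\<lambda>x. a * \<phi> x" I u i "a * c"] by (simp add: algebra_simps)
qed

lemma lspan_base: "i \<in> I \<Longrightarrow> u i \<in> lspan I u"
  using lspan.step[OF lspan.zero, of i I 1 u] by simp

lemma lspan_L2: "\<phi> \<in> lspan I u \<Longrightarrow> (\<And>i. i \<in> I \<Longrightarrow> u i \<in> L2 M) \<Longrightarrow> \<phi> \<in> L2 M"
proof (induction rule: lspan.induct)
  case (step \<phi> i c)
  then show ?case using L2_add[OF _ L2_scale[of "u i" M c], of \<phi>] by simp
qed simp

lemma lspan_finite_sum:
  "\<phi> \<in> lspan I u \<Longrightarrow> \<exists>F c. finite F \<and> F \<subseteq> I \<and> \<phi> = (\<lambda>x. \<Sum>i\<in>F. c i * u i x)"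
proof (induction rule: lspan.induct)
  case zero
  then show ?case by (intro exI[of _ "{}"]) auto
next
  case (step \<phi> i a)
  then obtain F c where F: "finite F" "F \<subseteq> I" "\<phi> = (\<lambda>x. \<Sum>i\<in>F. c i * u i x)" by blast
  \<comment> \<open>The new index \<open>i\<close> may already occur in \<open>F\<close>, and then
    the two coefficients add up.\<close>
  define d where "d j = (if j \<in> F then c j else 0) + (if j = i then a else 0)" for j
  have "(\<Sum>j\<in>insert i F. d j * u j x) = \<phi> x + a * u i x" for x
  proof -
    have "(\<Sum>j\<in>insert i F. d j * u j x) = (\<Sum>j\<in>insert i F. (if j \<in> F then c j * u j x else 0)) +
        (\<Sum>j\<in>insert i F. (if j = i then a * u i x else 0))"
      unfolding sum.distrib[symmetric] by (intro sum.cong) (auto simp: d_def algebra_simps)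
    also have "(\<Sum>j\<in>insert i F. (if j \<in> F then c j * u j x else 0)) = (\<Sum>j\<in>F. c j * u j x)"
      using F by (intro sum.mono_neutral_cong_right) auto
    finally show ?thesis using F by (simp add: sum.delta)
  qed
  then show ?case using F step by (intro exI[of _ "insert i F"] exI[of _ d]) auto
qed

definition l2_closure :: "'p measure \<Rightarrow> ('p \<Rightarrow> complex) set \<Rightarrow> ('p \<Rightarrow> complex) set" where
  "l2_closure M S = {f \<in> L2 M. \<forall>e>0. \<exists>\<phi>\<in>S. l2sq M (\<lambda>x. f x - \<phi> x) < e}"

context
  fixes M :: "'p measure" and I :: "'i set" and u :: "'i \<Rightarrow> 'p \<Rightarrow> complex"
  assumes u: "\<And>i. i \<in> I \<Longrightarrow> u i \<in> L2 M"
begin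

lemma l2_closure_base: "\<phi> \<in> lspan I u \<Longrightarrow> \<phi> \<in> l2_closure M (lspan I u)"
  using lspan_L2 u by (auto simp: l2_closure_def l2sq_def intro!: bexI[of _ \<phi>])

lemma l2_closure_lim:
  assumes f: "f \<in> L2 M" and "\<And>e. e > 0 \<Longrightarrow> \<exists>g\<in>l2_closure M (lspan I u). l2sq M (\<lambda>x. f x - g x) < e"
  shows "f \<in> l2_closure M (lspan I u)"
  unfolding l2_closure_def
proof (intro CollectI conjI allI impI f)
  fix e :: real assume e: "e > 0"
  obtain g where g: "g \<in> l2_closure M (lspan I u)" "l2sq M (\<lambda>x. f x - g x) < e/4" using assms(2)[of "e/4"] e by auto
  then obtain \<phi> where \<phi>: "\<phi> \<in> lspan I u" "l2sq M (\<lambda>x. g x - \<phi> x) < e/4" "g \<in> L2 M"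
    using e by (auto simp: l2_closure_def dest!: spec[of _ "e/4"])
  then show "\<exists>\<phi>\<in>lspan I u. l2sq M (\<lambda>x. f x - \<phi> x) < e"
    using l2sq_triangle[OF f \<phi>(3) lspan_L2[OF \<phi>(1) u]] g by (intro bexI[of _ \<phi>]) auto
qed

lemma l2_closure_LIMSEQ:
  assumes f: "f \<in> L2 M" and g: "\<And>n. g n \<in> l2_closure M (lspan I u)"
    and lim: "(\<lambda>n. l2sq M (\<lambda>x. f x - g n x)) \<longlonglongrightarrow> 0"
  shows "f \<in> l2_closure M (lspan I u)"
proof (rule l2_closure_lim[OF f])
  fix e :: real assume "e > 0"
  then obtain n where "l2sq M (\<lambda>x. f x - g n x) < e"
    using LIMSEQ_D[OF lim, of e] by fastforce
  then show "\<exists>g\<in>l2_closure M (lspan I u). l2sq M (\<lambda>x. f x - g x) < e" using g by blast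
qed

lemma l2_closure_add:
  assumes "f \<in> l2_closure M (lspan I u)" "g \<in> l2_closure M (lspan I u)"
  shows "(\<lambda>x. f x + g x) \<in> l2_closure M (lspan I u)"
  unfolding l2_closure_def
proof (intro CollectI conjI allI impI)
  have fg: "f \<in> L2 M" "g \<in> L2 M" using assms by (auto simp: l2_closure_def)
  then show "(\<lambda>x. f x + g x) \<in> L2 M" by (rule L2_add)
  fix e :: real assume e: "e > 0"
  obtain \<phi> where \<phi>: "\<phi> \<in> lspan I u" "l2sq M (\<lambda>x. f x - \<phi> x) < e/4"
    using assms(1) e by (auto simp: l2_closure_def dest!: spec[of _ "e/4"])
  obtain \<psi> where \<psi>: "\<psi> \<in> lspan I u" "l2sq M (\<lambda>x. g x - \<psi> x) < e/4"
    using assms(2) e by (auto simp: l2_closure_def dest!: spec[of _ "e/4"])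
  have "l2sq M (\<lambda>x. (f x - \<phi> x) + (g x - \<psi> x)) < e"
    using l2sq_add_le[OF L2_diff[OF fg(1) lspan_L2[OF \<phi>(1) u]] L2_diff[OF fg(2) lspan_L2[OF \<psi>(1) u]]] \<phi> \<psi> by simp
  then show "\<exists>\<phi>\<in>lspan I u. l2sq M (\<lambda>x. f x + g x - \<phi> x) < e"
    using lspan_add[OF \<psi>(1) \<phi>(1)] by (intro bexI[of _ "\<lambda>x. \<phi> x + \<psi> x"]) (auto simp: algebra_simps)
qed

lemma l2_closure_scale:
  assumes "f \<in> l2_closure M (lspan I u)" shows "(\<lambda>x. a * f x) \<in> l2_closure M (lspan I u)"
proof (cases "a = 0")
  case True
  then show ?thesis using l2_closure_base[OF lspan.zero] by simp
next
  case False
  have f: "f \<in> L2 M" using assms by (auto simp: l2_closure_def)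
  show ?thesis
    unfolding l2_closure_def
  proof (intro CollectI conjI allI impI L2_scale f)
    fix e :: real assume e: "e > 0"
    have "e / (cmod a)\<^sup>2 > 0" using e False by simp
    then obtain \<phi> where \<phi>: "\<phi> \<in> lspan I u" "l2sq M (\<lambda>x. f x - \<phi> x) < e / (cmod a)\<^sup>2"
      using assms unfolding l2_closure_def by blast
    have "l2sq M (\<lambda>x. a * f x - a * \<phi> x) < e"
      using \<phi>(2) False l2sq_scale[of M a "\<lambda>x. f x - \<phi> x"] by (simp add: right_diff_distrib pos_less_divide_eq mult.commute)
    then show "\<exists>\<phi>\<in>lspan I u. l2sq M (\<lambda>x. a * f x - \<phi> x) < e"
      using lspan_scale[OF \<phi>(1), of a] by (intro bexI[of _ "\<lambda>x. a * \<phi> x"]) auto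
  qed
qed

lemma l2_closure_sum:
  "(\<And>i. i \<in> A \<Longrightarrow> f i \<in> l2_closure M (lspan I u)) \<Longrightarrow> (\<lambda>x. \<Sum>i\<in>A. f i x) \<in> l2_closure M (lspan I u)"
  by (induction A rule: infinite_finite_induct) (auto intro: l2_closure_add l2_closure_base[OF lspan.zero])

end

section \<open>Density in L2 of a finite measure\<close>

lemma (in finite_measure) L2_indicator: "A \<in> sets M \<Longrightarrow> (indicator A :: _ \<Rightarrow> complex) \<in> L2 M"
proof -
  assume A: "A \<in> sets M"
  have "(\<lambda>x. (cmod (indicator A x))\<^sup>2) = (indicator A :: _ \<Rightarrow> real)" by (auto simp: indicator_def)
  moreover have "integrable M (indicator A :: _ \<Rightarrow> real)"
    using A emeasure_finite[of A] by (intro integrable_real_indicator) (simp_all add: less_top[symmetric])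
  ultimately show ?thesis using A by (simp add: L2_def)
qed

lemma l2sq_indicator: "A \<in> sets M \<Longrightarrow> l2sq M (indicator A) = measure M A"
proof -
  assume A: "A \<in> sets M"
  have "(\<lambda>x. (cmod (indicator A x))\<^sup>2) = (indicator A :: _ \<Rightarrow> real)" by (auto simp: indicator_def)
  then show ?thesis using A sets.sets_into_space[OF A] by (simp add: l2sq_def Int_absorb2)
qed

context finite_measure
begin

text \<open>Dynkin's argument: the sets whose indicator lies in the closure are stable under
  complements and countable disjoint unions. Complements require the indicator of the whole space,
  which need not belong to \<open>E\<close>; it comes from the countable partition
  \<open>V\<close>.\<close>

lemma indicator_dense:
  fixes u :: "'i \<Rightarrow> 'a \<Rightarrow> complex"
  assumes u: "\<And>i. i \<in> I \<Longrightarrow> u i \<in> L2 M"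
    and E: "Int_stable E" "E \<subseteq> Pow (space M)" "sets M = sigma_sets (space M) E"
    and span: "\<And>A. A \<in> E \<Longrightarrow> indicator A \<in> lspan I u"
    and V: "\<And>n. V n \<in> E" "disjoint_family V" "(\<Union>n::nat. V n) = space M"
    and A: "A \<in> sets M"
  shows "indicator A \<in> l2_closure M (lspan I u)"
proof -
  let ?C = "l2_closure M (lspan I u)"
  have diff: "(\<lambda>x. indicator A x - indicator B x :: complex) = indicator (A - B)" if "B \<subseteq> A" for A B :: "'a set"
    using that by (auto simp: indicator_def fun_eq_iff)
  \<comment> \<open>The squared distance from the indicator of the union to the n-th partial sum is
    the measure of the remaining tail, which tends to 0 by countable additivity.\<close>
  have Un: "indicator (\<Union>i. B i) \<in> ?C"
    if B: "\<And>i. B i \<in> sets M" "disjoint_family B" "\<And>i. indicator (B i) \<in> ?C" for B :: "nat \<Rightarrow> 'a set"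
  proof (rule l2_closure_LIMSEQ[OF u])
    show "indicator (\<Union>i. B i) \<in> L2 M" using B by (intro L2_indicator) auto
    show "(\<lambda>x. \<Sum>i<n. indicator (B i) x) \<in> ?C" for n
      using B by (intro l2_closure_sum u) auto
    have s: "(\<lambda>x. \<Sum>i<n. indicator (B i) x :: complex) = indicator (\<Union>i<n. B i)" for n
    proof
      fix x
      show "(\<Sum>i<n. indicator (B i) x :: complex) = indicator (\<Union>i<n. B i) x"
        using B(2) by (intro indicator_UN_disjoint[symmetric]) (auto simp: disjoint_family_on_def)
    qed
    have "l2sq M (\<lambda>x. indicator (\<Union>i. B i) x - (\<Sum>i<n. indicator (B i) x)) = measure M (\<Union>i. B i) - (\<Sum>i<n. measure M (B i))" for n
    proof -
      have "l2sq M (\<lambda>x. indicator (\<Union>i. B i) x - indicator (\<Union>i<n. B i) x) = measure M ((\<Union>i. B i) - (\<Union>i<n. B i))"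
        using B(1) by (subst diff) (auto intro!: l2sq_indicator)
      also have "\<dots> = measure M (\<Union>i. B i) - measure M (\<Union>i<n. B i)"
        using B(1) by (intro finite_measure_Diff) auto
      also have "measure M (\<Union>i<n. B i) = (\<Sum>i<n. measure M (B i))"
        using B by (intro finite_measure_finite_Union) (auto simp: disjoint_family_on_def)
      finally show ?thesis unfolding fun_cong[OF s] .
    qed
    moreover have "(\<lambda>n. measure M (\<Union>i. B i) - (\<Sum>i<n. measure M (B i))) \<longlonglongrightarrow> measure M (\<Union>i. B i) - measure M (\<Union>i. B i)"
      using finite_measure_UNION[of B] B by (intro tendsto_diff tendsto_const) (auto simp: sums_def)
    ultimately show "(\<lambda>n. l2sq M (\<lambda>x. indicator (\<Union>i. B i) x - (\<Sum>i<n. indicator (B i) x))) \<longlonglongrightarrow> 0" by simp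
  qed
  have base: "indicator A \<in> ?C" if "A \<in> E" for A using l2_closure_base[OF u span[OF that]] by simp
  have sp: "indicator (space M) \<in> ?C"
    using Un[of V] V E base by auto
  have "A \<in> sigma_sets (space M) E" using A E by simp
  from E(1,2) this show ?thesis
  proof (induction rule: sigma_sets_induct_disjoint)
    case (basic A)
    then show ?case by (rule base)
  next
    case empty
    have "indicator {} = (\<lambda>_. 0 :: complex)" by auto
    then show ?case using l2_closure_base[OF u lspan.zero] by simp
  next
    case (compl A)
    then have "A \<subseteq> space M" using E(3) sets.sets_into_space by auto
    then have *: "indicator (space M - A) = (\<lambda>x. indicator (space M) x + (-1) * indicator A x :: complex)"
      by (auto simp: indicator_def fun_eq_iff)
    show ?case unfolding * by (rule l2_closure_add[OF u sp l2_closure_scale[OF u compl(2)]])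
  next
    case (union B)
    then show ?case using E(3) by (intro Un) auto
  qed
qed

lemma L2_dense:
  fixes u :: "'i \<Rightarrow> 'a \<Rightarrow> complex"
  assumes u: "\<And>i. i \<in> I \<Longrightarrow> u i \<in> L2 M"
    and ind: "\<And>A. A \<in> sets M \<Longrightarrow> indicator A \<in> l2_closure M (lspan I u)"
    and f: "f \<in> L2 M"
  shows "f \<in> l2_closure M (lspan I u)"
proof -
  obtain F where F: "\<And>i. simple_function M (F i)" "\<And>x. x \<in> space M \<Longrightarrow> (\<lambda>i. F i x) \<longlonglongrightarrow> f x"
      "\<And>i x. x \<in> space M \<Longrightarrow> dist (F i x) 0 \<le> 2 * dist (f x) 0"
    using borel_measurable_implies_sequence_metric[OF L2D(1)[OF f], of 0] by blast
  note [measurable] = borel_measurable_simple_function[OF F(1)] L2D(1)[OF f]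
  have FC: "F i \<in> l2_closure M (lspan I u)" for i
  proof -
    have fin: "finite (F i ` space M)" using simple_functionD(1)[OF F(1)] .
    define g where "g x = (\<Sum>y\<in>F i ` space M. y * indicator (F i -` {y} \<inter> space M) x)" for x
    have g: "g \<in> l2_closure M (lspan I u)"
      unfolding g_def[abs_def]
      using simple_functionD(2)[OF F(1)] by (intro l2_closure_sum u l2_closure_scale ind) auto
    have Fg: "g x = F i x" if "x \<in> space M" for x
    proof -
      have "g x = (\<Sum>y\<in>F i ` space M. if y = F i x then y else 0)"
        unfolding g_def using that by (intro sum.cong) (auto simp: indicator_def)
      then show ?thesis using that fin by simp
    qed
    \<comment> \<open>\<open>g\<close> and \<open>F i\<close> agree only on the space of
      \<open>M\<close>, so membership passes through their L2 distance, which is 0.\<close>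
    show ?thesis
    proof (rule l2_closure_lim[OF u])
      have gL: "g \<in> L2 M" using g by (simp add: l2_closure_def)
      show "F i \<in> L2 M"
      proof (rule L2_bound[OF gL])
        show "AE x in M. cmod (F i x) \<le> cmod (g x)" by (rule AE_I2) (simp add: Fg)
      qed measurable
      have "l2sq M (\<lambda>x. F i x - g x) = (\<integral>x. 0 \<partial>M)"
        unfolding l2sq_def by (rule Bochner_Integration.integral_cong) (simp_all add: Fg)
      then show "\<exists>g\<in>l2_closure M (lspan I u). l2sq M (\<lambda>x. F i x - g x) < e" if "e > 0" for e
        using g that by (intro bexI[of _ g]) auto
    qed
  qed
  show ?thesis
  proof (rule l2_closure_LIMSEQ[OF u f FC])
    have "(\<lambda>n. \<integral>x. (cmod (f x - F n x))\<^sup>2 \<partial>M) \<longlonglongrightarrow> (\<integral>x. 0 \<partial>M)"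
    proof (rule integral_dominated_convergence)
      \<comment> \<open>\<open>F n\<close> is bounded by \<open>2 * cmod f\<close>, hence the
        difference by \<open>3 * cmod f\<close> and its square by 9 times the square.\<close>
      show "integrable M (\<lambda>x. 9 * (cmod (f x))\<^sup>2)" using L2D(2)[OF f] by simp
      show "AE x in M. (\<lambda>n. (cmod (f x - F n x))\<^sup>2) \<longlonglongrightarrow> 0"
      proof (rule AE_I2)
        fix x assume "x \<in> space M"
        then have "(\<lambda>n. (cmod (f x - F n x))\<^sup>2) \<longlonglongrightarrow> (cmod (f x - f x))\<^sup>2" by (intro tendsto_intros F(2))
        then show "(\<lambda>n. (cmod (f x - F n x))\<^sup>2) \<longlonglongrightarrow> 0" by simp
      qed
      show "AE x in M. norm ((cmod (f x - F n x))\<^sup>2) \<le> 9 * (cmod (f x))\<^sup>2" for n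
      proof (rule AE_I2)
        fix x assume "x \<in> space M"
        then have "cmod (f x - F n x) \<le> 3 * cmod (f x)"
          using F(3)[of x n] norm_triangle_ineq4[of "f x" "F n x"] by (simp add: dist_norm)
        then have "(cmod (f x - F n x))\<^sup>2 \<le> (3 * cmod (f x))\<^sup>2" by (intro power_mono) auto
        then show "norm ((cmod (f x - F n x))\<^sup>2) \<le> 9 * (cmod (f x))\<^sup>2" by (simp add: power_mult_distrib)
      qed
    qed measurable
    then show "(\<lambda>n. l2sq M (\<lambda>x. f x - F n x)) \<longlonglongrightarrow> 0" by (simp add: l2sq_def)
  qed
qed

end

section \<open>Extension of isometries\<close>

locale isometry_extension = hilbert sm ip
  for sm :: "complex \<Rightarrow> 'h::ab_group_add \<Rightarrow> 'h" and ip :: "'h \<Rightarrow> 'h \<Rightarrow> complex" +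
  fixes M :: "'p measure" and I :: "'i set" and e :: "'i \<Rightarrow> 'h" and u :: "'i \<Rightarrow> 'p \<Rightarrow> complex"
  assumes fin: "finite_measure M"
    and u_L2: "\<And>i. i \<in> I \<Longrightarrow> u i \<in> L2 M"
    and gram: "\<And>i j. i \<in> I \<Longrightarrow> j \<in> I \<Longrightarrow> ip (e i) (e j) = l2ip M (u i) (u j)"
    and dense_e: "\<And>x \<epsilon>. \<epsilon> > 0 \<Longrightarrow> \<exists>F c. finite F \<and> F \<subseteq> I \<and> nsq (x - (\<Sum>i\<in>F. sm (c i) (e i))) < \<epsilon>"
    and dense_u: "\<And>f. f \<in> L2 M \<Longrightarrow> f \<in> l2_closure M (lspan I u)"
begin

text \<open>The same formal combination evaluated on both sides. It is a relation because the
  \<open>e i\<close> may be linearly dependent: a vector does not determine its combination, and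
  only the equality of the Gram matrices makes partners of equal vectors agree.\<close>

inductive gspan :: "'h \<Rightarrow> ('p \<Rightarrow> complex) \<Rightarrow> bool" where
  zero: "gspan 0 (\<lambda>_. 0)"
| step: "gspan s \<phi> \<Longrightarrow> i \<in> I \<Longrightarrow> gspan (s + sm c (e i)) (\<lambda>x. \<phi> x + c * u i x)"

lemma gspan_L2: "gspan s \<phi> \<Longrightarrow> \<phi> \<in> L2 M"
proof (induction rule: gspan.induct)
  case (step s \<phi> i c)
  then show ?case using L2_add[OF _ L2_scale[of "u i" M c], of \<phi>] u_L2 by simp
qed simp

lemma gspan_add:
  assumes "gspan t \<psi>" "gspan s \<phi>" shows "gspan (s + t) (\<lambda>x. \<phi> x + \<psi> x)"
  using assms
proof (induction rule: gspan.induct)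
  case (step t \<psi> i c)
  then show ?case using gspan.step[of "s + t" "\<lambda>x. \<phi> x + \<psi> x" i c] by (simp add: add.assoc)
qed simp

lemma gspan_scale: "gspan s \<phi> \<Longrightarrow> gspan (sm a s) (\<lambda>x. a * \<phi> x)"
proof (induction rule: gspan.induct)
  case zero
  then show ?case using gspan.zero by simp
next
  case (step s \<phi> i c)
  then show ?case using gspan.step[of "sm a s" "\<lambda>x. a * \<phi> x" i "a * c"]
    by (simp add: algebra_simps sm_add sm_sm)
qed

lemma gspan_gram_base: "gspan s \<phi> \<Longrightarrow> i \<in> I \<Longrightarrow> ip s (e i) = l2ip M \<phi> (u i)"
proof (induction rule: gspan.induct)
  case zero
  then show ?case by (simp add: l2ip_def)
next
  case (step s \<phi> j c)
  then show ?case
    by (simp add: ip_add_left ip_sm_left gram l2ip_add_left[OF gspan_L2[OF step(1)] L2_scale[OF u_L2] u_L2] l2ip_scale_left)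
qed

lemma gspan_gram: "gspan t \<psi> \<Longrightarrow> gspan s \<phi> \<Longrightarrow> ip s t = l2ip M \<phi> \<psi>"
proof (induction rule: gspan.induct)
  case zero
  then show ?case by (simp add: l2ip_def)
next
  case (step t \<psi> j c)
  then show ?case
    by (simp add: ip_add_right ip_sm_right gspan_gram_base
        l2ip_add_right[OF gspan_L2[OF step(1)] L2_scale[OF u_L2] gspan_L2] l2ip_scale_right)
qed

lemma gspan_nsq: "gspan s \<phi> \<Longrightarrow> nsq s = l2sq M \<phi>"
  using gspan_gram[of s \<phi> s \<phi>] by (simp add: ip_self l2ip_self)

lemma gspan_lspan: "\<phi> \<in> lspan I u \<Longrightarrow> \<exists>s. gspan s \<phi>"
  by (induction rule: lspan.induct) (auto intro: gspan.intros)

lemma gspan_sum: "finite F \<Longrightarrow> F \<subseteq> I \<Longrightarrow> gspan (\<Sum>i\<in>F. sm (c i) (e i)) (\<lambda>x. \<Sum>i\<in>F. c i * u i x)"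
proof (induction F rule: finite_induct)
  case empty
  then show ?case by (simp add: gspan.zero)
next
  case (insert i F)
  then show ?case using gspan.step[of "\<Sum>i\<in>F. sm (c i) (e i)" "\<lambda>x. \<Sum>i\<in>F. c i * u i x" i "c i"]
    by (simp add: add.commute)
qed

lemma gspan_base: "i \<in> I \<Longrightarrow> gspan (e i) (u i)"
  using gspan.step[OF gspan.zero, of i 1] by simp

text \<open>The graph of the unitary to be constructed: the closure of \<open>gspan\<close>.\<close>

definition rel :: "'h \<Rightarrow> ('p \<Rightarrow> complex) \<Rightarrow> bool" where
  "rel x g \<longleftrightarrow> g \<in> L2 M \<and> (\<forall>\<epsilon>>0. \<exists>s \<phi>. gspan s \<phi> \<and> nsq (x - s) < \<epsilon> \<and> l2sq M (\<lambda>p. g p - \<phi> p) < \<epsilon>)"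

lemma rel_L2: "rel x g \<Longrightarrow> g \<in> L2 M" by (simp add: rel_def)

lemma relE:
  assumes "rel x g" "\<epsilon> > 0"
  obtains s \<phi> where "gspan s \<phi>" "nsq (x - s) < \<epsilon>" "l2sq M (\<lambda>p. g p - \<phi> p) < \<epsilon>"
  using assms unfolding rel_def by blast

lemma rel_gspan: "gspan s \<phi> \<Longrightarrow> rel s \<phi>"
  unfolding rel_def by (auto simp: gspan_L2 l2sq_def intro!: exI[of _ s] exI[of _ \<phi>])

lemma rel_closed:
  assumes g: "g \<in> L2 M" and "\<And>\<epsilon>. \<epsilon> > 0 \<Longrightarrow> \<exists>y h. rel y h \<and> nsq (x - y) < \<epsilon> \<and> l2sq M (\<lambda>p. g p - h p) < \<epsilon>"
  shows "rel x g"
  unfolding rel_def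
proof (intro conjI allI impI g)
  fix \<epsilon> :: real assume \<epsilon>: "\<epsilon> > 0"
  obtain y h where y: "rel y h" "nsq (x - y) < \<epsilon>/4" "l2sq M (\<lambda>p. g p - h p) < \<epsilon>/4"
    using assms(2)[of "\<epsilon>/4"] \<epsilon> by auto
  obtain s \<phi> where s: "gspan s \<phi>" "nsq (y - s) < \<epsilon>/4" "l2sq M (\<lambda>p. h p - \<phi> p) < \<epsilon>/4"
    using relE[OF y(1), of "\<epsilon>/4"] \<epsilon> by auto
  have "nsq (x - s) < \<epsilon>" using nsq_add_le[of "x - y" "y - s"] y s by simp
  moreover have "l2sq M (\<lambda>p. g p - \<phi> p) < \<epsilon>"
    using l2sq_triangle[OF g rel_L2[OF y(1)] gspan_L2[OF s(1)]] y s by simp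
  ultimately show "\<exists>s \<phi>. gspan s \<phi> \<and> nsq (x - s) < \<epsilon> \<and> l2sq M (\<lambda>p. g p - \<phi> p) < \<epsilon>" using s by blast
qed

lemma rel_add:
  assumes "rel x g" "rel y h" shows "rel (x + y) (\<lambda>p. g p + h p)"
proof (rule rel_closed)
  note L = rel_L2[OF assms(1)] rel_L2[OF assms(2)]
  show "(\<lambda>p. g p + h p) \<in> L2 M" using L by (rule L2_add)
  fix \<epsilon> :: real assume \<epsilon>: "\<epsilon> > 0"
  obtain s \<phi> where s: "gspan s \<phi>" "nsq (x - s) < \<epsilon>/4" "l2sq M (\<lambda>p. g p - \<phi> p) < \<epsilon>/4"
    using relE[OF assms(1), of "\<epsilon>/4"] \<epsilon> by auto
  obtain t \<psi> where t: "gspan t \<psi>" "nsq (y - t) < \<epsilon>/4" "l2sq M (\<lambda>p. h p - \<psi> p) < \<epsilon>/4"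
    using relE[OF assms(2), of "\<epsilon>/4"] \<epsilon> by auto
  have "nsq ((x + y) - (s + t)) < \<epsilon>"
    using nsq_add_le[of "x - s" "y - t"] s t by (simp add: algebra_simps)
  moreover have "l2sq M (\<lambda>p. (g p + h p) - (\<phi> p + \<psi> p)) < \<epsilon>"
    using l2sq_add_le[OF L2_diff[OF L(1) gspan_L2[OF s(1)]] L2_diff[OF L(2) gspan_L2[OF t(1)]]] s t
    by (simp add: algebra_simps)
  ultimately show "\<exists>z k. rel z k \<and> nsq (x + y - z) < \<epsilon> \<and> l2sq M (\<lambda>p. g p + h p - k p) < \<epsilon>"
    using rel_gspan[OF gspan_add[OF t(1) s(1)]] by blast
qed

lemma rel_scale:
  assumes "rel x g" shows "rel (sm a x) (\<lambda>p. a * g p)"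
proof (cases "a = 0")
  case True
  then show ?thesis using rel_gspan[OF gspan.zero] by simp
next
  case False
  show ?thesis
  proof (rule rel_closed)
    show "(\<lambda>p. a * g p) \<in> L2 M" using rel_L2[OF assms] by (rule L2_scale)
    fix \<epsilon> :: real assume "\<epsilon> > 0"
    then have "\<epsilon> / (cmod a)\<^sup>2 > 0" using False by simp
    from relE[OF assms this] obtain s \<phi> where s: "gspan s \<phi>" "nsq (x - s) < \<epsilon> / (cmod a)\<^sup>2"
      "l2sq M (\<lambda>p. g p - \<phi> p) < \<epsilon> / (cmod a)\<^sup>2" .
    have "nsq (sm a x - sm a s) < \<epsilon>"
      using s(2) False by (simp add: sm_diff[symmetric] nsq_sm pos_less_divide_eq mult.commute)
    moreover have "l2sq M (\<lambda>p. a * g p - a * \<phi> p) < \<epsilon>"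
      using s(3) False l2sq_scale[of M a "\<lambda>p. g p - \<phi> p"] by (simp add: right_diff_distrib pos_less_divide_eq mult.commute)
    ultimately show "\<exists>y h. rel y h \<and> nsq (sm a x - y) < \<epsilon> \<and> l2sq M (\<lambda>p. a * g p - h p) < \<epsilon>"
      using rel_gspan[OF gspan_scale[OF s(1)]] by blast
  qed
qed

lemma rel_diff: "rel x g \<Longrightarrow> rel y h \<Longrightarrow> rel (x - y) (\<lambda>p. g p - h p)"
  using rel_add[of x g "sm (-1) y" "\<lambda>p. (-1) * h p"] rel_scale[of y h "-1"] by (simp add: sm_minus_left)

text \<open>On \<open>gspan\<close> both norms agree. Each norm is compared with the other through
  one approximating pair, which costs two applications of the \<delta>-inequality, and then the
  accuracy is sent to 0.\<close>

lemma rel_nsq: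
  assumes "rel x g" shows "l2sq M g = nsq x"
proof -
  note g = rel_L2[OF assms]
  \<comment> \<open>The bound obtained from two applications of the \<delta>-inequality with
    \<delta> = \<open>d\<close>. The pair is taken within \<open>d\<^sup>2\<close>, so that the
    error \<open>(1 + 1/d) * d\<^sup>2 = d\<^sup>2 + d\<close> still vanishes in the limit.\<close>
  let ?b = "\<lambda>c d. (1 + d) * ((1 + d) * c + (d\<^sup>2 + d)) + (d\<^sup>2 + d)"
  have lim: "((\<lambda>d. ?b c d) \<longlongrightarrow> c) (at_right 0)" for c :: real
    by (rule tendsto_eq_intros refl | simp)+
  have *: "nsq x \<le> ?b (l2sq M g) d \<and> l2sq M g \<le> ?b (nsq x) d" if d: "d > 0" for d
  proof -
    obtain s \<phi> where s: "gspan s \<phi>" "nsq (x - s) < d\<^sup>2" "l2sq M (\<lambda>p. g p - \<phi> p) < d\<^sup>2"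
      using relE[OF assms, of "d\<^sup>2"] d by auto
    note \<phi> = gspan_L2[OF s(1)]
    have m: "(1 + 1/d) * r \<le> d\<^sup>2 + d" if "r < d\<^sup>2" for r
    proof -
      have "(1 + 1/d) * r \<le> (1 + 1/d) * d\<^sup>2" using d that by (intro mult_left_mono) auto
      also have "\<dots> = d\<^sup>2 + d" using d by (simp add: field_simps power2_eq_square)
      finally show ?thesis .
    qed
    have 1: "nsq x \<le> (1 + d) * nsq s + (d\<^sup>2 + d)"
      using nsq_add_le_delta[OF d, of s "x - s"] m[OF s(2)] by simp
    have 2: "nsq s \<le> (1 + d) * nsq x + (d\<^sup>2 + d)"
      using nsq_add_le_delta[OF d, of x "s - x"] m[OF s(2)] by (simp add: nsq_diff_commute[of s x])
    have 3: "l2sq M g \<le> (1 + d) * l2sq M \<phi> + (d\<^sup>2 + d)"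
      using l2sq_add_le_delta[OF d \<phi> L2_diff[OF g \<phi>]] m[OF s(3)] by simp
    have 4: "l2sq M \<phi> \<le> (1 + d) * l2sq M g + (d\<^sup>2 + d)"
      using l2sq_add_le_delta[OF d g L2_diff[OF \<phi> g]] m[OF s(3)] by (simp add: l2sq_diff_commute[of M \<phi> g])
    have "(1 + d) * nsq s \<le> (1 + d) * ((1 + d) * nsq x + (d\<^sup>2 + d))" using 2 d by (intro mult_left_mono) auto
    moreover have "(1 + d) * l2sq M \<phi> \<le> (1 + d) * ((1 + d) * l2sq M g + (d\<^sup>2 + d))" using 4 d by (intro mult_left_mono) auto
    ultimately show ?thesis using 1 3 unfolding gspan_nsq[OF s(1)] by (intro conjI) linarith+
  qed
  have "nsq x \<le> l2sq M g"
    by (rule tendsto_lowerbound[OF lim]) (use * in \<open>auto simp: eventually_at_filter\<close>)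
  moreover have "l2sq M g \<le> nsq x"
    by (rule tendsto_lowerbound[OF lim]) (use * in \<open>auto simp: eventually_at_filter\<close>)
  ultimately show ?thesis by simp
qed

text \<open>By linearity the difference of \<open>g\<close> and \<open>h\<close> is related to 0, so
  it has norm 0.\<close>

lemma rel_unique: "rel x g \<Longrightarrow> rel x h \<Longrightarrow> AE p in M. g p = h p"
  using rel_nsq[OF rel_diff[of x g x h]] l2sq_eq_0_AE[OF rel_L2[OF rel_diff[of x g x h]]] by simp

lemma rel_AE_cong:
  assumes "rel x g" "h \<in> borel_measurable M" "AE p in M. g p = h p" shows "rel x h"
proof (rule rel_closed)
  show h: "h \<in> L2 M" by (rule L2_bound[OF rel_L2[OF assms(1)] assms(2)]) (use assms(3) in auto)
  have "l2sq M (\<lambda>p. h p - g p) = l2sq M (\<lambda>p. 0)"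
    using L2D(1)[OF L2_diff[OF h rel_L2[OF assms(1)]]] assms(3) by (intro l2sq_cong_AE) auto
  then show "\<exists>y k. rel y k \<and> nsq (x - y) < \<epsilon> \<and> l2sq M (\<lambda>p. h p - k p) < \<epsilon>" if "\<epsilon> > 0" for \<epsilon>
    using assms(1) that by (intro exI[of _ x] exI[of _ g]) (simp add: l2sq_def)
qed

text \<open>Polarisation: the norm of a sum yields the real parts, and multiplying by \<i> the
  imaginary ones.\<close>

lemma rel_ip:
  assumes x: "rel x g" and y: "rel y h" shows "l2ip M g h = ip x y"
proof -
  have Re: "Re (l2ip M g h) = Re (ip x y)" if x: "rel x g" for x g
    using rel_nsq[OF rel_add[OF x y]] rel_nsq[OF x] rel_nsq[OF y]
    by (simp add: l2sq_add rel_L2[OF x] rel_L2[OF y] nsq_add)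
  show ?thesis using Re[OF x] Re[OF rel_scale[OF x, of \<i>]]
    by (simp add: complex_eq_iff l2ip_scale_left ip_sm_left)
qed

text \<open>The unitary is defined everywhere: the partners of approximants of \<open>x\<close> form
  a Cauchy sequence because related pairs have equal norms, and \<open>L2 M\<close> is
  complete.\<close>

lemma rel_exists_right: "\<exists>g. rel x g"
proof -
  have "\<exists>s \<phi>. gspan s \<phi> \<and> nsq (x - s) < 1 / real (Suc n)" for n
  proof -
    have "1 / real (Suc n) > 0" by simp
    from dense_e[OF this] obtain F c
      where F: "finite F" "F \<subseteq> I" "nsq (x - (\<Sum>i\<in>F. sm (c i) (e i))) < 1 / real (Suc n)" by blast
    show ?thesis using gspan_sum[OF F(1,2)] F(3) by blast
  qed
  then obtain s \<phi> where s: "\<And>n. gspan (s n) (\<phi> n)" "\<And>n. nsq (x - s n) < 1 / real (Suc n)" by metis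
  have \<phi>d: "l2sq M (\<lambda>p. \<phi> m p - \<phi> n p) = nsq (s m - s n)" for m n
    using rel_nsq[OF rel_diff[OF rel_gspan[OF s(1)] rel_gspan[OF s(1)]]] .
  have "\<exists>g\<in>L2 M. (\<lambda>n. l2sq M (\<lambda>p. \<phi> n p - g p)) \<longlonglongrightarrow> 0"
  proof (rule L2_complete[OF fin gspan_L2[OF s(1)]])
    fix \<epsilon> :: real assume \<epsilon>: "\<epsilon> > 0"
    obtain N where N: "1 / real (Suc N) < \<epsilon>/4" using nat_approx_posE[of "\<epsilon>/4"] \<epsilon> by auto
    have "l2sq M (\<lambda>p. \<phi> m p - \<phi> n p) < \<epsilon>" if "m \<ge> N" "n \<ge> N" for m n
    proof -
      have "1 / real (Suc m) \<le> 1 / real (Suc N)" "1 / real (Suc n) \<le> 1 / real (Suc N)"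
        using that by (auto simp: frac_le)
      then show ?thesis using nsq_add_le[of "s m - x" "x - s n"] s(2)[of m] s(2)[of n] N
        by (simp add: \<phi>d nsq_diff_commute[of "s m" x])
    qed
    then show "\<exists>N. \<forall>m\<ge>N. \<forall>n\<ge>N. l2sq M (\<lambda>p. \<phi> m p - \<phi> n p) < \<epsilon>" by blast
  qed
  then obtain g where g: "g \<in> L2 M" "(\<lambda>n. l2sq M (\<lambda>p. \<phi> n p - g p)) \<longlonglongrightarrow> 0" by blast
  have "rel x g" unfolding rel_def
  proof (intro conjI allI impI g)
    fix \<epsilon> :: real assume \<epsilon>: "\<epsilon> > 0"
    obtain N where N: "1 / real (Suc N) < \<epsilon>" using nat_approx_posE[of \<epsilon>] \<epsilon> by auto
    obtain N' where N': "\<And>n. n \<ge> N' \<Longrightarrow> l2sq M (\<lambda>p. \<phi> n p - g p) < \<epsilon>"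
      using LIMSEQ_D[OF g(2) \<epsilon>] by auto
    let ?n = "max N N'"
    have "1 / real (Suc ?n) \<le> 1 / real (Suc N)" by (auto simp: frac_le)
    then have "nsq (x - s ?n) < \<epsilon>" using s(2)[of ?n] N by linarith
    then show "\<exists>s \<phi>. gspan s \<phi> \<and> nsq (x - s) < \<epsilon> \<and> l2sq M (\<lambda>p. g p - \<phi> p) < \<epsilon>"
      using s(1)[of ?n] N'[of ?n] l2sq_diff_commute[of M "\<phi> ?n" g] by auto
  qed
  then show ?thesis by blast
qed

text \<open>The mirror image, from the density of the \<open>u i\<close> and the completeness of the
  Hilbert space; this is the surjectivity of the unitary.\<close>

lemma rel_exists_left:
  assumes g: "g \<in> L2 M" shows "\<exists>x. rel x g"
proof -
  have "\<exists>s \<phi>. gspan s \<phi> \<and> l2sq M (\<lambda>p. g p - \<phi> p) < 1 / real (Suc n)" for n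
  proof -
    have "1 / real (Suc n) > 0" by simp
    then obtain \<phi> where "\<phi> \<in> lspan I u" "l2sq M (\<lambda>p. g p - \<phi> p) < 1 / real (Suc n)"
      using dense_u[OF g] unfolding l2_closure_def by blast
    then show ?thesis using gspan_lspan by blast
  qed
  then obtain s \<phi> where s: "\<And>n. gspan (s n) (\<phi> n)" "\<And>n. l2sq M (\<lambda>p. g p - \<phi> n p) < 1 / real (Suc n)" by metis
  have \<phi>d: "nsq (s m - s n) = l2sq M (\<lambda>p. \<phi> m p - \<phi> n p)" for m n
    using rel_nsq[OF rel_diff[OF rel_gspan[OF s(1)] rel_gspan[OF s(1)]]] by simp
  have "\<exists>x. (\<lambda>n. nsq (s n - x)) \<longlonglongrightarrow> 0"
  proof (rule nsq_complete)
    fix \<epsilon> :: real assume \<epsilon>: "\<epsilon> > 0"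
    obtain N where N: "1 / real (Suc N) < \<epsilon>/4" using nat_approx_posE[of "\<epsilon>/4"] \<epsilon> by auto
    have "nsq (s m - s n) < \<epsilon>" if "m \<ge> N" "n \<ge> N" for m n
    proof -
      have "1 / real (Suc m) \<le> 1 / real (Suc N)" "1 / real (Suc n) \<le> 1 / real (Suc N)"
        using that by (auto simp: frac_le)
      then show ?thesis using l2sq_triangle[OF gspan_L2[OF s(1)] g gspan_L2[OF s(1)], of m n] s(2)[of m] s(2)[of n] N
        by (simp add: \<phi>d l2sq_diff_commute[of M "\<phi> m" g])
    qed
    then show "\<exists>N. \<forall>m\<ge>N. \<forall>n\<ge>N. nsq (s m - s n) < \<epsilon>" by blast
  qed
  then obtain x where x: "(\<lambda>n. nsq (s n - x)) \<longlonglongrightarrow> 0" by blast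
  have "rel x g" unfolding rel_def
  proof (intro conjI allI impI g)
    fix \<epsilon> :: real assume \<epsilon>: "\<epsilon> > 0"
    obtain N where N: "1 / real (Suc N) < \<epsilon>" using nat_approx_posE[of \<epsilon>] \<epsilon> by auto
    obtain N' where N': "\<And>n. n \<ge> N' \<Longrightarrow> nsq (s n - x) < \<epsilon>"
      using LIMSEQ_D[OF x \<epsilon>] by auto
    let ?n = "max N N'"
    have "1 / real (Suc ?n) \<le> 1 / real (Suc N)" by (auto simp: frac_le)
    then have "l2sq M (\<lambda>p. g p - \<phi> ?n p) < \<epsilon>" using s(2)[of ?n] N by linarith
    then show "\<exists>s \<phi>. gspan s \<phi> \<and> nsq (x - s) < \<epsilon> \<and> l2sq M (\<lambda>p. g p - \<phi> p) < \<epsilon>"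
      using s(1)[of ?n] N'[of ?n] nsq_diff_commute[of "s ?n" x] by auto
  qed
  then show ?thesis by blast
qed

text \<open>A choice of representative, since the image function is determined only up to a null
  set.\<close>

definition U :: "'h \<Rightarrow> 'p \<Rightarrow> complex" where "U x = (SOME g. rel x g)"

lemma rel_U: "rel x (U x)"
  unfolding U_def using rel_exists_right by (rule someI_ex)

lemma U_AE_eq: "rel x g \<Longrightarrow> AE p in M. U x p = g p"
  using rel_unique[OF rel_U] .

lemma U_L2: "U x \<in> L2 M" by (rule rel_L2[OF rel_U])

text \<open>Two bounded linear operators that correspond on the generators correspond everywhere,
  because the graph \<open>rel\<close> is closed. It is applied to the range projections and to the
  operators \<open>t l\<close>.\<close>

lemma rel_intertwine:
  assumes T_add: "\<And>x y. T (x + y) = T x + T y" and T_sm: "\<And>a x. T (sm a x) = sm a (T x)"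
    and T_bound: "\<And>x. nsq (T x) \<le> C * nsq x"
    and S_L2: "\<And>f. f \<in> L2 M \<Longrightarrow> S f \<in> L2 M"
    and S_add: "\<And>f g. S (\<lambda>p. f p + g p) = (\<lambda>p. S f p + S g p)" and S_scale: "\<And>a f. S (\<lambda>p. a * f p) = (\<lambda>p. a * S f p)"
    and S_bound: "\<And>f. f \<in> L2 M \<Longrightarrow> l2sq M (S f) \<le> C * l2sq M f"
    and base: "\<And>i. i \<in> I \<Longrightarrow> rel (T (e i)) (S (u i))"
    and x: "rel x g"
  shows "rel (T x) (S g)"
proof (rule rel_closed)
  have T0: "T 0 = 0" using T_add[of 0 0] by simp
  have T_diff: "T (x - y) = T x - T y" for x y
    using T_add[of "x - y" y] by (simp add: algebra_simps)
  have S0: "S (\<lambda>_. 0) = (\<lambda>_. 0)" using S_scale[of 0 "\<lambda>_. 0"] by simp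
  have S_diff: "S (\<lambda>p. f p - g p) = (\<lambda>p. S f p - S g p)" for f g
    using S_add[of f "\<lambda>p. (-1) * g p"] unfolding S_scale by simp
  show "S g \<in> L2 M" using rel_L2[OF x] by (rule S_L2)
  have span: "rel (T s) (S \<phi>)" if "gspan s \<phi>" for s \<phi>
    using that
  proof (induction rule: gspan.induct)
    case zero
    then show ?case using rel_gspan[OF gspan.zero] by (simp add: T0 S0)
  next
    case (step s \<phi> i c)
    then show ?case using rel_add[OF step(3) rel_scale[OF base]] by (simp add: T_add T_sm S_add S_scale)
  qed
  fix \<epsilon> :: real assume \<epsilon>: "\<epsilon> > 0"
  \<comment> \<open>\<open>C\<close> may be zero or negative, hence the scaling by the positive
    number \<open>\<bar>C\<bar> + 1\<close>.\<close>
  define d where "d = \<epsilon> / (\<bar>C\<bar> + 1)"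
  have d: "d > 0" using \<epsilon> by (simp add: d_def)
  have Cd: "C * r < \<epsilon>" if "r < d" "r \<ge> 0" for r
  proof -
    have "C * r \<le> (\<bar>C\<bar> + 1) * r" using that by (intro mult_right_mono) auto
    also have "\<dots> < (\<bar>C\<bar> + 1) * d" using that by (intro mult_strict_left_mono) auto
    also have "\<dots> = \<epsilon>" by (simp add: d_def)
    finally show ?thesis .
  qed
  obtain s \<phi> where s: "gspan s \<phi>" "nsq (x - s) < d" "l2sq M (\<lambda>p. g p - \<phi> p) < d"
    using relE[OF x d] .
  have "nsq (T x - T s) < \<epsilon>" using T_bound[of "x - s"] Cd[OF s(2)] by (simp add: T_diff)
  moreover have "l2sq M (\<lambda>p. S g p - S \<phi> p) < \<epsilon>"
    using S_bound[OF L2_diff[OF rel_L2[OF x] gspan_L2[OF s(1)]]] Cd[OF s(3)] by (simp add: S_diff)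
  ultimately show "\<exists>y h. rel y h \<and> nsq (T x - y) < \<epsilon> \<and> l2sq M (\<lambda>p. S g p - h p) < \<epsilon>"
    using span[OF s(1)] by blast
qed

end

section \<open>Factorisation in k-graphs\<close>

definition diag :: "nat \<Rightarrow> nat \<Rightarrow> nat \<Rightarrow> nat" where
  "diag k n = (\<lambda>i. if i < k then n else 0)"

lemma diag_NK [simp]: "diag k n \<in> NK k"
  by (auto simp: diag_def NK_def)

lemma vzero_NK [simp]: "vzero \<in> NK k"
  by (auto simp: vzero_def NK_def)

lemma vadd_NK [simp]: "m \<in> NK k \<Longrightarrow> n \<in> NK k \<Longrightarrow> vadd m n \<in> NK k"
  by (auto simp: vadd_def NK_def)

lemma vsub_NK [simp]: "m \<in> NK k \<Longrightarrow> vsub m n \<in> NK k"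
  by (auto simp: vsub_def NK_def)

lemma NK_downward: "n \<in> NK k \<Longrightarrow> m \<le> n \<Longrightarrow> m \<in> NK k"
  by (auto simp: NK_def le_fun_def) (metis le_zero_eq)

lemma vzero_le [simp]: "vzero \<le> n"
  by (auto simp: vzero_def le_fun_def)

lemma vadd_vzero [simp]: "vadd m vzero = m" "vadd vzero m = m"
  by (auto simp: vadd_def vzero_def)

lemma vadd_assoc: "vadd (vadd m n) p = vadd m (vadd n p)"
  by (auto simp: vadd_def add.assoc)

lemma vadd_commute: "vadd m n = vadd n m"
  by (auto simp: vadd_def add.commute)

lemma vadd_left_cancel [simp]: "vadd m n = vadd m p \<longleftrightarrow> n = p"
  by (auto simp: vadd_def fun_eq_iff)

lemma le_vadd [simp]: "m \<le> vadd m n" "n \<le> vadd m n"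
  by (auto simp: vadd_def le_fun_def)

lemma vadd_mono [simp]: "vadd m n \<le> vadd m p \<longleftrightarrow> n \<le> p" "vadd n m \<le> vadd p m \<longleftrightarrow> n \<le> p"
  by (auto simp: vadd_def le_fun_def)

lemma vsub_vadd [simp]: "vsub (vadd m n) m = n" "vsub (vadd n m) m = n"
  by (auto simp: vadd_def vsub_def)

lemma vadd_vsub: "m \<le> n \<Longrightarrow> vadd m (vsub n m) = n"
  by (auto simp: vadd_def vsub_def le_fun_def fun_eq_iff)

lemma vsub_vzero [simp]: "vsub m vzero = m"
  by (auto simp: vsub_def vzero_def)

lemma vadd_eq_self: "vadd m n = m \<Longrightarrow> n = vzero"
  by (auto simp: vadd_def vzero_def fun_eq_iff)

lemma diag_mono: "m \<le> n \<Longrightarrow> diag k m \<le> diag k n"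
  by (auto simp: diag_def le_fun_def)

lemma diag_0 [simp]: "diag k 0 = vzero"
  by (auto simp: diag_def vzero_def)

lemma diag_Suc: "diag k (Suc n) = vadd (diag k n) (diag k 1)"
  by (auto simp: diag_def vadd_def fun_eq_iff)

text \<open>The multiples of (1, ..., 1) are cofinal in N^k, so a single sequence of degrees can
  replace the whole partially ordered set. The sum of the coordinates is a crude bound for each of
  them.\<close>

lemma diag_cofinal:
  assumes "n \<in> NK k" obtains N where "n \<le> diag k N"
proof
  show "n \<le> diag k (\<Sum>i<k. n i)"
    using assms by (auto simp: le_fun_def diag_def NK_def intro!: member_le_sum)
qed

lemma NK_upper_bound:
  assumes "finite A" "A \<subseteq> NK k" obtains N where "\<And>n. n \<in> A \<Longrightarrow> n \<le> diag k N"
proof -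
  have "\<exists>N. \<forall>n\<in>A. n \<le> diag k N" using assms
  proof (induction rule: finite_induct)
    case (insert a A)
    then obtain N where N: "\<forall>n\<in>A. n \<le> diag k N" by auto
    obtain M where M: "a \<le> diag k M" using diag_cofinal insert by blast
    have "\<forall>n\<in>insert a A. n \<le> diag k (max N M)"
      using N M diag_mono[of N "max N M" k] diag_mono[of M "max N M" k] by (auto intro: order_trans)
    then show ?case by blast
  qed auto
  then show thesis using that by blast
qed

text \<open>Both \<open>initial\<close> and \<open>final\<close> are meaningful only for \<open>p \<le> deg G l\<close>.\<close>

definition initial :: "'a kgraph \<Rightarrow> 'a \<Rightarrow> (nat \<Rightarrow> nat) \<Rightarrow> 'a" where
  "initial G l p = (THE a. a \<in> mor G \<and> deg G a = p \<and> (\<exists>b\<in>mor G. src G a = rng G b \<and> l = cmp G a b))"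

definition final :: "'a kgraph \<Rightarrow> 'a \<Rightarrow> (nat \<Rightarrow> nat) \<Rightarrow> 'a" where
  "final G l p = (THE b. b \<in> mor G \<and> (\<exists>a\<in>mor G. deg G a = p \<and> src G a = rng G b \<and> l = cmp G a b))"

text \<open>For \<open>p\<close> above the degree of \<open>l\<close> these are the paths of degree
  \<open>p\<close> that begin with \<open>l\<close>: the descendants of \<open>l\<close> in a tree
  of paths. Their cylinders partition that of \<open>l\<close>.\<close>

definition exts :: "'a kgraph \<Rightarrow> 'a \<Rightarrow> (nat \<Rightarrow> nat) \<Rightarrow> 'a set" where
  "exts G l p = {a \<in> mor G. deg G a = p \<and> initial G a (deg G l) = l}"

section \<open>Consequences of unique factorisation\<close>

locale row_finite_kgraph =
  fixes k :: nat and G :: "'a kgraph"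
  assumes kgraph: "is_kgraph k G" and row_finite: "row_finite k G" and no_sources: "no_sources k G"
begin

lemma kgraph_conjuncts:
  "countable (mor G)" "obj G \<subseteq> mor G"
  "\<forall>l\<in>mor G. rng G l \<in> obj G \<and> src G l \<in> obj G"
  "\<forall>v\<in>obj G. rng G v = v \<and> src G v = v"
  "\<forall>l\<in>mor G. \<forall>m\<in>mor G. src G l = rng G m \<longrightarrow>
     cmp G l m \<in> mor G \<and> rng G (cmp G l m) = rng G l \<and> src G (cmp G l m) = src G m"
  "\<forall>l\<in>mor G. cmp G (rng G l) l = l \<and> cmp G l (src G l) = l"
  "\<forall>l\<in>mor G. \<forall>m\<in>mor G. \<forall>n\<in>mor G. src G l = rng G m \<longrightarrow> src G m = rng G n \<longrightarrow>
     cmp G (cmp G l m) n = cmp G l (cmp G m n)"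
  "\<forall>l\<in>mor G. deg G l \<in> NK k"
  "\<forall>l\<in>mor G. \<forall>m\<in>mor G. src G l = rng G m \<longrightarrow>
     deg G (cmp G l m) = vadd (deg G l) (deg G m)"
  "\<forall>l\<in>mor G. \<forall>m\<in>NK k. \<forall>n\<in>NK k. deg G l = vadd m n \<longrightarrow>
     (\<exists>!p. fst p \<in> mor G \<and> snd p \<in> mor G \<and> src G (fst p) = rng G (snd p) \<and>
           l = cmp G (fst p) (snd p) \<and> deg G (fst p) = m \<and> deg G (snd p) = n)"
  by (insert kgraph[unfolded is_kgraph_def]; (elim conjE)?; assumption)+

lemmas countable_mor = kgraph_conjuncts(1)
lemmas obj_mor = subsetD[OF kgraph_conjuncts(2)]
lemma rng_obj [simp]: "l \<in> mor G \<Longrightarrow> rng G l \<in> obj G" using kgraph_conjuncts(3) by blast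
lemma src_obj [simp]: "l \<in> mor G \<Longrightarrow> src G l \<in> obj G" using kgraph_conjuncts(3) by blast
lemma rng_id [simp]: "v \<in> obj G \<Longrightarrow> rng G v = v" using kgraph_conjuncts(4) by blast
lemma src_id [simp]: "v \<in> obj G \<Longrightarrow> src G v = v" using kgraph_conjuncts(4) by blast
lemma cmp_mor [simp]: "l \<in> mor G \<Longrightarrow> m \<in> mor G \<Longrightarrow> src G l = rng G m \<Longrightarrow> cmp G l m \<in> mor G"
  using kgraph_conjuncts(5) by blast
lemma rng_cmp [simp]: "l \<in> mor G \<Longrightarrow> m \<in> mor G \<Longrightarrow> src G l = rng G m \<Longrightarrow> rng G (cmp G l m) = rng G l"
  using kgraph_conjuncts(5) by blast
lemma src_cmp [simp]: "l \<in> mor G \<Longrightarrow> m \<in> mor G \<Longrightarrow> src G l = rng G m \<Longrightarrow> src G (cmp G l m) = src G m"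
  using kgraph_conjuncts(5) by blast
lemma cmp_rng [simp]: "l \<in> mor G \<Longrightarrow> cmp G (rng G l) l = l" using kgraph_conjuncts(6) by blast
lemma cmp_src [simp]: "l \<in> mor G \<Longrightarrow> cmp G l (src G l) = l" using kgraph_conjuncts(6) by blast
lemma cmp_assoc: "l \<in> mor G \<Longrightarrow> m \<in> mor G \<Longrightarrow> n \<in> mor G \<Longrightarrow> src G l = rng G m \<Longrightarrow> src G m = rng G n
    \<Longrightarrow> cmp G (cmp G l m) n = cmp G l (cmp G m n)"
  using kgraph_conjuncts(7) by blast
lemma deg_NK [simp]: "l \<in> mor G \<Longrightarrow> deg G l \<in> NK k" using kgraph_conjuncts(8) by blast
lemma deg_cmp [simp]: "l \<in> mor G \<Longrightarrow> m \<in> mor G \<Longrightarrow> src G l = rng G m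
    \<Longrightarrow> deg G (cmp G l m) = vadd (deg G l) (deg G m)"
  using kgraph_conjuncts(9) by blast

lemma factor_ex1:
  "l \<in> mor G \<Longrightarrow> m \<in> NK k \<Longrightarrow> n \<in> NK k \<Longrightarrow> deg G l = vadd m n \<Longrightarrow>
   \<exists>!p. fst p \<in> mor G \<and> snd p \<in> mor G \<and> src G (fst p) = rng G (snd p) \<and>
        l = cmp G (fst p) (snd p) \<and> deg G (fst p) = m \<and> deg G (snd p) = n"
  by (rule kgraph_conjuncts(10)[rule_format])

lemma Ex1_unique: "\<exists>!x. P x \<Longrightarrow> P a \<Longrightarrow> P b \<Longrightarrow> a = b"
  by blast

text \<open>Equal degrees of the first factors force equal degrees of the second ones, since degrees
  add and cancel; then the factorisation axiom applies.\<close>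

lemma factor_unique:
  assumes "a \<in> mor G" "b \<in> mor G" "a' \<in> mor G" "b' \<in> mor G" "src G a = rng G b" "src G a' = rng G b'"
    "cmp G a b = cmp G a' b'" "deg G a = deg G a'"
  shows "a = a' \<and> b = b'"
proof -
  have "deg G (cmp G a b) = vadd (deg G a) (deg G b)" "deg G (cmp G a b) = vadd (deg G a) (deg G b')"
    using assms by (metis deg_cmp)+
  then have d: "deg G b' = deg G b" "deg G (cmp G a b) = vadd (deg G a) (deg G b)" by auto
  have ex1: "\<exists>!p. fst p \<in> mor G \<and> snd p \<in> mor G \<and> src G (fst p) = rng G (snd p) \<and>
        cmp G a b = cmp G (fst p) (snd p) \<and> deg G (fst p) = deg G a \<and> deg G (snd p) = deg G b"
    by (rule factor_ex1) (use assms d in simp_all)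
  have "(a, b) = (a', b')"
    by (rule Ex1_unique[OF ex1]) (use assms d in simp_all)
  then show ?thesis by simp
qed

text \<open>An identity is its own square, so adding its degree to itself changes nothing.\<close>

lemma deg_obj [simp]: "v \<in> obj G \<Longrightarrow> deg G v = vzero"
  by (metis cmp_src deg_cmp obj_mor rng_id src_id vadd_eq_self)

text \<open>Composing \<open>l\<close> with its source and composing its range with \<open>l\<close>
  are two factorisations whose first factors both have degree zero, so \<open>l\<close> equals its
  range.\<close>

lemma deg_vzero_obj:
  assumes "l \<in> mor G" "deg G l = vzero" shows "l \<in> obj G"
proof -
  have "l = rng G l" using factor_unique[of l "src G l" "rng G l" l] assms by (simp add: obj_mor)
  then show ?thesis using rng_obj[OF assms(1)] by simp
qed

lemma initial_cmp:
  assumes "a \<in> mor G" "b \<in> mor G" "src G a = rng G b"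
  shows "initial G (cmp G a b) (deg G a) = a" "final G (cmp G a b) (deg G a) = b"
proof -
  have u: "a' = a" "b' = b" if "a' \<in> mor G" "b' \<in> mor G" "src G a' = rng G b'" "cmp G a b = cmp G a' b'" "deg G a' = deg G a" for a' b'
    using factor_unique[of a' b' a b] that assms by auto
  show "initial G (cmp G a b) (deg G a) = a" "final G (cmp G a b) (deg G a) = b"
    unfolding initial_def final_def by (rule the_equality; use assms u in blast)+
qed

lemma initial_final:
  assumes "l \<in> mor G" "p \<le> deg G l"
  shows "initial G l p \<in> mor G" "deg G (initial G l p) = p" "final G l p \<in> mor G"
    "src G (initial G l p) = rng G (final G l p)" "cmp G (initial G l p) (final G l p) = l"
    "deg G (final G l p) = vsub (deg G l) p" "rng G (initial G l p) = rng G l" "src G (final G l p) = src G l"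
proof -
  have "p \<in> NK k" using NK_downward assms by (metis deg_NK)
  then obtain a b where ab: "a \<in> mor G" "b \<in> mor G" "src G a = rng G b" "l = cmp G a b" "deg G a = p"
      "deg G b = vsub (deg G l) p"
    using factor_ex1[of l p "vsub (deg G l) p"] assms by (auto simp: vadd_vsub)
  have "initial G l p = a" "final G l p = b" using initial_cmp[of a b] ab by auto
  then show "initial G l p \<in> mor G" "deg G (initial G l p) = p" "final G l p \<in> mor G"
    "src G (initial G l p) = rng G (final G l p)" "cmp G (initial G l p) (final G l p) = l"
    "deg G (final G l p) = vsub (deg G l) p" "rng G (initial G l p) = rng G l" "src G (final G l p) = src G l"
    using ab by auto
qed

lemma initial_self [simp]: "l \<in> mor G \<Longrightarrow> initial G l (deg G l) = l"
  using initial_cmp(1)[of l "src G l"] by (auto simp: obj_mor)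

lemma final_self: "l \<in> mor G \<Longrightarrow> final G l (deg G l) = src G l"
  using initial_cmp(2)[of l "src G l"] by (auto simp: obj_mor)

lemma final_vzero: "l \<in> mor G \<Longrightarrow> final G l vzero = l"
  using initial_cmp(2)[of "rng G l" l] by (auto simp: obj_mor)

lemma initial_vzero: "l \<in> mor G \<Longrightarrow> initial G l vzero = rng G l"
  using initial_cmp(1)[of "rng G l" l] by (auto simp: obj_mor)

text \<open>Factoring in two stages gives, after reassociation, a factorisation of \<open>l\<close>
  at degree \<open>p\<close>, and there is only one.\<close>

lemma initial_split:
  assumes "l \<in> mor G" "p \<le> q" "q \<le> deg G l"
  shows "initial G (initial G l q) p = initial G l p"
    and "final G l p = cmp G (final G (initial G l q) p) (final G l q)"
proof -
  let ?u = "initial G l q" let ?w = "final G l q"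
  note u = initial_final[OF assms(1,3)]
  have p: "p \<le> deg G ?u" using u assms by simp
  note v = initial_final[OF u(1) p]
  let ?a = "initial G ?u p" let ?b = "cmp G (final G ?u p) ?w"
  have ab: "?b \<in> mor G" "src G ?a = rng G ?b" "l = cmp G ?a ?b"
    using u v by (auto simp: cmp_assoc[symmetric])
  show "initial G ?u p = initial G l p" using initial_cmp(1)[OF v(1) ab(1,2)] ab(3) v by simp
  show "final G l p = ?b" using initial_cmp(2)[OF v(1) ab(1,2)] ab(3) v by simp
qed

lemma finite_exts:
  assumes "l \<in> mor G" "p \<in> NK k" "deg G l \<le> p" shows "finite (exts G l p)"
proof (rule finite_subset)
  show "exts G l p \<subseteq> vLn G (rng G l) p"
    using assms initial_final(7) by (fastforce simp: exts_def vLn_def)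
  show "finite (vLn G (rng G l) p)"
    using row_finite assms by (auto simp: row_finite_def)
qed

lemma exts_eq_cmp:
  assumes "l \<in> mor G" "p \<in> NK k" "deg G l \<le> p"
  shows "exts G l p = cmp G l ` vLn G (src G l) (vsub p (deg G l))"
proof (intro set_eqI iffI)
  fix a assume "a \<in> exts G l p"
  then have a: "a \<in> mor G" "deg G a = p" "initial G a (deg G l) = l" by (auto simp: exts_def)
  show "a \<in> cmp G l ` vLn G (src G l) (vsub p (deg G l))"
    using initial_final[of a "deg G l"] a assms
    by (intro image_eqI[where x="final G a (deg G l)"]) (auto simp: vLn_def)
qed (use assms in \<open>auto simp: exts_def vLn_def vadd_vsub initial_cmp\<close>)

lemma inj_on_cmp: "l \<in> mor G \<Longrightarrow> inj_on (cmp G l) (vLn G (src G l) n)"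
  by (rule inj_onI) (metis (mono_tags, lifting) factor_unique vLn_def mem_Collect_eq)

lemma exts_nonempty:
  assumes "l \<in> mor G" "p \<in> NK k" "deg G l \<le> p" shows "exts G l p \<noteq> {}"
  using no_sources assms by (auto simp: exts_eq_cmp no_sources_def)

subsection \<open>Infinite paths\<close>

lemma infpaths_conjuncts:
  assumes "x \<in> infpaths k G"
  shows "\<forall>m n. \<not> (m \<in> NK k \<and> n \<in> NK k \<and> m \<le> n) \<longrightarrow> x m n = undefined"
    "\<forall>m\<in>NK k. \<forall>n\<in>NK k. m \<le> n \<longrightarrow> x m n \<in> mor G \<and> deg G (x m n) = vsub n m"
    "\<forall>m\<in>NK k. x m m \<in> obj G"
    "\<forall>m\<in>NK k. \<forall>n\<in>NK k. m \<le> n \<longrightarrow> rng G (x m n) = x m m \<and> src G (x m n) = x n n"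
    "\<forall>m\<in>NK k. \<forall>n\<in>NK k. \<forall>p\<in>NK k. m \<le> n \<longrightarrow> n \<le> p \<longrightarrow> x m p = cmp G (x m n) (x n p)"
  by (insert assms[unfolded infpaths_def mem_Collect_eq]; (elim conjE)?; assumption)+

lemma path_undefined: "x \<in> infpaths k G \<Longrightarrow> \<not> (p \<in> NK k \<and> q \<in> NK k \<and> p \<le> q) \<Longrightarrow> x p q = undefined"
  using infpaths_conjuncts(1) by metis

lemma path_mor:
  assumes "x \<in> infpaths k G" "p \<in> NK k" "q \<in> NK k" "p \<le> q"
  shows "x p q \<in> mor G" "deg G (x p q) = vsub q p" "rng G (x p q) = x p p" "src G (x p q) = x q q"
  using infpaths_conjuncts(2,4)[OF assms(1)] assms(2-4) by auto

lemma path_obj: "x \<in> infpaths k G \<Longrightarrow> p \<in> NK k \<Longrightarrow> x p p \<in> obj G"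
  using infpaths_conjuncts(3) by blast

lemma path_split:
  assumes "x \<in> infpaths k G" "p \<in> NK k" "q \<in> NK k" "r \<in> NK k" "p \<le> q" "q \<le> r"
  shows "x p r = cmp G (x p q) (x q r)"
  using infpaths_conjuncts(5)[OF assms(1)] assms(2-6) by blast

lemma path_initial:
  assumes "x \<in> infpaths k G" "q \<in> NK k" "p \<le> q"
  shows "initial G (x vzero q) p = x vzero p" "final G (x vzero q) p = x p q"
proof -
  have p: "p \<in> NK k" using NK_downward assms by metis
  note a = path_mor[OF assms(1) vzero_NK p vzero_le] and b = path_mor[OF assms(1) p assms(2,3)]
  have "x vzero q = cmp G (x vzero p) (x p q)" using path_split[of x vzero p q] assms p by simp
  then show "initial G (x vzero q) p = x vzero p" "final G (x vzero q) p = x p q"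
    using initial_cmp[OF a(1) b(1)] a b by auto
qed

lemma path_eqI:
  assumes "x \<in> infpaths k G" "y \<in> infpaths k G"
    and "\<And>q. q \<in> NK k \<Longrightarrow> \<exists>q'\<in>NK k. q \<le> q' \<and> x vzero q' = y vzero q'"
  shows "x = y"
proof (intro ext)
  fix p q
  show "x p q = y p q"
  proof (cases "p \<in> NK k \<and> q \<in> NK k \<and> p \<le> q")
    case True
    obtain q' where q': "q' \<in> NK k" "q \<le> q'" "x vzero q' = y vzero q'" using assms(3) True by blast
    have "x vzero q = y vzero q"
      using path_initial(1)[OF assms(1) q'(1,2)] path_initial(1)[OF assms(2) q'(1,2)] q'(3) by simp
    then show ?thesis
      using path_initial(2)[OF assms(1), of q p] path_initial(2)[OF assms(2), of q p] True by simp
  next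
    case False
    then show ?thesis using assms(1,2) path_undefined by metis
  qed
qed

text \<open>A coherent sequence of finite paths of cofinal degrees is the same as an infinite path:
  \<open>x p q\<close> is what remains after cutting degree \<open>p\<close> off the initial segment
  of degree \<open>q\<close>.\<close>

lemma path_exists:
  fixes lam :: "nat \<Rightarrow> 'a"
  assumes mor: "\<And>n. lam n \<in> mor G" and le: "\<And>n. deg G (lam n) \<le> deg G (lam (Suc n))"
    and init: "\<And>n. initial G (lam (Suc n)) (deg G (lam n)) = lam n"
    and cofinal: "\<And>q. q \<in> NK k \<Longrightarrow> \<exists>n. q \<le> deg G (lam n)"
  shows "\<exists>x\<in>infpaths k G. \<forall>n. x vzero (deg G (lam n)) = lam n"
proof -
  have le': "deg G (lam m) \<le> deg G (lam n)" if "m \<le> n" for m n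
    using lift_Suc_mono_le[of "\<lambda>n. deg G (lam n)", OF le that] .
  have init': "initial G (lam n) (deg G (lam m)) = lam m" if "m \<le> n" for m n
    using that
  proof (induction n rule: dec_induct)
    case (step n)
    have "initial G (lam (Suc n)) (deg G (lam m)) =
        initial G (initial G (lam (Suc n)) (deg G (lam n))) (deg G (lam m))"
      using step mor le le' by (subst initial_split) auto
    then show ?case using step init by simp
  qed (use mor in auto)
  \<comment> \<open>Any index whose path is long enough would serve; coherence makes the segment
    independent of the choice, as \<open>h_eq\<close> shows.\<close>
  define h where "h q = initial G (lam (SOME n. q \<le> deg G (lam n))) q" for q
  have h_eq: "h q = initial G (lam n) q" if "q \<in> NK k" "q \<le> deg G (lam n)" for q n
  proof -
    define m where "m = (SOME n. q \<le> deg G (lam n))"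
    have m: "q \<le> deg G (lam m)" unfolding m_def using cofinal[OF that(1)] by (rule someI_ex)
    have "initial G (lam i) q = initial G (lam j) q" if "i \<le> j" "q \<le> deg G (lam i)" for i j
      using initial_split(1)[of "lam j" q "deg G (lam i)"] that mor init'[OF that(1)] le'[OF that(1)] by simp
    then have "initial G (lam m) q = initial G (lam n) q"
      using m that(2) by (metis nle_le)
    then show ?thesis by (simp add: h_def m_def)
  qed
  have h: "h q \<in> mor G" "deg G (h q) = q" if q: "q \<in> NK k" for q
  proof -
    obtain n where n: "q \<le> deg G (lam n)" using cofinal[OF q] by blast
    show "h q \<in> mor G" "deg G (h q) = q"
      using initial_final[OF mor n] h_eq[OF q n] by auto
  qed
  have h_init: "initial G (h q) p = h p" if p: "p \<in> NK k" and q: "q \<in> NK k" and pq: "p \<le> q" for p q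
  proof -
    obtain n where n: "q \<le> deg G (lam n)" using cofinal[OF q] by blast
    show ?thesis using h_eq[OF q n] h_eq[OF p order_trans[OF pq n]] initial_split(1)[OF mor pq n] by simp
  qed
  define x where "x p q = (if p \<in> NK k \<and> q \<in> NK k \<and> p \<le> q then final G (h q) p else undefined)" for p q
  have x0: "x vzero q = h q" if "q \<in> NK k" for q
    using that h by (simp add: x_def final_vzero)
  have xpp: "x p p = src G (h p)" if "p \<in> NK k" for p
    using that h final_self[of "h p"] by (simp add: x_def)
  have "x \<in> infpaths k G"
  proof -
    have 1: "x p q \<in> mor G" "deg G (x p q) = vsub q p" "rng G (x p q) = x p p" "src G (x p q) = x q q"
      if p: "p \<in> NK k" and q: "q \<in> NK k" and pq: "p \<le> q" for p q
      using initial_final[of "h q" p] h[OF q] p q pq xpp[OF p] xpp[OF q] h_init[OF p q pq]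
      by (auto simp: x_def)
    have 2: "x p r = cmp G (x p q) (x q r)"
      if "p \<in> NK k" "q \<in> NK k" "r \<in> NK k" "p \<le> q" "q \<le> r" for p q r
      using that initial_split(2)[of "h r" p q] h[of r] h_init[of q r] by (auto simp: x_def)
    show ?thesis
      unfolding infpaths_def mem_Collect_eq
      by (intro conjI ballI allI impI 1 2) (use xpp h in \<open>auto simp: x_def\<close>)
  qed
  moreover have "x vzero (deg G (lam n)) = lam n" for n
    using x0 mor h_eq[of "deg G (lam n)" n] by simp
  ultimately show ?thesis by blast
qed

lemma cofinal_vadd_diag: "p \<in> NK k \<Longrightarrow> \<exists>n. p \<le> vadd d (diag k n)"
  by (meson diag_cofinal le_vadd(2) order_trans)

text \<open>Dependent choice: a property that always passes to some extension by (1, ..., 1)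
  persists along an infinite path. The constant property gives nonempty cylinders, and the failure
  of finite coverability gives Koenig's lemma.\<close>

lemma path_through:
  assumes "l \<in> mor G" "Q l"
    and step: "\<And>m. m \<in> mor G \<Longrightarrow> Q m \<Longrightarrow> \<exists>m'\<in>exts G m (vadd (deg G m) (diag k 1)). Q m'"
  shows "\<exists>x\<in>cyl k G l. \<forall>n. Q (x vzero (vadd (deg G l) (diag k n)))"
proof -
  have "\<exists>lam. \<forall>n. (lam n \<in> mor G \<and> Q (lam n) \<and> (n = 0 \<longrightarrow> lam n = l)) \<and>
      lam (Suc n) \<in> exts G (lam n) (vadd (deg G (lam n)) (diag k 1))"
    by (rule dependent_nat_choice) (use assms in \<open>auto simp: exts_def dest: step\<close>)
  then obtain lam where lam: "\<And>n. lam n \<in> mor G" "\<And>n. Q (lam n)" "lam 0 = l"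
      "\<And>n. lam (Suc n) \<in> exts G (lam n) (vadd (deg G (lam n)) (diag k 1))" by blast
  have d: "deg G (lam n) = vadd (deg G l) (diag k n)" for n
  proof (induction n)
    case (Suc n)
    then show ?case using lam(4)[of n] by (simp add: exts_def vadd_assoc[symmetric] diag_Suc[of k n])
  qed (use lam in auto)
  have "\<exists>x\<in>infpaths k G. \<forall>n. x vzero (deg G (lam n)) = lam n"
  proof (rule path_exists)
    show "deg G (lam n) \<le> deg G (lam (Suc n))" for n
      using lam(4)[of n] by (simp add: exts_def)
    show "initial G (lam (Suc n)) (deg G (lam n)) = lam n" for n using lam(4)[of n] by (simp add: exts_def)
    show "\<exists>n. q \<le> deg G (lam n)" if "q \<in> NK k" for q using cofinal_vadd_diag[OF that] by (simp add: d)
  qed (rule lam)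
  then obtain x where x: "x \<in> infpaths k G" "\<And>n. x vzero (deg G (lam n)) = lam n" by blast
  have "x \<in> cyl k G l" using x(1) x(2)[of 0] lam(3) by (simp add: cyl_def)
  moreover have "Q (x vzero (vadd (deg G l) (diag k n)))" for n using x(2)[of n] lam(2)[of n] by (simp add: d)
  ultimately show ?thesis by blast
qed

section \<open>Cylinder sets and their compactness\<close>

lemma cyl_nonempty: "l \<in> mor G \<Longrightarrow> cyl k G l \<noteq> {}"
  using path_through[of l "\<lambda>_. True"] exts_nonempty[of _ "vadd _ (diag k 1)"] by (metis all_not_in_conv deg_NK diag_NK le_vadd(1) vadd_NK)

lemma cyl_subset_infpaths: "cyl k G l \<subseteq> infpaths k G" by (auto simp: cyl_def)

lemma path_in_cyl: "x \<in> infpaths k G \<Longrightarrow> n \<in> NK k \<Longrightarrow> x \<in> cyl k G (x vzero n)"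
  by (simp add: cyl_def path_mor)

lemma cyl_initial:
  assumes "a \<in> mor G" "p \<le> deg G a" shows "cyl k G a \<subseteq> cyl k G (initial G a p)"
  using assms path_initial(1)[OF _ deg_NK[OF assms(1)] assms(2)] by (fastforce simp: cyl_def initial_final)

lemma cyl_Int_cases:
  assumes "a \<in> mor G" "b \<in> mor G" "deg G a \<le> deg G b"
  shows "cyl k G a \<inter> cyl k G b = (if initial G b (deg G a) = a then cyl k G b else {})"
proof -
  have "x vzero (deg G a) = initial G b (deg G a)" if "x \<in> cyl k G b" for x
    using path_initial(1)[OF _ deg_NK[OF assms(2)] assms(3), of x] that by (simp add: cyl_def)
  then show ?thesis by (auto simp: cyl_def)
qed

lemma cyl_disjoint: "deg G a = deg G b \<Longrightarrow> a \<noteq> b \<Longrightarrow> cyl k G a \<inter> cyl k G b = {}"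
  by (auto simp: cyl_def)

lemma cyl_eq_Union_exts:
  assumes "l \<in> mor G" "p \<in> NK k" "deg G l \<le> p"
  shows "cyl k G l = (\<Union>a\<in>exts G l p. cyl k G a)"
proof (intro set_eqI iffI)
  fix x assume x: "x \<in> cyl k G l"
  then have "x \<in> infpaths k G" "x vzero (deg G l) = l" by (auto simp: cyl_def)
  then have "x vzero p \<in> exts G l p"
    using assms path_mor[of x vzero p] path_initial(1)[of x p "deg G l"] by (simp add: exts_def)
  then show "x \<in> (\<Union>a\<in>exts G l p. cyl k G a)" using x path_in_cyl[of x p] assms by (auto simp: cyl_def)
qed (use assms cyl_initial in \<open>fastforce simp: exts_def\<close>)

lemma infpaths_eq_Union: "n \<in> NK k \<Longrightarrow> infpaths k G = (\<Union>a\<in>{a\<in>mor G. deg G a = n}. cyl k G a)"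
  using path_in_cyl path_mor[of _ vzero n] cyl_subset_infpaths by fastforce

text \<open>If a cylinder has no finite subcover, neither has one of its finitely many pieces one
  step longer. Following such pieces yields an infinite path, which lies in some cylinder of the
  cover; as soon as its initial segment is at least as long as the defining path there, that one
  cylinder covers the piece, a contradiction.\<close>

lemma cyl_compact:
  assumes "l \<in> mor G" "B \<subseteq> mor G" "cyl k G l \<subseteq> (\<Union>b\<in>B. cyl k G b)"
  shows "\<exists>B'. finite B' \<and> B' \<subseteq> B \<and> cyl k G l \<subseteq> (\<Union>b\<in>B'. cyl k G b)"
proof (rule ccontr)
  define Q where "Q m \<longleftrightarrow> \<not> (\<exists>B'. finite B' \<and> B' \<subseteq> B \<and> cyl k G m \<subseteq> (\<Union>b\<in>B'. cyl k G b))" for m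
  assume "\<not> ?thesis"
  then have "Q l" by (simp add: Q_def)
  moreover have "\<exists>m'\<in>exts G m (vadd (deg G m) (diag k 1)). Q m'" if m: "m \<in> mor G" "Q m" for m
  proof (rule ccontr)
    assume "\<not> ?thesis"
    then have "\<forall>m'\<in>exts G m (vadd (deg G m) (diag k 1)). \<exists>B'. finite B' \<and> B' \<subseteq> B \<and> cyl k G m' \<subseteq> (\<Union>b\<in>B'. cyl k G b)"
      unfolding Q_def by blast
    then obtain B' where B': "\<And>m'. m' \<in> exts G m (vadd (deg G m) (diag k 1)) \<Longrightarrow>
        finite (B' m') \<and> B' m' \<subseteq> B \<and> cyl k G m' \<subseteq> (\<Union>b\<in>B' m'. cyl k G b)" by metis
    let ?B = "\<Union>m'\<in>exts G m (vadd (deg G m) (diag k 1)). B' m'"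
    have "finite ?B" using finite_exts m B' by auto
    moreover have "?B \<subseteq> B" using B' by auto
    moreover have "cyl k G m \<subseteq> (\<Union>b\<in>?B. cyl k G b)"
    proof
      fix x assume "x \<in> cyl k G m"
      then obtain a where a: "a \<in> exts G m (vadd (deg G m) (diag k 1))" "x \<in> cyl k G a"
        using cyl_eq_Union_exts[of m "vadd (deg G m) (diag k 1)"] m by auto
      then show "x \<in> (\<Union>b\<in>?B. cyl k G b)" using B'[OF a(1)] by blast
    qed
    ultimately show False using m(2) unfolding Q_def by blast
  qed
  ultimately obtain x where x: "x \<in> cyl k G l" "\<And>n. Q (x vzero (vadd (deg G l) (diag k n)))"
    using path_through[of l Q] assms(1) by blast
  then obtain b where b: "b \<in> B" "x \<in> cyl k G b" using assms by blast
  have "b \<in> mor G" using b assms by auto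
  then obtain n where n: "deg G b \<le> vadd (deg G l) (diag k n)" using cofinal_vadd_diag deg_NK by blast
  let ?p = "vadd (deg G l) (diag k n)"
  have xi: "x \<in> infpaths k G" "x vzero (deg G b) = b" using b by (auto simp: cyl_def)
  have p: "?p \<in> NK k" using assms by simp
  have "initial G (x vzero ?p) (deg G b) = b" using path_initial(1)[OF xi(1) p n] xi by simp
  then have "cyl k G (x vzero ?p) \<subseteq> cyl k G b"
    using cyl_initial[of "x vzero ?p" "deg G b"] path_mor[OF xi(1) vzero_NK p] n by simp
  then have "cyl k G (x vzero ?p) \<subseteq> (\<Union>b\<in>{b}. cyl k G b)" by simp
  moreover have "finite {b}" "{b} \<subseteq> B" using b by auto
  ultimately show False using x(2)[of n] unfolding Q_def by blast
qed

subsection \<open>Shifts and prefixes\<close>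

lemma shift_apply: "p \<in> NK k \<Longrightarrow> q \<in> NK k \<Longrightarrow> p \<le> q \<Longrightarrow> shift k n x p q = x (vadd p n) (vadd q n)"
  by (simp add: shift_def)

lemma shift_infpaths: "x \<in> infpaths k G \<Longrightarrow> n \<in> NK k \<Longrightarrow> shift k n x \<in> infpaths k G"
proof -
  assume x: "x \<in> infpaths k G" and n: "n \<in> NK k"
  have v: "vsub (vadd q n) (vadd p n) = vsub q p" for p q by (auto simp: vsub_def vadd_def)
  have 1: "x (vadd p n) (vadd q n) \<in> mor G \<and> deg G (x (vadd p n) (vadd q n)) = vsub q p \<and>
      rng G (x (vadd p n) (vadd q n)) = x (vadd p n) (vadd p n) \<and> src G (x (vadd p n) (vadd q n)) = x (vadd q n) (vadd q n)"
    if "p \<in> NK k" "q \<in> NK k" "p \<le> q" for p q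
    using path_mor[OF x, of "vadd p n" "vadd q n"] that n by (simp add: v)
  have 2: "x (vadd p n) (vadd p n) \<in> obj G" if "p \<in> NK k" for p
    using path_obj[OF x] that n by simp
  have 3: "x (vadd p n) (vadd r n) = cmp G (x (vadd p n) (vadd q n)) (x (vadd q n) (vadd r n))"
    if "p \<in> NK k" "q \<in> NK k" "r \<in> NK k" "p \<le> q" "q \<le> r" for p q r
    using path_split[OF x, of "vadd p n" "vadd q n" "vadd r n"] that n by simp
  show ?thesis
    unfolding infpaths_def mem_Collect_eq
  proof (intro conjI ballI allI impI)
    fix p q assume "\<not> (p \<in> NK k \<and> q \<in> NK k \<and> p \<le> q)"
    then show "shift k n x p q = undefined" by (auto simp: shift_def)
  next
    fix p q r assume "p \<in> NK k" "q \<in> NK k" "r \<in> NK k" "p \<le> q" "q \<le> r"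
    then show "shift k n x p r = cmp G (shift k n x p q) (shift k n x q r)"
      using 3[of p q r] order_trans[of p q r] by (simp add: shift_apply)
  qed (use 1 2 in \<open>simp_all add: shift_apply\<close>)
qed

lemma shift_shift: "(shift k m :: 'a ipath \<Rightarrow> 'a ipath) \<circ> shift k n = shift k (vadd m n)" if "m \<in> NK k"
  using that by (auto simp: shift_def fun_eq_iff vadd_assoc)

lemma shift_eq_iff_cmp:
  assumes "x \<in> cyl k G l" "l \<in> mor G" "q \<in> NK k"
  shows "x vzero (vadd (deg G l) q) = cmp G l (shift k (deg G l) x vzero q)"
    and "shift k (deg G l) x vzero q \<in> mor G" "rng G (shift k (deg G l) x vzero q) = src G l"
    "deg G (shift k (deg G l) x vzero q) = q"
proof -
  have x: "x \<in> infpaths k G" "x vzero (deg G l) = l" using assms by (auto simp: cyl_def)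
  have s: "shift k (deg G l) x vzero q = x (deg G l) (vadd (deg G l) q)"
    using assms by (simp add: shift_apply vadd_commute)
  show "x vzero (vadd (deg G l) q) = cmp G l (shift k (deg G l) x vzero q)"
    using path_split[OF x(1), of vzero "deg G l" "vadd (deg G l) q"] assms s x by simp
  show "shift k (deg G l) x vzero q \<in> mor G" "rng G (shift k (deg G l) x vzero q) = src G l"
    "deg G (shift k (deg G l) x vzero q) = q"
    using path_mor[OF x(1), of "deg G l" "vadd (deg G l) q"] path_mor[OF x(1), of vzero "deg G l"] assms s x
    by auto
qed

lemma shift_cyl_src: "x \<in> cyl k G l \<Longrightarrow> l \<in> mor G \<Longrightarrow> shift k (deg G l) x \<in> cyl k G (src G l)"
  using shift_infpaths[of x "deg G l"] shift_eq_iff_cmp(2-4)[of x l vzero] initial_self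
    deg_vzero_obj[of "shift k (deg G l) x vzero vzero"]
  by (auto simp: cyl_def)

text \<open>This gives meaning to the definite description behind \<open>prefix\<close>. Uniqueness
  holds because \<open>l\<close> together with the shifted path determines all initial segments
  beyond \<open>l\<close>.\<close>

lemma prefix_ex1:
  assumes l: "l \<in> mor G" and x: "x \<in> cyl k G (src G l)"
  shows "\<exists>!y. y \<in> infpaths k G \<and> y vzero (deg G l) = l \<and> shift k (deg G l) y = x"
proof (rule ex_ex1I)
  have xi: "x \<in> infpaths k G" "x vzero vzero = src G l" using x l by (auto simp: cyl_def)
  have a: "x vzero q \<in> mor G" "deg G (x vzero q) = q" "rng G (x vzero q) = src G l" if "q \<in> NK k" for q
    using path_mor[OF xi(1) vzero_NK that] xi by auto
  \<comment> \<open>Prepending \<open>l\<close> to the segments of \<open>x\<close> of degree n(1,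
    ..., 1) gives a coherent sequence, whose limit is the path sought.\<close>
  let ?lam = "\<lambda>n. cmp G l (x vzero (diag k n))"
  have d: "deg G (?lam n) = vadd (deg G l) (diag k n)" for n using a l by simp
  have "\<exists>y\<in>infpaths k G. \<forall>n. y vzero (deg G (?lam n)) = ?lam n"
  proof (rule path_exists)
    show "?lam n \<in> mor G" for n using a l by simp
    show "deg G (?lam n) \<le> deg G (?lam (Suc n))" for n by (simp add: d diag_mono)
    show "\<exists>n. q \<le> deg G (?lam n)" if "q \<in> NK k" for q using cofinal_vadd_diag[OF that] by (simp add: d)
    fix n
    let ?r = "x (diag k n) (diag k (Suc n))"
    have r: "?r \<in> mor G" "rng G ?r = src G (x vzero (diag k n))" "x vzero (diag k (Suc n)) = cmp G (x vzero (diag k n)) ?r"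
      using path_mor[OF xi(1), of "diag k n" "diag k (Suc n)"] path_mor[OF xi(1), of vzero "diag k n"]
        path_split[OF xi(1), of vzero "diag k n" "diag k (Suc n)"] diag_mono[of n "Suc n" k]
      by auto
    have "?lam (Suc n) = cmp G (?lam n) ?r" using cmp_assoc[of l "x vzero (diag k n)" ?r] a l r by simp
    then show "initial G (?lam (Suc n)) (deg G (?lam n)) = ?lam n"
      using initial_cmp(1)[of "?lam n" ?r] a l r by simp
  qed
  then obtain y where y: "y \<in> infpaths k G" "\<And>n. y vzero (vadd (deg G l) (diag k n)) = ?lam n"
    by (auto simp: d)
  have yl: "y vzero (deg G l) = l" using y(2)[of 0] xi l by simp
  then have yc: "y \<in> cyl k G l" using y by (simp add: cyl_def)
  have "shift k (deg G l) y = x"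
  proof (rule path_eqI)
    show "shift k (deg G l) y \<in> infpaths k G" using shift_infpaths y l by simp
    show "x \<in> infpaths k G" by fact
    fix q assume "q \<in> NK k"
    then obtain n where n: "q \<le> diag k n" using diag_cofinal by blast
    have "cmp G l (shift k (deg G l) y vzero (diag k n)) = cmp G l (x vzero (diag k n))"
      using shift_eq_iff_cmp(1)[OF yc l, of "diag k n"] y(2)[of n] by simp
    then have "shift k (deg G l) y vzero (diag k n) = x vzero (diag k n)"
      using factor_unique[OF l shift_eq_iff_cmp(2)[OF yc l diag_NK] l a(1)[OF diag_NK]
          shift_eq_iff_cmp(3)[OF yc l diag_NK, symmetric] a(3)[OF diag_NK, symmetric]] by blast
    then show "\<exists>q'\<in>NK k. q \<le> q' \<and> shift k (deg G l) y vzero q' = x vzero q'" using n by auto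
  qed
  then show "\<exists>y. y \<in> infpaths k G \<and> y vzero (deg G l) = l \<and> shift k (deg G l) y = x" using y yl by blast
next
  fix y z
  assume y: "y \<in> infpaths k G \<and> y vzero (deg G l) = l \<and> shift k (deg G l) y = x"
    and z: "z \<in> infpaths k G \<and> z vzero (deg G l) = l \<and> shift k (deg G l) z = x"
  have c: "y \<in> cyl k G l" "z \<in> cyl k G l" using y z by (auto simp: cyl_def)
  show "y = z"
  proof (rule path_eqI)
    fix q assume "q \<in> NK k"
    then show "\<exists>q'\<in>NK k. q \<le> q' \<and> y vzero q' = z vzero q'"
      using shift_eq_iff_cmp(1)[OF c(1) l, of q] shift_eq_iff_cmp(1)[OF c(2) l, of q] y z l
      by (intro bexI[of _ "vadd (deg G l) q"]) auto
  qed (use y z in auto)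
qed

lemma prefix_cyl:
  assumes "l \<in> mor G" "x \<in> cyl k G (src G l)"
  shows "prefix k G l x \<in> cyl k G l" "shift k (deg G l) (prefix k G l x) = x"
  using theI'[OF prefix_ex1[OF assms]] by (auto simp: prefix_def cyl_def)

lemma prefix_eqI:
  assumes "l \<in> mor G" "y \<in> cyl k G l" "shift k (deg G l) y = x" shows "prefix k G l x = y"
proof -
  have "x \<in> cyl k G (src G l)" using shift_cyl_src assms by blast
  from the1_equality[OF prefix_ex1[OF assms(1) this], of y] show ?thesis
    using assms by (auto simp: prefix_def cyl_def)
qed

lemma prefix_image:
  assumes "l \<in> mor G" "A \<subseteq> cyl k G (src G l)"
  shows "prefix k G l ` A = {y \<in> cyl k G l. shift k (deg G l) y \<in> A}"
proof (intro set_eqI iffI)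
  fix y assume "y \<in> {y \<in> cyl k G l. shift k (deg G l) y \<in> A}"
  then show "y \<in> prefix k G l ` A"
    by (intro image_eqI[of _ _ "shift k (deg G l) y"]) (auto simp: prefix_eqI[OF assms(1)])
qed (use assms prefix_cyl in auto)

lemma prefix_image_cyl: "l \<in> mor G \<Longrightarrow> prefix k G l ` cyl k G (src G l) = cyl k G l"
  using shift_cyl_src by (auto simp: prefix_image)

lemma shift_vzero: "x \<in> infpaths k G \<Longrightarrow> shift k vzero x = x"
  using path_undefined[of x] by (auto simp: shift_def fun_eq_iff)

lemma prefix_obj: "v \<in> obj G \<Longrightarrow> x \<in> cyl k G v \<Longrightarrow> prefix k G v x = x"
  by (rule prefix_eqI) (auto simp: obj_mor shift_vzero cyl_def)

lemma cyl_subset_rng: "l \<in> mor G \<Longrightarrow> cyl k G l \<subseteq> cyl k G (rng G l)"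
  using cyl_initial[of l vzero] by (simp add: initial_vzero)

text \<open>Unique factorisation translates conditions on the shifted path into conditions on the
  path itself; on measures and operators this becomes the composition rule for \<open>l\<close> and
  \<open>m\<close>.\<close>

lemma shift_mem_cyl_iff:
  assumes "x \<in> cyl k G l" "l \<in> mor G" "m \<in> mor G" "src G l = rng G m"
  shows "shift k (deg G l) x \<in> cyl k G m \<longleftrightarrow> x \<in> cyl k G (cmp G l m)"
proof -
  have x: "x \<in> infpaths k G" "shift k (deg G l) x \<in> infpaths k G"
    using assms shift_infpaths by (auto simp: cyl_def)
  note s = shift_eq_iff_cmp[OF assms(1,2), of "deg G m"]
  show ?thesis
    using s assms x factor_unique[of l "shift k (deg G l) x vzero (deg G m)" l m]
    by (auto simp: cyl_def)
qed

lemma prefix_prefix: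
  assumes "l \<in> mor G" "m \<in> mor G" "src G l = rng G m" "x \<in> cyl k G (src G m)"
  shows "prefix k G l (prefix k G m x) = prefix k G (cmp G l m) x"
proof (rule prefix_eqI[symmetric])
  have 1: "prefix k G m x \<in> cyl k G (src G l)" "prefix k G m x \<in> cyl k G m"
    using prefix_cyl(1)[OF assms(2,4)] cyl_subset_rng assms by auto
  have 2: "prefix k G l (prefix k G m x) \<in> cyl k G l" "shift k (deg G l) (prefix k G l (prefix k G m x)) = prefix k G m x"
    using prefix_cyl[OF assms(1) 1(1)] by auto
  show "prefix k G l (prefix k G m x) \<in> cyl k G (cmp G l m)"
    using shift_mem_cyl_iff[OF 2(1) assms(1-3)] 1 2 by simp
  have "shift k (vadd (deg G m) (deg G l)) (prefix k G l (prefix k G m x)) =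
      shift k (deg G m) (shift k (deg G l) (prefix k G l (prefix k G m x)))"
    using fun_cong[OF shift_shift[of "deg G m" "deg G l"]] assms by simp
  then show "shift k (deg G (cmp G l m)) (prefix k G l (prefix k G m x)) = x"
    using 2 prefix_cyl[OF assms(2,4)] assms by (simp add: vadd_commute)
qed (use assms in auto)

subsection \<open>Measures on the path space\<close>

text \<open>The degrees involved are totally ordered, so members are nested or disjoint; the empty
  set is added to make the family intersection-stable. The base degree \<open>d\<close> is a
  parameter so that pushforwards along prefixing by \<open>l\<close> can be tested on cylinders at
  least as long as \<open>l\<close>.\<close>

definition chain :: "(nat \<Rightarrow> nat) \<Rightarrow> 'a ipath set set" where
  "chain d = insert {} (cyl k G ` {a \<in> mor G. \<exists>n. deg G a = vadd d (diag k n)})"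

lemma chain_subset: "chain d \<subseteq> Pow (infpaths k G)"
  by (auto simp: chain_def cyl_def)

lemma diag_linear: "vadd d (diag k m) \<le> vadd d (diag k n) \<or> vadd d (diag k n) \<le> vadd d (diag k m)"
  using diag_mono[of m n k] diag_mono[of n m k] by (cases "m \<le> n") auto

lemma chain_cases:
  assumes "A \<in> chain d"
  obtains "A = {}" | a n where "a \<in> mor G" "deg G a = vadd d (diag k n)" "A = cyl k G a"
  using assms by (auto simp: chain_def)

lemma chain_nested:
  assumes "A \<in> chain d" "B \<in> chain d" shows "A \<inter> B = {} \<or> A \<subseteq> B \<or> B \<subseteq> A"
proof (cases "A = {} \<or> B = {}")
  case False
  then obtain a m b n where a: "a \<in> mor G" "deg G a = vadd d (diag k m)" "A = cyl k G a"
    and b: "b \<in> mor G" "deg G b = vadd d (diag k n)" "B = cyl k G b"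
    using chain_cases[OF assms(1)] chain_cases[OF assms(2)] by metis
  consider "deg G a \<le> deg G b" | "deg G b \<le> deg G a" using diag_linear[of d m n] a(2) b(2) by auto
  then show ?thesis
  proof cases
    case 1
    then show ?thesis using cyl_Int_cases[OF a(1) b(1)] unfolding a(3) b(3) by (metis inf_le1)
  next
    case 2
    then show ?thesis using cyl_Int_cases[OF b(1) a(1)] unfolding a(3) b(3) by (metis inf_commute inf_le1)
  qed
qed auto

lemma Int_chain:
  assumes "A \<in> chain d" "B \<in> chain d" shows "A \<inter> B \<in> chain d"
proof -
  consider "A \<inter> B = {}" | "A \<inter> B = A" | "A \<inter> B = B" using chain_nested[OF assms] by blast
  then show ?thesis using assms by cases (auto simp: chain_def)
qed

lemma countable_chain: "countable (chain d)"
  unfolding chain_def by (intro countable_insert countable_image countable_subset[OF _ countable_mor]) auto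

text \<open>Some degree of the chain dominates that of \<open>l\<close>, and row-finiteness makes
  the cylinder a finite union of cylinders of that degree.\<close>

lemma cyl_in_sigma_chain:
  assumes "d \<in> NK k" "l \<in> mor G" shows "cyl k G l \<in> sigma_sets (infpaths k G) (chain d)"
proof -
  obtain n where n: "deg G l \<le> vadd d (diag k n)" using cofinal_vadd_diag deg_NK assms by blast
  have p: "vadd d (diag k n) \<in> NK k" using assms by simp
  interpret sigma_algebra "infpaths k G" "sigma_sets (infpaths k G) (chain d)"
    by (rule sigma_algebra_sigma_sets[OF chain_subset])
  show ?thesis
    unfolding cyl_eq_Union_exts[OF assms(2) p n]
    by (intro finite_UN finite_exts[OF assms(2) p n]) (auto simp: exts_def chain_def intro!: sigma_sets.Basic)
qed

lemma sigma_sets_chain: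
  assumes "d \<in> NK k"
  shows "sigma_sets (infpaths k G) (chain d) = sigma_sets (infpaths k G) (cyl k G ` mor G)"
proof (rule sigma_sets_eqI)
  fix A assume "A \<in> chain d"
  then show "A \<in> sigma_sets (infpaths k G) (cyl k G ` mor G)"
    by (cases rule: chain_cases) (auto intro: sigma_sets.Empty)
qed (use cyl_in_sigma_chain assms in auto)

section \<open>Comparison of measures and measurability of the standard maps\<close>

lemma path_measure_space: "path_measure k G M \<Longrightarrow> space M = infpaths k G"
  by (simp add: path_measure_def)

lemma path_measure_sets:
  "path_measure k G M \<Longrightarrow> d \<in> NK k \<Longrightarrow> sets M = sigma_sets (infpaths k G) (chain d)"
  using sets_measure_of[of "cyl k G ` mor G" "infpaths k G"] cyl_subset_infpaths
  by (auto simp: path_measure_def path_space_def sigma_sets_chain image_subset_iff)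

lemma cyl_sets [measurable]: "path_measure k G M \<Longrightarrow> l \<in> mor G \<Longrightarrow> cyl k G l \<in> sets M"
  using cyl_in_sigma_chain[of vzero l] path_measure_sets[of M vzero] by simp

text \<open>Uniqueness on an intersection-stable generator. The cylinders of degree \<open>d\<close>
  supply the countable cover by sets of finite measure.\<close>

lemma path_measure_eqI:
  assumes M: "path_measure k G M" and N: "path_measure k G N" and d: "d \<in> NK k"
    and eq: "\<And>a n. a \<in> mor G \<Longrightarrow> deg G a = vadd d (diag k n) \<Longrightarrow>
      emeasure M (cyl k G a) = emeasure N (cyl k G a)"
    and fin: "\<And>a. a \<in> mor G \<Longrightarrow> emeasure M (cyl k G a) \<noteq> \<infinity>"
  shows "M = N"
proof (rule measure_eqI_generator_eq_countable)
  show "Int_stable (chain d)" by (auto simp: Int_stable_def Int_chain)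
  show "chain d \<subseteq> Pow (infpaths k G)" by (rule chain_subset)
  show "emeasure M X = emeasure N X" if "X \<in> chain d" for X
    using that by (cases rule: chain_cases) (auto simp: eq)
  show "sets M = sigma_sets (infpaths k G) (chain d)" "sets N = sigma_sets (infpaths k G) (chain d)"
    using M N d path_measure_sets by auto
  show "chain d \<subseteq> chain d" ..
  show "\<Union> (chain d) = infpaths k G"
  proof
    show "infpaths k G \<subseteq> \<Union> (chain d)"
    proof
      fix x assume "x \<in> infpaths k G"
      then obtain a where "a \<in> mor G" "deg G a = d" "x \<in> cyl k G a"
        using infpaths_eq_Union[OF d] by auto
      then show "x \<in> \<Union> (chain d)" by (auto simp: chain_def intro!: exI[of _ 0] exI[of _ a])
    qed
  qed (use chain_subset in auto)
  show "emeasure M A \<noteq> \<infinity>" if "A \<in> chain d" for A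
    using that by (cases rule: chain_cases) (use fin in auto)
qed (rule countable_chain)

lemma shift_measurable [measurable]:
  assumes M: "path_measure k G M" and n: "n \<in> NK k" shows "shift k n \<in> measurable M M"
proof (rule measurable_sigma_sets)
  show "sets M = sigma_sets (infpaths k G) (cyl k G ` mor G)"
    using path_measure_sets[OF M vzero_NK] sigma_sets_chain[OF vzero_NK] by simp
  show "cyl k G ` mor G \<subseteq> Pow (infpaths k G)" using cyl_subset_infpaths by auto
  show "shift k n \<in> space M \<rightarrow> infpaths k G" using shift_infpaths n M by (auto simp: path_measure_space)
  fix A assume "A \<in> cyl k G ` mor G"
  then obtain e where e: "e \<in> mor G" "A = cyl k G e" by auto
  \<comment> \<open>Sorting paths by their initial segment \<open>a\<close> of degree
    \<open>n\<close> writes the preimage as a countable union of cylinders of composites with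
    \<open>e\<close>.\<close>
  let ?S = "{a \<in> mor G. deg G a = n \<and> src G a = rng G e}"
  have "shift k n -` A \<inter> space M = (\<Union>a\<in>?S. cyl k G (cmp G a e))"
  proof (intro set_eqI iffI)
    fix x assume x: "x \<in> shift k n -` A \<inter> space M"
    then have xi: "x \<in> infpaths k G" using M by (simp add: path_measure_space)
    obtain a where a: "a \<in> mor G" "deg G a = n" "x \<in> cyl k G a" using infpaths_eq_Union[OF n] xi by auto
    have s: "shift k n x \<in> cyl k G e" using x e by simp
    then have "shift k n x \<in> cyl k G (rng G e)" using cyl_subset_rng e by blast
    moreover have "shift k n x \<in> cyl k G (src G a)" using shift_cyl_src[OF a(3,1)] a by simp
    ultimately have "src G a = rng G e"
      using cyl_disjoint[of "src G a" "rng G e"] a e by auto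
    then have "x \<in> cyl k G (cmp G a e)" using shift_mem_cyl_iff[OF a(3,1) e(1)] s a by simp
    then show "x \<in> (\<Union>a\<in>?S. cyl k G (cmp G a e))" using a \<open>src G a = rng G e\<close> by auto
  next
    fix x assume "x \<in> (\<Union>a\<in>?S. cyl k G (cmp G a e))"
    then obtain a where a: "a \<in> mor G" "deg G a = n" "src G a = rng G e" "x \<in> cyl k G (cmp G a e)" by auto
    then have "x \<in> cyl k G a" using cyl_initial[of "cmp G a e" "deg G a"] initial_cmp(1)[of a e] e by auto
    then show "x \<in> shift k n -` A \<inter> space M"
      using shift_mem_cyl_iff[of x a e] a e M cyl_subset_infpaths by (auto simp: path_measure_space)
  qed
  also have "\<dots> \<in> sets M"
    by (intro sets.countable_UN' countable_subset[OF _ countable_mor]) (use M e in auto)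
  finally show "shift k n -` A \<inter> space M \<in> sets M" .
qed

lemma prefix_vimage_cyl:
  assumes l: "l \<in> mor G" and e: "e \<in> mor G" "deg G l \<le> deg G e"
  shows "prefix k G l -` cyl k G e \<inter> cyl k G (src G l) =
    (if initial G e (deg G l) = l then cyl k G (final G e (deg G l)) else {})"
proof (cases "initial G e (deg G l) = l")
  case True
  note f = initial_final[OF e]
  have r: "src G l = rng G (final G e (deg G l))" using f True by simp
  have "prefix k G l x \<in> cyl k G e \<longleftrightarrow> x \<in> cyl k G (final G e (deg G l))" if "x \<in> cyl k G (src G l)" for x
    using shift_mem_cyl_iff[OF prefix_cyl(1)[OF l that] l f(3) r] prefix_cyl(2)[OF l that] f(5) True by simp
  moreover have "cyl k G (final G e (deg G l)) \<subseteq> cyl k G (src G l)"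
    using cyl_subset_rng[OF f(3)] r by simp
  ultimately show ?thesis using True by auto
next
  case False
  then have "cyl k G l \<inter> cyl k G e = {}" using cyl_Int_cases[OF l e] by simp
  then show ?thesis using False prefix_cyl(1)[OF l] by auto
qed

lemma prefix_measurable:
  assumes M: "path_measure k G M" and l: "l \<in> mor G"
  shows "prefix k G l \<in> measurable (restrict_space M (cyl k G (src G l))) M"
proof (rule measurable_sigma_sets)
  have d: "deg G l \<in> NK k" using l by simp
  \<comment> \<open>Basing the chain at the degree of \<open>l\<close> makes every generator at
    least as long as \<open>l\<close>, so that its preimage is a single cylinder or empty.\<close>
  show "sets M = sigma_sets (infpaths k G) (chain (deg G l))"
    using path_measure_sets[OF M d] by simp
  show "chain (deg G l) \<subseteq> Pow (infpaths k G)" by (rule chain_subset)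
  have D: "cyl k G (src G l) \<in> sets M" using M l by (simp add: cyl_sets obj_mor)
  have sp: "space (restrict_space M (cyl k G (src G l))) = cyl k G (src G l)"
    using sets.sets_into_space[OF D] by (auto simp: space_restrict_space)
  show "prefix k G l \<in> space (restrict_space M (cyl k G (src G l))) \<rightarrow> infpaths k G"
    using prefix_cyl(1)[OF l] cyl_subset_infpaths by (auto simp: sp)
  fix A assume "A \<in> chain (deg G l)"
  then have "prefix k G l -` A \<inter> cyl k G (src G l) \<in> sets M"
  proof (cases rule: chain_cases)
    case (2 e n)
    then show ?thesis using prefix_vimage_cyl[OF l, of e] cyl_sets[OF M] initial_final(3)[of e "deg G l"] by simp
  qed auto
  then show "prefix k G l -` A \<inter> space (restrict_space M (cyl k G (src G l))) \<in> sets (restrict_space M (cyl k G (src G l)))"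
    unfolding sp using D by (subst sets_restrict_space_iff) auto
qed

text \<open>Finite additivity by refinement: all cylinders involved are cut into cylinders of one
  common degree, where the claim is about splitting a finite index set.\<close>

lemma weight_disjoint_union:
  fixes w :: "'a \<Rightarrow> real"
  assumes w: "\<And>l p. l \<in> mor G \<Longrightarrow> p \<in> NK k \<Longrightarrow> deg G l \<le> p \<Longrightarrow> w l = (\<Sum>a\<in>exts G l p. w a)"
    and l: "l \<in> mor G" and J: "finite J" "b ` J \<subseteq> mor G"
    and U: "cyl k G l = (\<Union>j\<in>J. cyl k G (b j))" and disj: "disjoint_family_on (\<lambda>j. cyl k G (b j)) J"
  shows "w l = (\<Sum>j\<in>J. w (b j))"
proof -
  have "finite (insert (deg G l) (deg G ` b ` J))" "insert (deg G l) (deg G ` b ` J) \<subseteq> NK k"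
    using l J by (auto simp: image_subset_iff)
  from NK_upper_bound[OF this] obtain N
    where N: "\<And>n. n \<in> insert (deg G l) (deg G ` b ` J) \<Longrightarrow> n \<le> diag k N" by blast
  let ?p = "diag k N"
  \<comment> \<open>At the common degree, being an extension is the same as inclusion of cylinders,
    because cylinders are nonempty. The set identity \<open>U\<close> therefore becomes an identity
    of index sets.\<close>
  have ext: "exts G a ?p = {c \<in> mor G. deg G c = ?p \<and> cyl k G c \<subseteq> cyl k G a}"
    if "a \<in> mor G" "deg G a \<le> ?p" for a
  proof -
    have "initial G c (deg G a) = a \<longleftrightarrow> cyl k G c \<subseteq> cyl k G a" if c: "c \<in> mor G" "deg G c = ?p" for c
      using cyl_Int_cases[of a c] \<open>a \<in> mor G\<close> \<open>deg G a \<le> ?p\<close> c cyl_nonempty[OF c(1)]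
      by (cases "initial G c (deg G a) = a") (simp_all, blast+)
    then show ?thesis unfolding exts_def by blast
  qed
  have ne: "\<exists>x. x \<in> cyl k G c" if "c \<in> mor G" for c using cyl_nonempty that by auto
  have bJ: "b j \<in> mor G" "deg G (b j) \<le> ?p" if "j \<in> J" for j using J N that by auto
  have "exts G l ?p = (\<Union>j\<in>J. exts G (b j) ?p)"
  proof (intro set_eqI iffI)
    fix c assume "c \<in> exts G l ?p"
    then have c: "c \<in> mor G" "deg G c = ?p" "cyl k G c \<subseteq> cyl k G l" using ext[of l] l N by auto
    obtain x where x: "x \<in> cyl k G c" using ne c by blast
    then obtain j where j: "j \<in> J" "x \<in> cyl k G (b j)" using c U by auto
    have "cyl k G c \<subseteq> cyl k G (b j)"
      using cyl_Int_cases[of "b j" c] bJ[OF j(1)] c x j by (auto split: if_splits)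
    then show "c \<in> (\<Union>j\<in>J. exts G (b j) ?p)" using c j ext[OF bJ[OF j(1)]] by auto
  next
    fix c assume "c \<in> (\<Union>j\<in>J. exts G (b j) ?p)"
    then obtain j where j: "j \<in> J" "c \<in> exts G (b j) ?p" by auto
    then show "c \<in> exts G l ?p" using ext[OF bJ[OF j(1)]] ext[OF l N] U by auto
  qed
  then have "w l = (\<Sum>c\<in>(\<Union>j\<in>J. exts G (b j) ?p). w c)" using w[OF l _ N] by simp
  also have "\<dots> = (\<Sum>j\<in>J. \<Sum>c\<in>exts G (b j) ?p. w c)"
  proof (rule sum.UNION_disjoint)
    show "\<forall>j\<in>J. finite (exts G (b j) ?p)" using finite_exts bJ by auto
    show "\<forall>i\<in>J. \<forall>j\<in>J. i \<noteq> j \<longrightarrow> exts G (b i) ?p \<inter> exts G (b j) ?p = {}"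
    proof (intro ballI impI)
      fix i j assume ij: "i \<in> J" "j \<in> J" "i \<noteq> j"
      then have "cyl k G (b i) \<inter> cyl k G (b j) = {}" using disj by (auto simp: disjoint_family_on_def)
      then show "exts G (b i) ?p \<inter> exts G (b j) ?p = {}"
        using ext[OF bJ[OF ij(1)]] ext[OF bJ[OF ij(2)]] ne by fastforce
    qed
  qed (rule J)
  also have "\<dots> = (\<Sum>j\<in>J. w (b j))"
    by (intro sum.cong refl w[symmetric]) (use bJ in auto)
  finally show ?thesis .
qed

text \<open>For a difference of nested cylinders: the larger one splits into finitely many disjoint
  cylinders of the degree of the smaller one, and the smaller one is removed from the list.\<close>

lemma semiring_chain: "semiring_of_sets (infpaths k G) (chain vzero)"
proof
  show "chain vzero \<subseteq> Pow (infpaths k G)" by (rule chain_subset)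
  show "{} \<in> chain vzero" by (simp add: chain_def)
  show "A \<inter> B \<in> chain vzero" if "A \<in> chain vzero" "B \<in> chain vzero" for A B using that by (rule Int_chain)
  fix A B assume AB: "A \<in> chain vzero" "B \<in> chain vzero"
  consider "A \<inter> B = {}" | "A \<subseteq> B" | "B \<subseteq> A" "B \<noteq> {}" "\<not> A \<subseteq> B" using chain_nested[OF AB] by blast
  then show "\<exists>C\<subseteq>chain vzero. finite C \<and> disjoint C \<and> A - B = \<Union> C"
  proof cases
    case 1
    then show ?thesis using AB by (intro exI[of _ "{A}"]) auto
  next
    case 2
    then show ?thesis by (intro exI[of _ "{}"]) auto
  next
    case 3
    then obtain a m b n where a: "a \<in> mor G" "deg G a = diag k m" "A = cyl k G a"
      and b: "b \<in> mor G" "deg G b = diag k n" "B = cyl k G b"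
      using chain_cases[OF AB(1)] chain_cases[OF AB(2)] by (metis subset_empty vadd_vzero(2))
    have le: "deg G a \<le> deg G b"
    proof (rule ccontr)
      assume n: "\<not> deg G a \<le> deg G b"
      then have "deg G b \<le> deg G a" using a b diag_linear[of vzero m n] by auto
      then show False using cyl_Int_cases[of b a] a b 3 by (auto split: if_splits)
    qed
    let ?C = "cyl k G ` (exts G a (deg G b) - {b})"
    have U: "A = (\<Union>c\<in>exts G a (deg G b). cyl k G c)"
      using cyl_eq_Union_exts[OF a(1) _ le] a b by simp
    have disj: "cyl k G c \<inter> cyl k G c' = {}" if "c \<in> exts G a (deg G b)" "c' \<in> exts G a (deg G b)" "c \<noteq> c'" for c c'
      using that cyl_disjoint[of c c'] by (auto simp: exts_def)
    have bA: "b \<in> exts G a (deg G b)"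
      using cyl_Int_cases[OF a(1) b(1) le] 3 a b by (auto simp: exts_def split: if_splits)
    have "A - B = \<Union> ?C" unfolding U b(3) using disj[OF _ bA] by auto
    moreover have "finite ?C" using finite_exts[OF a(1) _ le] b by simp
    moreover have "disjoint ?C" unfolding disjoint_def using disj by blast
    moreover have "?C \<subseteq> chain vzero" using b by (auto simp: chain_def exts_def)
    ultimately show ?thesis by blast
  qed
qed

text \<open>By compactness a disjoint decomposition of a cylinder into members of the chain has only
  finitely many nonempty pieces, so countable additivity reduces to
  \<open>weight_disjoint_union\<close>.\<close>

lemma path_measure_exists:
  fixes w :: "'a \<Rightarrow> real"
  assumes w: "\<And>l p. l \<in> mor G \<Longrightarrow> p \<in> NK k \<Longrightarrow> deg G l \<le> p \<Longrightarrow> w l = (\<Sum>a\<in>exts G l p. w a)"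
    and nonneg: "\<And>l. l \<in> mor G \<Longrightarrow> w l \<ge> 0"
  shows "\<exists>M. path_measure k G M \<and> (\<forall>l\<in>mor G. emeasure M (cyl k G l) = ennreal (w l))"
proof -
  \<comment> \<open>Different paths can have the same cylinder, so the value is read off a chosen
    one; additivity for a one-piece decomposition shows that the choice does not matter.\<close>
  define \<mu> where "\<mu> A = (if A = {} then 0 else ennreal (w (SOME a. a \<in> mor G \<and> cyl k G a = A)))" for A
  have \<mu>_cyl: "\<mu> (cyl k G a) = ennreal (w a)" if "a \<in> mor G" for a
  proof -
    let ?b = "SOME b. b \<in> mor G \<and> cyl k G b = cyl k G a"
    have b: "?b \<in> mor G \<and> cyl k G ?b = cyl k G a" by (rule someI[of _ a]) (use that in simp)
    have "w a = (\<Sum>j\<in>{?b}. w j)"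
      by (rule weight_disjoint_union[OF w that]) (use b in \<open>auto simp: disjoint_family_on_def\<close>)
    then show ?thesis using cyl_nonempty[OF that] by (simp add: \<mu>_def)
  qed
  interpret semiring_of_sets "infpaths k G" "chain vzero" by (rule semiring_chain)
  have ca: "countably_additive (chain vzero) \<mu>"
    unfolding countably_additive_def
  proof (intro allI impI)
    fix A :: "nat \<Rightarrow> 'a ipath set"
    assume A: "range A \<subseteq> chain vzero" and disj: "disjoint_family A" and U: "(\<Union>i. A i) \<in> chain vzero"
    show "(\<Sum>i. \<mu> (A i)) = \<mu> (\<Union>i. A i)"
      using U
    proof (cases rule: chain_cases)
      case 1
      then have "A i = {}" for i by auto
      then show ?thesis by (simp add: \<mu>_def)
    next
      case (2 l m)
      let ?I = "{i. A i \<noteq> {}}"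
      have "\<forall>i\<in>?I. \<exists>b\<in>mor G. A i = cyl k G b"
        using A chain_cases by (metis (mono_tags, lifting) mem_Collect_eq range_subsetD)
      then obtain b where b: "\<And>i. A i \<noteq> {} \<Longrightarrow> b i \<in> mor G \<and> A i = cyl k G (b i)" by (auto simp: Bex_def) metis
      have sub0: "cyl k G l \<subseteq> (\<Union>c\<in>b ` ?I. cyl k G c)"
      proof
        fix x assume "x \<in> cyl k G l"
        then obtain i where i: "x \<in> A i" using 2 by auto
        then have "A i \<noteq> {}" by auto
        then show "x \<in> (\<Union>c\<in>b ` ?I. cyl k G c)" using b i by auto
      qed
      have "b ` ?I \<subseteq> mor G" using b by auto
      from cyl_compact[OF 2(1) this sub0]
      obtain B where B: "finite B" "B \<subseteq> b ` ?I" "cyl k G l \<subseteq> (\<Union>c\<in>B. cyl k G c)"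
        by (elim exE conjE) (rule that)
      obtain J where J: "finite J" "J \<subseteq> ?I" "B = b ` J" using finite_subset_image[OF B(1,2)] by blast
      have bJ: "b j \<in> mor G" "A j = cyl k G (b j)" if "j \<in> J" for j using b[of j] J(2) that by blast+
      have sub: "cyl k G l \<subseteq> (\<Union>j\<in>J. A j)" using B J bJ by auto
      \<comment> \<open>The finite subcover already exhausts the cylinder, so by disjointness the
        remaining pieces are empty.\<close>
      have "A i = {}" if "i \<notin> J" for i
      proof (rule ccontr)
        assume "A i \<noteq> {}"
        then obtain x where x: "x \<in> A i" by auto
        then have "x \<in> cyl k G l" using 2 by auto
        then obtain j where "j \<in> J" "x \<in> A j" using sub by auto
        then show False using disj x that unfolding disjoint_family_on_def by (metis IntI UNIV_I empty_iff)
      qed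
      then have "(\<Sum>i. \<mu> (A i)) = (\<Sum>i\<in>J. \<mu> (A i))"
        by (intro suminf_finite J) (auto simp: \<mu>_def)
      also have "\<dots> = (\<Sum>i\<in>J. ennreal (w (b i)))" using bJ \<mu>_cyl by (intro sum.cong) auto
      also have "\<dots> = ennreal (\<Sum>i\<in>J. w (b i))" using bJ nonneg by (intro sum_ennreal) auto
      also have "(\<Sum>i\<in>J. w (b i)) = w l"
      proof (rule weight_disjoint_union[OF w 2(1) J(1), symmetric])
        show "b ` J \<subseteq> mor G" using bJ by auto
        show "cyl k G l = (\<Union>j\<in>J. cyl k G (b j))" using sub 2(3) bJ(2)[symmetric] by auto
        show "disjoint_family_on (\<lambda>j. cyl k G (b j)) J"
          using disj by (auto simp: disjoint_family_on_def bJ(2)[symmetric])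
      qed
      finally show ?thesis using 2 \<mu>_cyl by simp
    qed
  qed
  have "positive (chain vzero) \<mu>" by (simp add: positive_def \<mu>_def)
  then obtain \<nu> where \<nu>: "\<And>A. A \<in> chain vzero \<Longrightarrow> \<nu> A = \<mu> A"
      "measure_space (infpaths k G) (sigma_sets (infpaths k G) (chain vzero)) \<nu>"
    using caratheodory[OF _ ca] by auto
  define M where "M = measure_of (infpaths k G) (sigma_sets (infpaths k G) (chain vzero)) \<nu>"
  have ss: "sigma_sets (infpaths k G) (chain vzero) \<subseteq> Pow (infpaths k G)"
    using sigma_sets_into_sp[OF chain_subset] by auto
  have M: "path_measure k G M"
  proof -
    have "space M = infpaths k G" by (simp add: M_def space_measure_of ss)
    moreover have "sets M = sigma_sets (infpaths k G) (chain vzero)"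
      unfolding M_def using ss chain_subset by (subst sets_measure_of) (simp_all only: sigma_sets_sigma_sets_eq)
    moreover have "sets (path_space k G) = sigma_sets (infpaths k G) (chain vzero)"
      unfolding path_space_def sigma_sets_chain[OF vzero_NK]
      by (rule sets_measure_of) (auto simp: cyl_def)
    ultimately show ?thesis by (simp only: path_measure_def)
  qed
  have em: "emeasure M A = \<nu> A" if "A \<in> sigma_sets (infpaths k G) (chain vzero)" for A
    unfolding M_def
    by (rule emeasure_measure_of_sigma) (use \<nu>(2) that in \<open>simp_all only: measure_space_def\<close>)
  \<comment> \<open>The extension theorem fixes the values only on the chain; a cylinder of any
    other degree is split into members of the chain.\<close>
  have "emeasure M (cyl k G l) = ennreal (w l)" if l: "l \<in> mor G" for l
  proof -
    obtain n where n: "deg G l \<le> diag k n" using diag_cofinal deg_NK l by blast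
    let ?E = "exts G l (diag k n)"
    have c: "cyl k G a \<in> chain vzero" if "a \<in> ?E" for a using that by (auto simp: exts_def chain_def)
    have "emeasure M (cyl k G l) = (\<Sum>a\<in>?E. emeasure M (cyl k G a))"
      unfolding cyl_eq_Union_exts[OF l diag_NK n]
    proof (rule sum_emeasure[symmetric])
      show "cyl k G ` ?E \<subseteq> sets M" using cyl_sets[OF M] by (auto simp: exts_def)
      show "disjoint_family_on (cyl k G) ?E"
        unfolding disjoint_family_on_def
      proof (intro ballI impI)
        fix a b assume "a \<in> ?E" "b \<in> ?E" "a \<noteq> b"
        then show "cyl k G a \<inter> cyl k G b = {}" using cyl_disjoint[of a b] by (simp add: exts_def)
      qed
    qed (use finite_exts l n in auto)
    also have "\<dots> = (\<Sum>a\<in>?E. ennreal (w a))"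
      by (intro sum.cong refl) (use c em \<nu> \<mu>_cyl in \<open>auto simp: exts_def\<close>)
    also have "\<dots> = ennreal (\<Sum>a\<in>?E. w a)" using nonneg by (intro sum_ennreal) (auto simp: exts_def)
    finally show ?thesis using w[OF l diag_NK n] by simp
  qed
  then show ?thesis using M by blast
qed

section \<open>The partition of the path space by vertices\<close>

lemma countable_obj: "countable (obj G)"
  by (rule countable_subset[OF _ countable_mor]) (auto simp: obj_mor)

definition vertex_cyl :: "nat \<Rightarrow> 'a ipath set" where
  "vertex_cyl n = (if n \<in> to_nat_on (obj G) ` obj G then cyl k G (from_nat_into (obj G) n) else {})"

lemma vertex_cyl_to_nat: "v \<in> obj G \<Longrightarrow> vertex_cyl (to_nat_on (obj G) v) = cyl k G v"
  using countable_obj by (simp add: vertex_cyl_def)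

lemma vertex_cyl_cases:
  obtains "vertex_cyl n = {}" | v where "v \<in> obj G" "n = to_nat_on (obj G) v" "vertex_cyl n = cyl k G v"
  by (cases "n \<in> to_nat_on (obj G) ` obj G") (auto simp: vertex_cyl_to_nat, simp add: vertex_cyl_def)

lemma vertex_cyl_chain: "vertex_cyl n \<in> chain vzero"
  by (rule vertex_cyl_cases[of n]) (auto simp: chain_def obj_mor intro!: image_eqI exI[of _ 0])

lemma mem_vertex_cyl_iff:
  assumes "x \<in> infpaths k G" shows "x \<in> vertex_cyl n \<longleftrightarrow> n = to_nat_on (obj G) (x vzero vzero)"
proof -
  have x: "x vzero vzero \<in> obj G" "x \<in> cyl k G (x vzero vzero)"
    using path_obj[OF assms vzero_NK] path_in_cyl[OF assms vzero_NK] by simp_all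
  have c: "x \<in> cyl k G v \<longleftrightarrow> v = x vzero vzero" if "v \<in> obj G" for v
    using assms that by (auto simp: cyl_def)
  have t: "to_nat_on (obj G) v = to_nat_on (obj G) (x vzero vzero) \<longleftrightarrow> v = x vzero vzero" if "v \<in> obj G" for v
    using inj_on_eq_iff[OF inj_on_to_nat_on[OF countable_obj] that x(1)] .
  show ?thesis
  proof (cases rule: vertex_cyl_cases[of n])
    case 1
    then show ?thesis using vertex_cyl_to_nat[OF x(1)] x(2) by (metis empty_iff)
  next
    case (2 v)
    show ?thesis unfolding 2(3) unfolding 2(2) using c[OF 2(1)] t[OF 2(1)] by simp
  qed
qed

lemma vertex_cyl_subset: "vertex_cyl n \<subseteq> infpaths k G"
  by (rule vertex_cyl_cases[of n]) (auto simp: cyl_def)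

lemma disjoint_vertex_cyl: "disjoint_family vertex_cyl"
  unfolding disjoint_family_on_def
proof (intro ballI impI)
  fix m n :: nat assume "m \<noteq> n"
  show "vertex_cyl m \<inter> vertex_cyl n = {}"
  proof (intro equals0I)
    fix x assume x: "x \<in> vertex_cyl m \<inter> vertex_cyl n"
    then have "x \<in> infpaths k G" using vertex_cyl_subset by blast
    then show False using x \<open>m \<noteq> n\<close> by (simp add: mem_vertex_cyl_iff)
  qed
qed

lemma UN_vertex_cyl: "(\<Union>n. vertex_cyl n) = infpaths k G"
proof
  show "infpaths k G \<subseteq> (\<Union>n. vertex_cyl n)" using mem_vertex_cyl_iff by auto
qed (use vertex_cyl_subset in auto)

lemma vertex_cyl_sets: "path_measure k G M \<Longrightarrow> vertex_cyl n \<in> sets M"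
  by (rule vertex_cyl_cases[of n]) (auto simp: cyl_sets obj_mor)

lemma L2_dense_cyl:
  assumes M: "path_measure k G M" and fin: "finite_measure M" and f: "f \<in> L2 M"
  shows "f \<in> l2_closure M (lspan (mor G) (\<lambda>l. indicator (cyl k G l)))"
proof (rule finite_measure.L2_dense[OF fin _ _ f])
  show u: "indicator (cyl k G i) \<in> L2 M" if "i \<in> mor G" for i
    using finite_measure.L2_indicator[OF fin cyl_sets[OF M that]] .
  fix A assume A: "A \<in> sets M"
  show "indicator A \<in> l2_closure M (lspan (mor G) (\<lambda>l. indicator (cyl k G l)))"
  proof (rule finite_measure.indicator_dense[OF fin u _ _ _ _ vertex_cyl_chain disjoint_vertex_cyl _ A])
    show "Int_stable (chain vzero)" by (auto simp: Int_stable_def Int_chain)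
    show "chain vzero \<subseteq> Pow (space M)" using chain_subset M by (simp add: path_measure_space)
    show "sets M = sigma_sets (space M) (chain vzero)"
      using path_measure_sets[OF M vzero_NK] M by (simp add: path_measure_space)
    show "(\<Union>n. vertex_cyl n) = space M" using UN_vertex_cyl M by (simp add: path_measure_space)
    show "indicator A \<in> lspan (mor G) (\<lambda>l. indicator (cyl k G l))" if "A \<in> chain vzero" for A
      using that
    proof (cases rule: chain_cases)
      case 1
      have "(indicator {} :: 'a ipath \<Rightarrow> complex) = (\<lambda>_. 0)" by auto
      then show ?thesis using lspan.zero[of "mor G" "\<lambda>l. indicator (cyl k G l)"] 1 by simp
    next
      case (2 a n)
      then show ?thesis using lspan_base[of a "mor G" "\<lambda>l. indicator (cyl k G l)"] by simp
    qed
  qed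
qed

section \<open>Restriction to cylinders and the composed measure\<close>

lemma space_restrict_cyl:
  "path_measure k G M \<Longrightarrow> space (restrict_space M (cyl k G l)) = cyl k G l"
  using cyl_subset_infpaths by (auto simp: space_restrict_space path_measure_space)

lemma sets_restrict_cyl:
  "path_measure k G M \<Longrightarrow> l \<in> mor G \<Longrightarrow> A \<in> sets (restrict_space M (cyl k G l)) \<longleftrightarrow> A \<subseteq> cyl k G l \<and> A \<in> sets M"
  using cyl_sets[of M l] cyl_subset_infpaths[of l] by (subst sets_restrict_space_iff) (auto simp: path_measure_space Int_absorb2)

lemma src_mor: "l \<in> mor G \<Longrightarrow> src G l \<in> mor G" by (simp add: obj_mor)

text \<open>\<open>comp_meas\<close> is the image of the measure on the range under the inverse map, the shift.\<close>

lemma comp_meas_prefix: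
  assumes M: "path_measure k G M" and l: "l \<in> mor G"
  defines "D \<equiv> cyl k G (src G l)"
  defines "\<nu> \<equiv> distr (restrict_space M (cyl k G l)) (restrict_space M D) (shift k (deg G l))"
  shows "comp_meas M D (prefix k G l) = \<nu>"
    and "A \<in> sets M \<Longrightarrow> A \<subseteq> D \<Longrightarrow> emeasure (comp_meas M D (prefix k G l)) A = emeasure M (prefix k G l ` A)"
    and "A \<in> sets M \<Longrightarrow> A \<subseteq> D \<Longrightarrow> prefix k G l ` A \<in> sets M"
proof -
  have D: "D \<in> sets M" and Z: "cyl k G l \<in> sets M" using M l by (auto simp: D_def cyl_sets src_mor)
  have meas: "shift k (deg G l) \<in> measurable (restrict_space M (cyl k G l)) (restrict_space M D)"
    using shift_cyl_src[OF _ l] shift_measurable[OF M, of "deg G l"] l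
    by (intro measurable_restrict_space3) (auto simp: D_def)
  have sp: "space \<nu> = D" "sets \<nu> = sets (restrict_space M D)"
    by (simp_all add: \<nu>_def D_def space_restrict_cyl[OF M])
  have vim: "shift k (deg G l) -` A \<inter> space (restrict_space M (cyl k G l)) = prefix k G l ` A" if "A \<subseteq> D" for A
    using prefix_image[OF l, of A] that unfolding space_restrict_cyl[OF M] D_def by auto
  show im: "prefix k G l ` A \<in> sets M" if "A \<in> sets M" "A \<subseteq> D" for A
  proof -
    have "A \<in> sets (restrict_space M D)" using that sets_restrict_cyl[OF M src_mor[OF l]] by (simp add: D_def)
    from measurable_sets[OF meas this] show ?thesis
      unfolding vim[OF that(2)] sets_restrict_cyl[OF M l] by simp
  qed
  have em: "emeasure \<nu> A = emeasure M (prefix k G l ` A)" if A: "A \<in> sets M" "A \<subseteq> D" for A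
  proof -
    have "A \<in> sets (restrict_space M D)" using that sets_restrict_cyl[OF M src_mor[OF l]] by (simp add: D_def)
    then have "emeasure \<nu> A = emeasure (restrict_space M (cyl k G l)) (prefix k G l ` A)"
      unfolding \<nu>_def by (subst emeasure_distr[OF meas]) (simp_all add: vim[OF A(2)])
    also have "\<dots> = emeasure M (prefix k G l ` A)"
      using prefix_cyl(1)[OF l] A(2) Z sets.sets_into_space[OF Z] by (intro emeasure_restrict_space) (auto simp: D_def Int_absorb2)
    finally show ?thesis .
  qed
  show eq: "comp_meas M D (prefix k G l) = \<nu>"
  proof -
    have "comp_meas M D (prefix k G l) = measure_of D (sets (restrict_space M D)) (emeasure \<nu>)"
      unfolding comp_meas_def
    proof (rule measure_of_eq)
      show "sets (restrict_space M D) \<subseteq> Pow D" using sets.space_closed[of \<nu>] sp by simp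
      fix A assume "A \<in> sigma_sets D (sets (restrict_space M D))"
      then have "A \<in> sets (restrict_space M D)"
        using sets.sigma_sets_eq[of \<nu>] sp by simp
      then show "emeasure M (prefix k G l ` A) = emeasure \<nu> A"
        using em sets_restrict_cyl[OF M src_mor[OF l]] by (simp add: D_def)
    qed
    also have "\<dots> = \<nu>" using measure_of_of_measure[of \<nu>] sp by simp
    finally show ?thesis .
  qed
  show "emeasure (comp_meas M D (prefix k G l)) A = emeasure M (prefix k G l ` A)" if "A \<in> sets M" "A \<subseteq> D"
    unfolding eq by (rule em[OF that])
qed

end

text \<open>What both directions share for a single path: a weight whose squared modulus is the
  density of the pushforward along prefixing. It yields the change of variables and makes the
  weighted composition operator \<open>S\<close> a contraction.\<close>

locale prefix_weight = row_finite_kgraph k G for k and G :: "'a kgraph" +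
  fixes M :: "'a ipath measure" and l :: 'a and f :: "'a ipath \<Rightarrow> complex"
  assumes M: "path_measure k G M" and l: "l \<in> mor G" and f_L2: "f \<in> L2 M"
    and weight: "density M (\<lambda>x. ennreal ((cmod (f x))\<^sup>2)) = distr (restrict_space M (cyl k G (src G l))) M (prefix k G l)"
begin

lemma f_meas [measurable]: "f \<in> borel_measurable M" by (rule L2D(1)[OF f_L2])

lemma cyl_meas [measurable]: "cyl k G l \<in> sets M" "cyl k G (src G l) \<in> sets M"
  using M l by (auto simp: cyl_sets src_mor)

lemma shift_meas [measurable]: "shift k (deg G l) \<in> measurable M M"
  using shift_measurable[OF M] l by simp

lemma prefix_meas [measurable]: "prefix k G l \<in> measurable (restrict_space M (cyl k G (src G l))) M"
  by (rule prefix_measurable[OF M l])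

lemma nn_change:
  assumes [measurable]: "h \<in> borel_measurable M"
  shows "(\<integral>\<^sup>+x. ennreal ((cmod (f x))\<^sup>2) * h x \<partial>M) = (\<integral>\<^sup>+x. h (prefix k G l x) \<partial>restrict_space M (cyl k G (src G l)))"
proof -
  have "(\<integral>\<^sup>+x. ennreal ((cmod (f x))\<^sup>2) * h x \<partial>M) = (\<integral>\<^sup>+x. h x \<partial>density M (\<lambda>x. ennreal ((cmod (f x))\<^sup>2)))"
    by (subst nn_integral_density) auto
  also have "\<dots> = (\<integral>\<^sup>+x. h (prefix k G l x) \<partial>restrict_space M (cyl k G (src G l)))"
    unfolding weight by (subst nn_integral_distr) auto
  finally show ?thesis .
qed

lemma integral_change:
  fixes h :: "'a ipath \<Rightarrow> complex"
  assumes [measurable]: "h \<in> borel_measurable M"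
  shows "(\<integral>x. (cmod (f x))\<^sup>2 *\<^sub>R h x \<partial>M) = (\<integral>x. indicator (cyl k G (src G l)) x * h (prefix k G l x) \<partial>M)"
proof -
  have "(\<integral>x. (cmod (f x))\<^sup>2 *\<^sub>R h x \<partial>M) = (\<integral>x. h x \<partial>density M (\<lambda>x. ennreal ((cmod (f x))\<^sup>2)))"
    by (subst integral_density) auto
  also have "\<dots> = (\<integral>x. h (prefix k G l x) \<partial>restrict_space M (cyl k G (src G l)))"
    unfolding weight by (subst integral_distr) auto
  also have "\<dots> = (\<integral>x. indicator (cyl k G (src G l)) x *\<^sub>R h (prefix k G l x) \<partial>M)"
    using cyl_meas by (subst integral_restrict_space) (auto simp: set_lebesgue_integral_def)
  also have "\<dots> = (\<integral>x. indicator (cyl k G (src G l)) x * h (prefix k G l x) \<partial>M)"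
    by (intro Bochner_Integration.integral_cong) (auto simp: indicator_def)
  finally show ?thesis .
qed

text \<open>The pushforward is carried by the range of the prefixing map, and so is its
  density.\<close>

lemma support: "AE x in M. x \<notin> cyl k G l \<longrightarrow> f x = 0"
proof -
  have "(\<integral>\<^sup>+x. ennreal ((cmod (f x))\<^sup>2) * indicator (space M - cyl k G l) x \<partial>M)
      = (\<integral>\<^sup>+x. indicator (space M - cyl k G l) (prefix k G l x) \<partial>restrict_space M (cyl k G (src G l)))"
    by (rule nn_change) measurable
  also have "\<dots> = (\<integral>\<^sup>+x. 0 \<partial>restrict_space M (cyl k G (src G l)))"
    by (intro nn_integral_cong) (auto simp: space_restrict_cyl[OF M] prefix_cyl[OF l])
  finally have "(\<integral>\<^sup>+x. ennreal ((cmod (f x))\<^sup>2) * indicator (space M - cyl k G l) x \<partial>M) = 0" by simp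
  then have "AE x in M. ennreal ((cmod (f x))\<^sup>2) * indicator (space M - cyl k G l) x = 0"
    using nn_integral_0_iff_AE[of "\<lambda>x. ennreal ((cmod (f x))\<^sup>2) * indicator (space M - cyl k G l) x" M] by auto
  then show ?thesis by (rule AE_mp) (auto intro!: AE_I2 simp: indicator_def)
qed

abbreviation S :: "('a ipath \<Rightarrow> complex) \<Rightarrow> 'a ipath \<Rightarrow> complex" where
  "S h \<equiv> (\<lambda>x. f x * h (shift k (deg G l) x))"

lemma S_nn:
  assumes h: "h \<in> borel_measurable M"
  shows "(\<integral>\<^sup>+x. ennreal ((cmod (S h x))\<^sup>2) \<partial>M) = (\<integral>\<^sup>+x. ennreal ((cmod (h x))\<^sup>2) * indicator (cyl k G (src G l)) x \<partial>M)"
proof -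
  note [measurable] = h
  have "(\<integral>\<^sup>+x. ennreal ((cmod (S h x))\<^sup>2) \<partial>M) = (\<integral>\<^sup>+x. ennreal ((cmod (f x))\<^sup>2) * ennreal ((cmod (h (shift k (deg G l) x)))\<^sup>2) \<partial>M)"
    by (simp add: norm_mult power_mult_distrib ennreal_mult)
  also have "\<dots> = (\<integral>\<^sup>+x. ennreal ((cmod (h (shift k (deg G l) (prefix k G l x))))\<^sup>2) \<partial>restrict_space M (cyl k G (src G l)))"
    by (subst nn_change) auto
  also have "\<dots> = (\<integral>\<^sup>+x. ennreal ((cmod (h x))\<^sup>2) \<partial>restrict_space M (cyl k G (src G l)))"
    by (intro nn_integral_cong) (simp add: space_restrict_cyl[OF M] prefix_cyl[OF l])
  also have "\<dots> = (\<integral>\<^sup>+x. ennreal ((cmod (h x))\<^sup>2) * indicator (cyl k G (src G l)) x \<partial>M)"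
    using cyl_meas by (subst nn_integral_restrict_space) auto
  finally show ?thesis .
qed

lemma S_L2: assumes h: "h \<in> L2 M" shows "S h \<in> L2 M" "l2sq M (S h) \<le> l2sq M h"
proof -
  note [measurable] = L2D(1)[OF h]
  have "(\<integral>\<^sup>+x. ennreal ((cmod (S h x))\<^sup>2) \<partial>M) \<le> (\<integral>\<^sup>+x. ennreal ((cmod (h x))\<^sup>2) \<partial>M)"
    unfolding S_nn[OF L2D(1)[OF h]] by (intro nn_integral_mono) (auto simp: indicator_def)
  then have *: "(\<integral>\<^sup>+x. ennreal ((cmod (S h x))\<^sup>2) \<partial>M) \<le> ennreal (l2sq M h)"
    by (simp add: nn_integral_l2sq[OF h])
  show "S h \<in> L2 M" "l2sq M (S h) \<le> l2sq M h" by (rule L2_I_nn_integral[OF _ *]; measurable)+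
qed

end

section \<open>Monic representations\<close>

locale ck_representation = row_finite_kgraph k G + hilbert sm ip
  for k and G :: "'a kgraph" and sm :: "complex \<Rightarrow> 'h::ab_group_add \<Rightarrow> 'h" and ip +
  fixes t :: "'a \<Rightarrow> 'h \<Rightarrow> 'h"
  assumes CK: "CK_family k G sm ip t"
begin

lemma CK_conjuncts:
  "\<forall>l\<in>mor G. hbounded sm ip (t l)"
  "\<forall>v\<in>obj G. t v \<circ> t v = t v \<and> hadj ip (t v) = t v"
  "\<forall>v\<in>obj G. \<forall>w\<in>obj G. v \<noteq> w \<longrightarrow> t v \<circ> t w = (\<lambda>_. 0)"
  "\<forall>l\<in>mor G. \<forall>m\<in>mor G. src G l = rng G m \<longrightarrow> t l \<circ> t m = t (cmp G l m)"
  "\<forall>l\<in>mor G. hadj ip (t l) \<circ> t l = t (src G l)"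
  "\<forall>v\<in>obj G. \<forall>n\<in>NK k. t v = (\<lambda>x. \<Sum>l\<in>vLn G v n. t l (hadj ip (t l) x))"
  by (insert CK[unfolded CK_family_def]; (elim conjE)?; assumption)+

section \<open>Operator identities in a Cuntz-Krieger family\<close>

abbreviation ts :: "'a \<Rightarrow> 'h \<Rightarrow> 'h" where "ts l \<equiv> hadj ip (t l)"

definition P :: "'a \<Rightarrow> 'h \<Rightarrow> 'h" where "P l x = t l (ts l x)"

lemma t_bounded: "l \<in> mor G \<Longrightarrow> hbounded sm ip (t l)" using CK_conjuncts(1) by blast
lemma t_add: "l \<in> mor G \<Longrightarrow> t l (x + y) = t l x + t l y" using t_bounded by (simp add: hbounded_def)
lemma t_sm: "l \<in> mor G \<Longrightarrow> t l (sm a x) = sm a (t l x)" using t_bounded by (simp add: hbounded_def)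
lemma t_zero: "l \<in> mor G \<Longrightarrow> t l 0 = 0" using t_add[of l 0 0] by simp
lemma t_sum: "l \<in> mor G \<Longrightarrow> t l (\<Sum>i\<in>A. f i) = (\<Sum>i\<in>A. t l (f i))"
  by (induction A rule: infinite_finite_induct) (auto simp: t_add t_zero)

lemma ip_t: "l \<in> mor G \<Longrightarrow> ip (t l x) y = ip x (ts l y)" by (rule hadj[OF t_bounded])
lemma ip_ts: "l \<in> mor G \<Longrightarrow> ip (ts l x) y = ip x (t l y)" by (rule hadj_left[OF t_bounded])

lemma ts_add: "l \<in> mor G \<Longrightarrow> ts l (x + y) = ts l x + ts l y"
  by (rule ip_ext_left) (simp add: ip_ts ip_add_left)
lemma ts_sm: "l \<in> mor G \<Longrightarrow> ts l (sm a x) = sm a (ts l x)"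
  by (rule ip_ext_left) (simp add: ip_ts ip_sm_left)
lemma ts_zero: "l \<in> mor G \<Longrightarrow> ts l 0 = 0" using ts_add[of l 0 0] by simp

lemma ts_t: "l \<in> mor G \<Longrightarrow> ts l (t l x) = t (src G l) x"
  using CK_conjuncts(5) by (metis comp_apply)
lemma t_t: "l \<in> mor G \<Longrightarrow> m \<in> mor G \<Longrightarrow> src G l = rng G m \<Longrightarrow> t l (t m x) = t (cmp G l m) x"
  using CK_conjuncts(4) by (metis comp_apply)
lemma t_obj: "v \<in> obj G \<Longrightarrow> t v (t v x) = t v x" "v \<in> obj G \<Longrightarrow> ts v = t v"
  using CK_conjuncts(2) by (metis comp_apply, blast)
lemma t_obj_orth: "v \<in> obj G \<Longrightarrow> w \<in> obj G \<Longrightarrow> v \<noteq> w \<Longrightarrow> t v (t w x) = 0"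
  using CK_conjuncts(3) by (metis comp_apply)
lemma t_eq_sum: "v \<in> obj G \<Longrightarrow> n \<in> NK k \<Longrightarrow> t v x = (\<Sum>l\<in>vLn G v n. P l x)"
  using CK_conjuncts(6) unfolding P_def by metis

lemma t_src: "l \<in> mor G \<Longrightarrow> t l (t (src G l) x) = t l x" by (simp add: t_t obj_mor)
lemma t_rng: "l \<in> mor G \<Longrightarrow> t (rng G l) (t l x) = t l x" by (simp add: t_t obj_mor)

lemma ts_rng: "l \<in> mor G \<Longrightarrow> ts l (t (rng G l) x) = ts l x"
proof (rule ip_ext)
  fix y assume l: "l \<in> mor G"
  have "ip y (ts l (t (rng G l) x)) = ip (t l y) (ts (rng G l) x)"
    using l by (simp add: ip_t[symmetric] t_obj)
  also have "\<dots> = ip y (ts l x)" using l by (simp add: ip_t[symmetric] obj_mor t_rng)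
  finally show "ip y (ts l (t (rng G l) x)) = ip y (ts l x)" .
qed

lemma src_ts: "l \<in> mor G \<Longrightarrow> t (src G l) (ts l x) = ts l x"
proof (rule ip_ext)
  fix y assume l: "l \<in> mor G"
  have "ip y (t (src G l) (ts l x)) = ip y (ts (src G l) (ts l x))" using l by (simp add: t_obj)
  also have "\<dots> = ip y (ts l x)" using l by (simp add: ip_t[symmetric] obj_mor t_src)
  finally show "ip y (t (src G l) (ts l x)) = ip y (ts l x)" .
qed

lemma ts_cmp:
  assumes "l \<in> mor G" "m \<in> mor G" "src G l = rng G m" shows "ts (cmp G l m) x = ts m (ts l x)"
  by (rule ip_ext) (use assms in \<open>simp add: ip_t[symmetric] t_t\<close>)

lemma P_add: "l \<in> mor G \<Longrightarrow> P l (x + y) = P l x + P l y" by (simp add: P_def ts_add t_add)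
lemma P_sm: "l \<in> mor G \<Longrightarrow> P l (sm a x) = sm a (P l x)" by (simp add: P_def ts_sm t_sm)
lemma P_zero: "l \<in> mor G \<Longrightarrow> P l 0 = 0" by (simp add: P_def ts_zero t_zero)
lemma P_sum: "l \<in> mor G \<Longrightarrow> P l (\<Sum>i\<in>A. f i) = (\<Sum>i\<in>A. P l (f i))"
  by (induction A rule: infinite_finite_induct) (auto simp: P_add P_zero)

lemma P_selfadj: "l \<in> mor G \<Longrightarrow> ip (P l x) y = ip x (P l y)"
  by (simp add: P_def ip_t ip_ts)

lemma P_idem: "l \<in> mor G \<Longrightarrow> P l (P l x) = P l x"
  by (simp add: P_def ts_t src_ts)

lemma P_t: "l \<in> mor G \<Longrightarrow> P l (t l x) = t l x"
  by (simp add: P_def ts_t t_src)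

lemma P_obj: "v \<in> obj G \<Longrightarrow> P v x = t v x"
  by (simp add: P_def t_obj)

lemma P_cmp_t:
  assumes "l \<in> mor G" "m \<in> mor G" "src G l = rng G m" shows "P (cmp G l m) (t l x) = t l (P m x)"
  using assms by (simp add: P_def ts_cmp ts_t t_t[symmetric] ts_rng)

lemma rng_P: "l \<in> mor G \<Longrightarrow> t (rng G l) (P l x) = P l x"
  by (simp add: P_def t_rng)

lemma nsq_P: "l \<in> mor G \<Longrightarrow> nsq (P l x) = Re (ip x (P l x))"
  by (simp add: nsq_def P_selfadj P_idem)

lemma ip_P: "l \<in> mor G \<Longrightarrow> ip x (P l x) = of_real (nsq (P l x))"
  by (simp add: ip_self[symmetric] P_selfadj P_idem)

lemma nsq_P_le: "l \<in> mor G \<Longrightarrow> nsq (P l x) \<le> nsq x"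
  using nsq_nonneg[of "x - P l x"] by (simp add: nsq_diff nsq_P del: nsq_nonneg)

lemma nsq_t: "l \<in> mor G \<Longrightarrow> nsq (t l x) = nsq (t (src G l) x)"
  using nsq_P[of "src G l" x] by (simp add: nsq_def ip_t ts_t P_obj obj_mor)

lemma nsq_t_le: "l \<in> mor G \<Longrightarrow> nsq (t l x) \<le> nsq x"
  using nsq_P_le[OF obj_mor[OF src_obj], of l x] by (simp add: nsq_t[of l] P_obj)

text \<open>Projections that sum to a projection are mutually orthogonal.\<close>

lemma P_orth:
  assumes a: "a \<in> mor G" and b: "b \<in> mor G" and d: "deg G a = deg G b" and ne: "a \<noteq> b"
  shows "P a (P b x) = 0"
proof (cases "rng G a = rng G b")
  case True
  define y where "y = P b x"
  let ?L = "vLn G (rng G b) (deg G b)"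
  have fin: "finite ?L" using row_finite b by (simp add: row_finite_def)
  have ab: "a \<in> ?L" "b \<in> ?L" using a b d True by (auto simp: vLn_def)
  have "nsq y = Re (ip y (t (rng G b) y))" by (simp add: nsq_def y_def rng_P b)
  also have "\<dots> = (\<Sum>l\<in>?L. Re (ip y (P l y)))"
    using b by (simp add: t_eq_sum[of _ "deg G b"] ip_sum_right)
  also have "\<dots> = (\<Sum>l\<in>?L. nsq (P l y))" by (intro sum.cong) (auto simp: nsq_P vLn_def)
  also have "\<dots> \<ge> (\<Sum>l\<in>{a, b}. nsq (P l y))" using fin ab by (intro sum_mono2) auto
  finally have "nsq (P a y) + nsq (P b y) \<le> nsq y" using ne by simp
  moreover have "P b y = y" by (simp add: y_def P_idem b)
  ultimately have "nsq (P a y) = 0" using nsq_nonneg[of "P a y"] by simp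
  then show ?thesis unfolding y_def by (rule nsq_eq_0)
next
  case False
  have "P a (P b x) = t a (ts a (t (rng G a) (t (rng G b) (P b x))))"
    using a b by (simp add: P_def ts_rng t_rng)
  then show ?thesis using a b False by (simp add: t_obj_orth ts_zero t_zero)
qed

text \<open>The Cuntz-Krieger relation at the source of \<open>l\<close>, conjugated by
  \<open>t l\<close>.\<close>

lemma P_exts:
  assumes "l \<in> mor G" "p \<in> NK k" "deg G l \<le> p" shows "P l x = (\<Sum>a\<in>exts G l p. P a x)"
proof -
  let ?L = "vLn G (src G l) (vsub p (deg G l))"
  have "P l x = t l (t (src G l) (ts l x))" using assms by (simp add: P_def t_src)
  also have "\<dots> = (\<Sum>m\<in>?L. t l (P m (ts l x)))"
    using assms by (simp add: t_eq_sum[of _ "vsub p (deg G l)"] t_sum)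
  also have "\<dots> = (\<Sum>m\<in>?L. P (cmp G l m) x)"
    using assms by (intro sum.cong) (auto simp: vLn_def P_def ts_cmp t_t)
  also have "\<dots> = (\<Sum>a\<in>exts G l p. P a x)"
    unfolding exts_eq_cmp[OF assms] using inj_on_cmp[OF assms(1)] by (simp add: sum.reindex)
  finally show ?thesis .
qed

text \<open>Refine both projections to the common degree \<open>p\<close>. There distinct
  projections are orthogonal, so exactly the common extensions survive; \<open>cyl_Int_exts\<close>
  is the same computation for sets.\<close>

lemma P_P:
  assumes a: "a \<in> mor G" "deg G a \<le> p" and b: "b \<in> mor G" "deg G b \<le> p" and p: "p \<in> NK k"
  shows "P a (P b x) = (\<Sum>c\<in>exts G a p \<inter> exts G b p. P c x)"
proof -
  have fin: "finite (exts G a p)" "finite (exts G b p)" using finite_exts a b p by auto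
  have "P a (P b x) = (\<Sum>c\<in>exts G a p. \<Sum>d\<in>exts G b p. P c (P d x))"
  proof -
    have "P a (P b x) = (\<Sum>c\<in>exts G a p. P c (P b x))" using P_exts a p by blast
    also have "\<dots> = (\<Sum>c\<in>exts G a p. \<Sum>d\<in>exts G b p. P c (P d x))"
      by (intro sum.cong refl) (use P_exts[OF b(1) p b(2), of x] in \<open>simp add: exts_def P_sum\<close>)
    finally show ?thesis .
  qed
  also have "\<dots> = (\<Sum>c\<in>exts G a p. \<Sum>d\<in>exts G b p. if d = c then P c x else 0)"
    by (intro sum.cong refl) (auto simp: exts_def P_idem P_orth)
  also have "\<dots> = (\<Sum>c\<in>exts G a p. if c \<in> exts G b p then P c x else 0)"
    using fin by (intro sum.cong refl) (simp add: sum.delta')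
  also have "\<dots> = (\<Sum>c\<in>exts G a p \<inter> exts G b p. P c x)"
    using fin by (simp add: sum.inter_restrict)
  finally show ?thesis .
qed

lemma cyl_Int_exts:
  assumes a: "a \<in> mor G" "deg G a \<le> p" and b: "b \<in> mor G" "deg G b \<le> p" and p: "p \<in> NK k"
  shows "cyl k G a \<inter> cyl k G b = (\<Union>c\<in>exts G a p \<inter> exts G b p. cyl k G c)"
proof
  show "cyl k G a \<inter> cyl k G b \<subseteq> (\<Union>c\<in>exts G a p \<inter> exts G b p. cyl k G c)"
  proof
    fix x assume x: "x \<in> cyl k G a \<inter> cyl k G b"
    obtain c where c: "c \<in> exts G a p" "x \<in> cyl k G c" using x cyl_eq_Union_exts[OF a(1) p a(2)] by auto
    obtain d where d: "d \<in> exts G b p" "x \<in> cyl k G d" using x cyl_eq_Union_exts[OF b(1) p b(2)] by auto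
    have "c = d" using c d cyl_disjoint[of c d] by (auto simp: exts_def)
    then show "x \<in> (\<Union>c\<in>exts G a p \<inter> exts G b p. cyl k G c)" using c d by auto
  qed
  show "(\<Union>c\<in>exts G a p \<inter> exts G b p. cyl k G c) \<subseteq> cyl k G a \<inter> cyl k G b"
    using cyl_eq_Union_exts[OF a(1) p a(2)] cyl_eq_Union_exts[OF b(1) p b(2)] by auto
qed

lemma common_bound:
  assumes "a \<in> mor G" "b \<in> mor G" obtains n where "deg G a \<le> diag k n" "deg G b \<le> diag k n"
proof -
  have "finite {deg G a, deg G b}" "{deg G a, deg G b} \<subseteq> NK k" using assms by auto
  from NK_upper_bound[OF this] obtain n where n: "\<And>p. p \<in> {deg G a, deg G b} \<Longrightarrow> p \<le> diag k n" by blast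
  show thesis by (rule that[of n]) (simp_all add: n)
qed

lemma disjoint_exts: "disjoint_family_on (cyl k G) (exts G a p)"
  unfolding disjoint_family_on_def
proof (intro ballI impI)
  fix c d assume "c \<in> exts G a p" "d \<in> exts G a p" "c \<noteq> d"
  then show "cyl k G c \<inter> cyl k G d = {}" using cyl_disjoint[of c d] by (simp add: exts_def)
qed

text \<open>\<open>P_exts\<close> is precisely the consistency required of a weight, and the weights
  are squared norms, hence nonnegative.\<close>

lemma mu_pi_exists: "\<exists>M. is_mu_pi k G ip t \<xi> M"
proof -
  have "\<exists>M. path_measure k G M \<and> (\<forall>l\<in>mor G. emeasure M (cyl k G l) = ennreal (Re (ip \<xi> (P l \<xi>))))"
  proof (rule path_measure_exists)
    show "Re (ip \<xi> (P l \<xi>)) = (\<Sum>a\<in>exts G l p. Re (ip \<xi> (P a \<xi>)))"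
      if "l \<in> mor G" "p \<in> NK k" "deg G l \<le> p" for l p
      using P_exts[OF that] by (simp add: ip_sum_right)
    show "0 \<le> Re (ip \<xi> (P l \<xi>))" if "l \<in> mor G" for l using nsq_P[OF that, of \<xi>] nsq_nonneg[of "P l \<xi>"] by simp
  qed
  then show ?thesis by (simp add: is_mu_pi_def P_def)
qed

text \<open>Vertex projections are mutually orthogonal. The bound is uniform in the finite set
  \<open>F\<close>, which is what bounds the total mass of the measure when there are infinitely
  many vertices.\<close>

lemma Bessel:
  assumes "finite F" "F \<subseteq> obj G" shows "(\<Sum>v\<in>F. nsq (P v \<xi>)) \<le> nsq \<xi>"
proof -
  define y where "y = (\<Sum>v\<in>F. P v \<xi>)"
  have "P v y = P v \<xi>" if v: "v \<in> F" for v
  proof -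
    have "P v y = (\<Sum>w\<in>F. P v (P w \<xi>))" using assms v by (simp add: y_def P_sum obj_mor subset_iff)
    also have "\<dots> = (\<Sum>w\<in>F. if w = v then P v \<xi> else 0)"
      using assms v by (intro sum.cong refl) (auto simp: P_idem obj_mor P_orth subset_iff)
    finally show ?thesis using assms v by simp
  qed
  then have "ip y y = (\<Sum>v\<in>F. ip \<xi> (P v \<xi>))"
    using assms unfolding y_def[symmetric] by (subst (1) y_def) (auto simp: ip_sum_left P_selfadj obj_mor subset_iff intro!: sum.cong)
  moreover have "ip \<xi> y = (\<Sum>v\<in>F. ip \<xi> (P v \<xi>))" by (simp add: y_def ip_sum_right)
  moreover have "(\<Sum>v\<in>F. nsq (P v \<xi>)) = Re (\<Sum>v\<in>F. ip \<xi> (P v \<xi>))"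
    using assms by (auto simp: nsq_P obj_mor subset_iff intro!: sum.cong)
  ultimately have "nsq y = (\<Sum>v\<in>F. nsq (P v \<xi>))" "Re (ip \<xi> y) = (\<Sum>v\<in>F. nsq (P v \<xi>))" by (simp_all add: nsq_def)
  then show ?thesis using nsq_nonneg[of "\<xi> - y"] by (simp add: nsq_diff del: nsq_nonneg)
qed

end

section \<open>The unitary attached to a monic vector\<close>

locale monic_representation = ck_representation k G sm ip t
  for k and G :: "'a kgraph" and sm :: "complex \<Rightarrow> 'h::ab_group_add \<Rightarrow> 'h" and ip and t +
  fixes \<xi> :: 'h and M :: "'a ipath measure"
  assumes monic_rep: "monic_rep G sm ip t" and monic: "monic_vector G sm ip t \<xi>" and mu_pi: "is_mu_pi k G ip t \<xi> M"
begin

lemma M: "path_measure k G M" using mu_pi by (simp add: is_mu_pi_def)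

lemma emeasure_cyl: "l \<in> mor G \<Longrightarrow> emeasure M (cyl k G l) = ennreal (nsq (P l \<xi>))"
  using mu_pi by (simp add: is_mu_pi_def P_def[symmetric] nsq_P)

text \<open>The space is exhausted by the cylinders of finitely many vertices at a time, and
  Bessel's inequality bounds all of these by the squared norm of the vector.\<close>

lemma finite_M: "finite_measure M"
proof
  define F where "F n = {v \<in> obj G. to_nat_on (obj G) v < n}" for n
  have F: "finite (F n)" "F n \<subseteq> obj G" for n
  proof -
    have "inj_on (to_nat_on (obj G)) (F n)"
      using inj_on_to_nat_on[OF countable_obj] by (rule inj_on_subset) (auto simp: F_def)
    moreover have "to_nat_on (obj G) ` F n \<subseteq> {..<n}" by (auto simp: F_def)
    ultimately show "finite (F n)" by (meson finite_imageD finite_lessThan finite_subset)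
  qed (auto simp: F_def)
  define B where "B n = (\<Union>v\<in>F n. cyl k G v)" for n
  have Bs: "B n \<in> sets M" for n
    unfolding B_def by (intro sets.finite_UN F) (use F(2) cyl_sets[OF M] obj_mor in blast)
  have B: "emeasure M (B n) \<le> ennreal (nsq \<xi>)" for n
  proof -
    have "emeasure M (B n) = (\<Sum>v\<in>F n. emeasure M (cyl k G v))"
      unfolding B_def
    proof (rule sum_emeasure[symmetric])
      show "cyl k G ` F n \<subseteq> sets M" using F(2) cyl_sets[OF M] obj_mor by blast
      show "disjoint_family_on (cyl k G) (F n)"
        unfolding disjoint_family_on_def
      proof (intro ballI impI)
        fix v w assume "v \<in> F n" "w \<in> F n" "v \<noteq> w"
        then show "cyl k G v \<inter> cyl k G w = {}" using cyl_disjoint[of v w] by (simp add: F_def)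
      qed
    qed (rule F)
    also have "\<dots> = (\<Sum>v\<in>F n. ennreal (nsq (P v \<xi>)))"
      by (intro sum.cong refl emeasure_cyl) (auto simp: F_def obj_mor)
    also have "\<dots> = ennreal (\<Sum>v\<in>F n. nsq (P v \<xi>))" by (intro sum_ennreal) auto
    also have "\<dots> \<le> ennreal (nsq \<xi>)" by (intro ennreal_leI Bessel F)
    finally show ?thesis .
  qed
  have inc: "incseq B" by (auto simp: incseq_def B_def F_def)
  have "(\<Union>n. B n) = space M"
  proof
    show "space M \<subseteq> (\<Union>n. B n)"
    proof
      fix x assume "x \<in> space M"
      then have x: "x \<in> infpaths k G" using M by (simp add: path_measure_space)
      then have "x \<in> B (Suc (to_nat_on (obj G) (x vzero vzero)))"
        using path_obj[OF x vzero_NK] path_in_cyl[OF x vzero_NK] by (auto simp: B_def F_def)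
      then show "x \<in> (\<Union>n. B n)" by blast
    qed
  qed (use Bs sets.sets_into_space in blast)
  then have "emeasure M (space M) = (SUP n. emeasure M (B n))"
    using SUP_emeasure_incseq[OF _ inc] Bs by (metis image_subset_iff)
  also have "\<dots> \<le> ennreal (nsq \<xi>)" by (rule SUP_least) (rule B)
  finally show "emeasure M (space M) \<noteq> \<infinity>" by (auto simp: top_unique)
qed

text \<open>Both sides are sums over the common extensions of \<open>a\<close> and \<open>b\<close>,
  by \<open>P_P\<close> on the left and by \<open>cyl_Int_exts\<close> on the right.\<close>

lemma gram_cyl:
  assumes a: "a \<in> mor G" and b: "b \<in> mor G"
  shows "ip (P a \<xi>) (P b \<xi>) = l2ip M (indicator (cyl k G a)) (indicator (cyl k G b))"
proof -
  interpret finite_measure M by (rule finite_M)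
  obtain n where n: "deg G a \<le> diag k n" "deg G b \<le> diag k n" using common_bound[OF a b] .
  let ?E = "exts G a (diag k n) \<inter> exts G b (diag k n)"
  have fin: "finite ?E" using finite_exts a n by auto
  have "ip (P a \<xi>) (P b \<xi>) = (\<Sum>c\<in>?E. ip \<xi> (P c \<xi>))"
    using a b n by (simp add: P_selfadj P_P[OF a n(1) b n(2)] ip_sum_right)
  also have "\<dots> = (\<Sum>c\<in>?E. of_real (measure M (cyl k G c)))"
    by (intro sum.cong refl) (auto simp: exts_def ip_P measure_def emeasure_cyl)
  also have "\<dots> = of_real (\<Sum>c\<in>?E. measure M (cyl k G c))" by simp
  also have "(\<Sum>c\<in>?E. measure M (cyl k G c)) = measure M (cyl k G a \<inter> cyl k G b)"
    unfolding cyl_Int_exts[OF a n(1) b n(2) diag_NK]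
  proof (rule finite_measure_finite_Union[symmetric, OF fin])
    show "cyl k G ` ?E \<subseteq> sets M" using cyl_sets[OF M] by (auto simp: exts_def)
    show "disjoint_family_on (cyl k G) ?E"
      using disjoint_exts by (rule disjoint_family_on_mono[rotated]) auto
  qed
  also have "of_real (measure M (cyl k G a \<inter> cyl k G b)) = l2ip M (indicator (cyl k G a)) (indicator (cyl k G b))"
  proof -
    have "(\<lambda>x. indicator (cyl k G a) x * cnj (indicator (cyl k G b) x)) = (\<lambda>x. complex_of_real (indicator (cyl k G a \<inter> cyl k G b) x))"
      by (auto simp: indicator_def fun_eq_iff)
    then have "l2ip M (indicator (cyl k G a)) (indicator (cyl k G b)) = of_real (\<integral>x. indicator (cyl k G a \<inter> cyl k G b) x \<partial>M)"
      by (simp only: l2ip_def integral_complex_of_real)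
    also have "(\<integral>x. indicator (cyl k G a \<inter> cyl k G b) x \<partial>M) = measure M (cyl k G a \<inter> cyl k G b)"
      using sets.sets_into_space[OF cyl_sets[OF M a]] by (simp add: Int_absorb2 inf.absorb1 le_infI1)
    finally show ?thesis by simp
  qed
  finally show ?thesis .
qed

sublocale isometry_extension sm ip M "mor G" "\<lambda>l. P l \<xi>" "\<lambda>l. indicator (cyl k G l)"
proof (intro isometry_extension.intro isometry_extension_axioms.intro)
  show "hilbert sm ip" by (rule hilbert_axioms)
  interpret finite_measure M by (rule finite_M)
  show "finite_measure M" by (rule finite_M)
  show u: "indicator (cyl k G i) \<in> L2 M" if "i \<in> mor G" for i
    using L2_indicator[OF cyl_sets[OF M that]] .
  show "ip (P i \<xi>) (P j \<xi>) = l2ip M (indicator (cyl k G i)) (indicator (cyl k G j))"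
    if "i \<in> mor G" "j \<in> mor G" for i j using that by (rule gram_cyl)
  show "f \<in> l2_closure M (lspan (mor G) (\<lambda>l. indicator (cyl k G l)))" if "f \<in> L2 M" for f
    using L2_dense_cyl[OF M finite_M that] .
  fix x and e :: real assume e: "e > 0"
  then have "sqrt e > 0" by simp
  from monic[unfolded monic_vector_def, folded P_def, rule_format, OF this, of x]
  show "\<exists>F c. finite F \<and> F \<subseteq> mor G \<and> nsq (x - (\<Sum>i\<in>F. sm (c i) (P i \<xi>))) < e"
    by (auto simp: hnorm_eq)
qed

text \<open>By \<open>rel_intertwine\<close> it is enough to look at the generators, where both the
  product of the projections and the product of the indicators expand over the common
  extensions.\<close>

lemma rel_P:
  assumes a: "a \<in> mor G" and x: "rel x g"
  shows "rel (P a x) (\<lambda>p. indicator (cyl k G a) p * g p)"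
proof (rule rel_intertwine[where C = 1, OF _ _ _ _ _ _ _ _ x])
  fix b assume b: "b \<in> mor G"
  obtain n where n: "deg G a \<le> diag k n" "deg G b \<le> diag k n" using common_bound[OF a b] .
  let ?E = "exts G a (diag k n) \<inter> exts G b (diag k n)"
  have fin: "finite ?E" using finite_exts a n by auto
  have "gspan (\<Sum>c\<in>?E. sm 1 (P c \<xi>)) (\<lambda>p. \<Sum>c\<in>?E. 1 * indicator (cyl k G c) p)"
    by (rule gspan_sum[OF fin]) (auto simp: exts_def)
  moreover have "(\<Sum>c\<in>?E. 1 * indicator (cyl k G c) p) = (indicator (cyl k G a) p * indicator (cyl k G b) p :: complex)" for p
  proof -
    have "indicator (\<Union>c\<in>?E. cyl k G c) p = (\<Sum>c\<in>?E. indicator (cyl k G c) p :: complex)"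
      by (rule indicator_UN_disjoint[OF fin disjoint_family_on_mono[OF _ disjoint_exts]]) auto
    then show ?thesis by (simp add: cyl_Int_exts[OF a n(1) b n(2) diag_NK, symmetric] indicator_inter_arith)
  qed
  ultimately show "rel (P a (P b \<xi>)) (\<lambda>p. indicator (cyl k G a) p * indicator (cyl k G b) p)"
    by (simp add: rel_gspan P_P[OF a n(1) b n(2)])
qed (use a cyl_sets[OF M a] in \<open>auto simp: P_add P_sm nsq_P_le distrib_left L2_indicator_mult l2sq_indicator_mult_le\<close>)

section \<open>The weights of the projective system\<close>

definition F :: "'a \<Rightarrow> 'a ipath \<Rightarrow> complex" where "F l = U (t l \<xi>)"

lemma F_L2: "F l \<in> L2 M" by (simp add: F_def U_L2)

lemma rel_F: "rel (t l \<xi>) (F l)" by (simp add: F_def rel_U)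

text \<open>Tested on cylinders of paths \<open>a\<close> at least as long as \<open>l\<close>. The
  left measure gives the squared norm of \<open>P a (t l \<xi>)\<close>; the right one gives the
  measure of the cylinder of \<open>m\<close> if \<open>a\<close> is \<open>l\<close> followed by
  \<open>m\<close>, and 0 if \<open>a\<close> does not begin with \<open>l\<close>.\<close>

lemma F_weight:
  assumes l: "l \<in> mor G"
  shows "density M (\<lambda>x. ennreal ((cmod (F l x))\<^sup>2)) = distr (restrict_space M (cyl k G (src G l))) M (prefix k G l)"
proof (rule path_measure_eqI[OF _ _ deg_NK[OF l]])
  note [measurable] = L2D(1)[OF F_L2[of l]] prefix_measurable[OF M l]
  show "path_measure k G (density M (\<lambda>x. ennreal ((cmod (F l x))\<^sup>2)))"
    "path_measure k G (distr (restrict_space M (cyl k G (src G l))) M (prefix k G l))"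
    using M by (simp_all add: path_measure_def)
  have em: "emeasure (density M (\<lambda>x. ennreal ((cmod (F l x))\<^sup>2))) (cyl k G a) = ennreal (nsq (P a (t l \<xi>)))"
    if a: "a \<in> mor G" for a
  proof -
    note r = rel_P[OF a rel_F]
    have "emeasure (density M (\<lambda>x. ennreal ((cmod (F l x))\<^sup>2))) (cyl k G a) = (\<integral>\<^sup>+x. ennreal ((cmod (F l x))\<^sup>2) * indicator (cyl k G a) x \<partial>M)"
      using cyl_sets[OF M a] by (intro emeasure_density) auto
    also have "\<dots> = (\<integral>\<^sup>+x. ennreal ((cmod (indicator (cyl k G a) x * F l x))\<^sup>2) \<partial>M)"
      by (intro nn_integral_cong) (auto simp: indicator_def)
    also have "\<dots> = ennreal (nsq (P a (t l \<xi>)))"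
      using nn_integral_l2sq[OF rel_L2[OF r]] rel_nsq[OF r] by simp
    finally show ?thesis .
  qed
  then show "emeasure (density M (\<lambda>x. ennreal ((cmod (F l x))\<^sup>2))) (cyl k G a) \<noteq> \<infinity>" if "a \<in> mor G" for a
    using that by simp
  fix a n assume a: "a \<in> mor G" "deg G a = vadd (deg G l) (diag k n)"
  then have le: "deg G l \<le> deg G a" by simp
  note f = initial_final[OF a(1) le]
  have "emeasure (distr (restrict_space M (cyl k G (src G l))) M (prefix k G l)) (cyl k G a)
      = emeasure (restrict_space M (cyl k G (src G l))) (prefix k G l -` cyl k G a \<inter> cyl k G (src G l))"
    using cyl_sets[OF M a(1)] by (subst emeasure_distr) (auto simp: space_restrict_cyl[OF M])
  also have "\<dots> = emeasure M (prefix k G l -` cyl k G a \<inter> cyl k G (src G l))"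
    using cyl_sets[OF M src_mor[OF l]] sets.sets_into_space[OF cyl_sets[OF M src_mor[OF l]]]
    by (intro emeasure_restrict_space) (auto simp: Int_absorb2)
  also have "\<dots> = ennreal (nsq (P a (t l \<xi>)))"
  proof (cases "initial G a (deg G l) = l")
    case True
    let ?m = "final G a (deg G l)"
    have m: "src G l = rng G ?m" "cmp G l ?m = a" using f True by auto
    have "P a (t l \<xi>) = t l (P ?m \<xi>)" using P_cmp_t[OF l f(3) m(1)] m(2) by simp
    \<comment> \<open>\<open>t l\<close> is isometric on the range of the projection at its source,
      and \<open>P ?m \<xi>\<close> lies there.\<close>
    then have "nsq (P a (t l \<xi>)) = nsq (P ?m \<xi>)"
      using l f(3) m(1) by (simp add: nsq_t rng_P)
    then show ?thesis using True by (simp add: prefix_vimage_cyl[OF l a(1) le] emeasure_cyl[OF f(3)])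
  next
    case False
    \<comment> \<open>Both paths are compared at the degree of \<open>a\<close>, where the only
      extension of \<open>a\<close> is \<open>a\<close> itself; it does not begin with
      \<open>l\<close>, so the projections are orthogonal.\<close>
    have "P a (t l \<xi>) = P a (P l (t l \<xi>))" using l by (simp add: P_t)
    also have "\<dots> = (\<Sum>c\<in>exts G a (deg G a) \<inter> exts G l (deg G a). P c (t l \<xi>))"
      using a l le by (intro P_P) auto
    also have "exts G a (deg G a) \<inter> exts G l (deg G a) = {}"
      using False initial_self by (auto simp: exts_def) (metis initial_self)
    finally show ?thesis using False by (simp add: prefix_vimage_cyl[OF l a(1) le])
  qed
  finally show "emeasure (density M (\<lambda>x. ennreal ((cmod (F l x))\<^sup>2))) (cyl k G a) =
      emeasure (distr (restrict_space M (cyl k G (src G l))) M (prefix k G l)) (cyl k G a)"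
    using em[OF a(1)] by simp
qed

lemma prefix_weight_F: "l \<in> mor G \<Longrightarrow> prefix_weight k G M l (F l)"
  using M F_L2 F_weight by unfold_locales auto

text \<open>On generators, \<open>t l (P m \<xi>)\<close> is \<open>P\<close> of the composite
  applied to \<open>t l \<xi>\<close>, or 0 if the paths do not compose. Correspondingly the
  indicator of Z(m) after the shift is that of Z(lm), or 0, on Z(l); outside Z(l) the factor
  \<open>F l\<close> vanishes almost everywhere.\<close>

lemma rel_t:
  assumes l: "l \<in> mor G" and x: "rel x g"
  shows "rel (t l x) (\<lambda>p. F l p * g (shift k (deg G l) p))"
proof -
  interpret w: prefix_weight k G M l "F l" by (rule prefix_weight_F[OF l])
  show ?thesis
  proof (rule rel_intertwine[where C = 1, OF _ _ _ _ _ _ _ _ x])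
    fix m assume m: "m \<in> mor G"
    have base: "rel (t l (P m \<xi>)) (\<lambda>p. (if src G l = rng G m then indicator (cyl k G (cmp G l m)) p else 0) * F l p)"
    proof (cases "src G l = rng G m")
      case True
      then show ?thesis using rel_P[OF cmp_mor[OF l m True] rel_F, of l] P_cmp_t[OF l m True] by simp
    next
      case False
      have "t l (P m \<xi>) = t l (t (src G l) (t (rng G m) (P m \<xi>)))" using l m by (simp add: t_src rng_P)
      also have "\<dots> = 0" using l m False by (simp add: t_obj_orth t_zero)
      finally show ?thesis using False rel_gspan[OF gspan.zero] by simp
    qed
    show "rel (t l (P m \<xi>)) (\<lambda>p. F l p * indicator (cyl k G m) (shift k (deg G l) p))"
    proof (rule rel_AE_cong[OF base])
      note [measurable] = cyl_sets[OF M m]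
      show "(\<lambda>p. F l p * indicator (cyl k G m) (shift k (deg G l) p)) \<in> borel_measurable M" by measurable
      show "AE p in M. (if src G l = rng G m then indicator (cyl k G (cmp G l m)) p else 0) * F l p =
          F l p * indicator (cyl k G m) (shift k (deg G l) p)"
        using w.support
      proof (rule eventually_mono)
        fix p assume p: "p \<notin> cyl k G l \<longrightarrow> F l p = 0"
        show "(if src G l = rng G m then indicator (cyl k G (cmp G l m)) p else 0) * F l p =
          F l p * indicator (cyl k G m) (shift k (deg G l) p)"
        proof (cases "p \<in> cyl k G l")
          case pl: True
          show ?thesis
          proof (cases "src G l = rng G m")
            case True
            then show ?thesis using shift_mem_cyl_iff[OF pl l m True] by (simp add: indicator_def)
          next
            case False
            have "shift k (deg G l) p \<in> cyl k G (src G l)" using shift_cyl_src[OF pl l] .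
            moreover have "cyl k G (src G l) \<inter> cyl k G (rng G m) = {}" using l m False by (intro cyl_disjoint) auto
            ultimately have "shift k (deg G l) p \<notin> cyl k G m" using cyl_subset_rng[OF m] by blast
            then show ?thesis using False by simp
          qed
        qed (use p in simp)
      qed
    qed
  qed (use l w.S_L2 in \<open>auto simp: t_add t_sm nsq_t_le distrib_left ac_simps\<close>)
qed

text \<open>The indicator of Z(l) represents \<open>P l \<xi> = t l (ts l \<xi>)\<close>, which by
  \<open>rel_t\<close> is also represented by \<open>F l\<close> times a function, so
  \<open>F l\<close> has no zeros there up to a null set.\<close>

lemma F_nonzero:
  assumes l: "l \<in> mor G" shows "AE x in M. x \<in> cyl k G l \<longrightarrow> F l x \<noteq> 0"
proof -
  have "rel (P l \<xi>) (\<lambda>p. F l p * U (ts l \<xi>) (shift k (deg G l) p))"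
    using rel_t[OF l rel_U[of "ts l \<xi>"]] by (simp add: P_def)
  from rel_unique[OF rel_gspan[OF gspan_base[OF l]] this] show ?thesis
    by (rule eventually_mono) auto
qed

text \<open>If the cylinder were null, every vector \<open>P l x\<close> would correspond to the
  zero function, so \<open>t l\<close> would be 0, contrary to monicity.\<close>

lemma cyl_pos:
  assumes l: "l \<in> obj G" shows "0 < emeasure M (cyl k G l)"
proof (rule ccontr)
  assume "\<not> ?thesis"
  then have 0: "emeasure M (cyl k G l) = 0" by simp
  have "t l x = 0" for x
  proof -
    have r: "rel (P l x) (\<lambda>p. indicator (cyl k G l) p * U x p)" using rel_P[OF obj_mor[OF l] rel_U] .
    have "AE p in M. p \<notin> cyl k G l" using 0 cyl_sets[OF M obj_mor[OF l]] by (intro AE_not_in) auto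
    then have "AE p in M. indicator (cyl k G l) p * U x p = 0" by (rule eventually_mono) auto
    then have "l2sq M (\<lambda>p. indicator (cyl k G l) p * U x p) = l2sq M (\<lambda>_. 0)"
      using L2D(1)[OF rel_L2[OF r]] by (intro l2sq_cong_AE) auto
    then have "nsq (P l x) = 0" using rel_nsq[OF r] by (simp add: l2sq_def)
    then show ?thesis using nsq_eq_0 l by (simp add: P_obj)
  qed
  then show False using monic_rep obj_mor[OF l] by (auto simp: monic_rep_def)
qed

text \<open>The density is \<open>1 / |F l|^2\<close> evaluated after prefixing: the change of
  variables brings in the factor \<open>|F l|^2\<close>, which cancels on Z(l) by
  \<open>F_nonzero\<close>.\<close>

lemma radon_nikodym:
  assumes l: "l \<in> mor G"
  defines "R \<equiv> restrict_space M (cyl k G (src G l))"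
  shows "\<exists>g. g \<in> borel_measurable R \<and> density R g = comp_meas M (cyl k G (src G l)) (prefix k G l) \<and> (AE x in R. g x > 0)"
proof -
  interpret w: prefix_weight k G M l "F l" by (rule prefix_weight_F[OF l])
  note [measurable] = w.prefix_meas[folded R_def]
  define h where "h x = ennreal (1 / (cmod (F l x))\<^sup>2)" for x
  have [measurable]: "h \<in> borel_measurable M" unfolding h_def[abs_def] by measurable
  have sp: "space R = cyl k G (src G l)" by (simp add: R_def space_restrict_cyl[OF M])
  show ?thesis
  proof (intro exI[of _ "\<lambda>x. h (prefix k G l x)"] conjI)
    show "(\<lambda>x. h (prefix k G l x)) \<in> borel_measurable R" by measurable
    \<comment> \<open>As \<open>1 / 0 = 0\<close>, the function \<open>h\<close> vanishes where
      \<open>F l\<close> does, but that set is null for the density, which is the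
      pushforward.\<close>
    have "AE x in density M (\<lambda>x. ennreal ((cmod (F l x))\<^sup>2)). h x > 0"
      by (subst AE_density) (auto intro!: AE_I2 simp: h_def)
    then show "AE x in R. h (prefix k G l x) > 0"
      unfolding w.weight R_def[symmetric] by (subst (asm) AE_distr_iff) auto
    show "density R (\<lambda>x. h (prefix k G l x)) = comp_meas M (cyl k G (src G l)) (prefix k G l)"
    proof (rule measure_eqI)
      show "sets (density R (\<lambda>x. h (prefix k G l x))) = sets (comp_meas M (cyl k G (src G l)) (prefix k G l))"
        by (simp add: comp_meas_prefix(1)[OF M l] R_def)
      fix A assume "A \<in> sets (density R (\<lambda>x. h (prefix k G l x)))"
      then have AR: "A \<in> sets R" and A: "A \<in> sets M" "A \<subseteq> cyl k G (src G l)"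
        using sets_restrict_cyl[OF M src_mor[OF l]] by (auto simp: R_def)
      have im [measurable]: "prefix k G l ` A \<in> sets M" by (rule comp_meas_prefix(3)[OF M l A])
      have mem: "prefix k G l x \<in> prefix k G l ` A \<longleftrightarrow> x \<in> A" if "x \<in> cyl k G (src G l)" for x
      proof
        assume "prefix k G l x \<in> prefix k G l ` A"
        then obtain y where y: "y \<in> A" "prefix k G l x = prefix k G l y" by blast
        then show "x \<in> A" using prefix_cyl(2)[OF l that] prefix_cyl(2)[OF l, of y] A(2) by auto
      qed auto
      have "emeasure (density R (\<lambda>x. h (prefix k G l x))) A = (\<integral>\<^sup>+x. h (prefix k G l x) * indicator A x \<partial>R)"
        using AR by (intro emeasure_density) measurable
      also have "\<dots> = (\<integral>\<^sup>+x. h (prefix k G l x) * indicator (prefix k G l ` A) (prefix k G l x) \<partial>R)"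
        by (intro nn_integral_cong) (use mem in \<open>auto simp: sp indicator_def\<close>)
      also have "\<dots> = (\<integral>\<^sup>+x. ennreal ((cmod (F l x))\<^sup>2) * (h x * indicator (prefix k G l ` A) x) \<partial>M)"
        unfolding R_def by (rule w.nn_change[symmetric]) measurable
      also have "\<dots> = (\<integral>\<^sup>+x. indicator (prefix k G l ` A) x \<partial>M)"
      proof (rule nn_integral_cong_AE)
        have sub: "prefix k G l ` A \<subseteq> cyl k G l" using prefix_cyl(1)[OF l] A by auto
        show "AE x in M. ennreal ((cmod (F l x))\<^sup>2) * (h x * indicator (prefix k G l ` A) x) = indicator (prefix k G l ` A) x"
          using F_nonzero[OF l]
        proof (rule eventually_mono)
          fix x assume x: "x \<in> cyl k G l \<longrightarrow> F l x \<noteq> 0"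
          show "ennreal ((cmod (F l x))\<^sup>2) * (h x * indicator (prefix k G l ` A) x) = indicator (prefix k G l ` A) x"
          proof (cases "x \<in> prefix k G l ` A")
            case True
            then have "F l x \<noteq> 0" using x sub by auto
            then have "ennreal ((cmod (F l x))\<^sup>2) * h x = 1"
              unfolding h_def by (subst ennreal_mult[symmetric]) auto
            then show ?thesis using True by simp
          qed simp
        qed
      qed
      also have "\<dots> = emeasure M (prefix k G l ` A)" using im by simp
      finally show "emeasure (density R (\<lambda>x. h (prefix k G l x))) A = emeasure (comp_meas M (cyl k G (src G l)) (prefix k G l)) A"
        using comp_meas_prefix(2)[OF M l A] by simp
    qed
  qed
qed

section \<open>The standard semibranching function system\<close>

lemma std_sbfs: "std_lambda_sbfs k G M"
proof -
  interpret finite_measure M by (rule finite_M)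
  have "sbfs M {l \<in> mor G. deg G l = n} (\<lambda>l. cyl k G (src G l)) (prefix k G) (shift k n)" if n: "n \<in> NK k" for n
  proof -
    have U: "(\<Union>i\<in>{l \<in> mor G. deg G l = n}. prefix k G i ` cyl k G (src G i)) = space M"
      using infpaths_eq_Union[OF n] M by (simp add: prefix_image_cyl path_measure_space)
    show ?thesis
      unfolding sbfs_def U
    proof (intro conjI ballI impI)
      show "countable {l \<in> mor G. deg G l = n}" by (rule countable_subset[OF _ countable_mor]) auto
      fix i assume "i \<in> {l \<in> mor G. deg G l = n}"
      then have i: "i \<in> mor G" "deg G i = n" by auto
      show "cyl k G (src G i) \<in> sets M" using i M by (simp add: cyl_sets src_mor)
      show "0 < emeasure M (cyl k G (src G i))" using i cyl_pos by simp
      show "emeasure M (cyl k G (src G i)) < \<infinity>" by (simp add: less_top[symmetric])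
      show "prefix k G i \<in> measurable (restrict_space M (cyl k G (src G i))) M" using prefix_measurable[OF M i(1)] .
      show "prefix k G i ` cyl k G (src G i) \<in> sets M" using i M by (simp add: prefix_image_cyl cyl_sets)
      show "emeasure M (prefix k G i ` cyl k G (src G i)) < \<infinity>" by (simp add: less_top[symmetric])
      show "\<exists>g. g \<in> borel_measurable (restrict_space M (cyl k G (src G i))) \<and>
           density (restrict_space M (cyl k G (src G i))) g = comp_meas M (cyl k G (src G i)) (prefix k G i) \<and>
           (AE x in restrict_space M (cyl k G (src G i)). 0 < g x)"
        by (rule radon_nikodym[OF i(1)])
      show "shift k n (prefix k G i x) = x" if "x \<in> cyl k G (src G i)" for x
        using prefix_cyl(2)[OF i(1) that] i by simp
      fix j assume "j \<in> {l \<in> mor G. deg G l = n}" "i \<noteq> j"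
      then have "cyl k G i \<inter> cyl k G j = {}" using cyl_disjoint[of i j] i by simp
      then show "emeasure M (prefix k G i ` cyl k G (src G i) \<inter> prefix k G j ` cyl k G (src G j)) = 0"
        using i \<open>j \<in> _\<close> by (simp add: prefix_image_cyl)
    next
      show "shift k n \<in> measurable M M" by (rule shift_measurable[OF M n])
    qed simp
  qed
  moreover have "emeasure M (prefix k G m ` cyl k G (src G m) - cyl k G (src G l)) = 0"
    if "l \<in> mor G" "m \<in> mor G" "src G l = rng G m" for l m
  proof -
    have "prefix k G m ` cyl k G (src G m) - cyl k G (src G l) = {}"
      using cyl_subset_rng[of m] that by (auto simp: prefix_image_cyl)
    then show ?thesis by (simp only: emeasure_empty)
  qed
  ultimately show ?thesis
    unfolding std_lambda_sbfs_def using prefix_obj prefix_prefix shift_shift by (auto intro!: AE_I2)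
qed

lemma proj_system: "std_proj_system k G M F"
  unfolding std_proj_system_def
proof (intro conjI ballI impI)
  show "std_lambda_sbfs k G M" by (rule std_sbfs)
  fix l assume l: "l \<in> mor G"
  show "F l \<in> L2 M" by (rule F_L2)
  show "density M (\<lambda>x. ennreal ((cmod (F l x))\<^sup>2)) = distr (restrict_space M (cyl k G (src G l))) M (prefix k G l)"
    by (rule F_weight[OF l])
  show "\<not> (AE x in M. F l x = 0)"
  proof
    assume AE: "AE x in M. F l x = 0"
    have "l2sq M (F l) = l2sq M (\<lambda>_. 0)" using AE L2D(1)[OF F_L2] by (intro l2sq_cong_AE) auto
    then have "nsq (P (src G l) \<xi>) = 0"
      using rel_nsq[OF rel_F[of l]] l by (simp add: l2sq_def nsq_t P_obj)
    then show False using cyl_pos[of "src G l"] emeasure_cyl[of "src G l"] l by (simp add: obj_mor)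
  qed
  fix m assume m: "m \<in> mor G" "src G l = rng G m"
  \<comment> \<open>Both sides represent the vector
    \<open>t (cmp G l m) \<xi> = t l (t m \<xi>)\<close>.\<close>
  show "AE x in M. F l x * F m (shift k (deg G l) x) = F (cmp G l m) x"
    using rel_unique[OF rel_t[OF l rel_F[of m]]] rel_F[of "cmp G l m"] by (simp add: t_t[OF l m])
qed

lemma unitary: "unitarily_equiv G sm ip t M (proj_rep k G F)"
  unfolding unitarily_equiv_def
proof (intro exI[of _ U] conjI allI ballI)
  show "U x \<in> L2 M" for x by (rule U_L2)
  show "AE p in M. U (x + y) p = U x p + U y p" for x y by (rule U_AE_eq[OF rel_add[OF rel_U rel_U]])
  show "AE p in M. U (sm a x) p = a * U x p" for a x by (rule U_AE_eq[OF rel_scale[OF rel_U]])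
  show "l2ip M (U x) (U y) = ip x y" for x y by (rule rel_ip[OF rel_U rel_U])
  show "\<exists>x. AE p in M. U x p = f p" if "f \<in> L2 M" for f using rel_exists_left[OF that] U_AE_eq by blast
  show "AE p in M. U (t l x) p = proj_rep k G F l (U x) p" if "l \<in> mor G" for l x
    using U_AE_eq[OF rel_t[OF that rel_U]] by (simp add: proj_rep_def)
qed

end

section \<open>Projective systems\<close>

text \<open>Multiplication by \<open>g\<close> is isometric from L2 of the measure with density
  \<open>|g|^2\<close> into L2 of \<open>M\<close>; with the monic vector as \<open>g\<close> this
  is the inverse of the final isometry.\<close>

lemma l2sq_density:
  assumes "g \<in> borel_measurable M" "f \<in> borel_measurable M"
  shows "l2sq (density M (\<lambda>x. ennreal ((cmod (g x))\<^sup>2))) f = l2sq M (\<lambda>x. f x * g x)"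
    and "f \<in> L2 (density M (\<lambda>x. ennreal ((cmod (g x))\<^sup>2))) \<longleftrightarrow> (\<lambda>x. f x * g x) \<in> L2 M"
proof -
  note [measurable] = assms
  show "l2sq (density M (\<lambda>x. ennreal ((cmod (g x))\<^sup>2))) f = l2sq M (\<lambda>x. f x * g x)"
    unfolding l2sq_def by (subst integral_density) (auto simp: norm_mult power_mult_distrib mult.commute)
  have "integrable (density M (\<lambda>x. ennreal ((cmod (g x))\<^sup>2))) (\<lambda>x. (cmod (f x))\<^sup>2) \<longleftrightarrow> integrable M (\<lambda>x. (cmod (f x * g x))\<^sup>2)"
    by (subst integrable_density) (auto simp: norm_mult power_mult_distrib mult.commute)
  then show "f \<in> L2 (density M (\<lambda>x. ennreal ((cmod (g x))\<^sup>2))) \<longleftrightarrow> (\<lambda>x. f x * g x) \<in> L2 M"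
    by (simp add: L2_def)
qed

lemma l2ip_density:
  assumes "g \<in> borel_measurable M" "f \<in> borel_measurable M" "h \<in> borel_measurable M"
  shows "l2ip (density M (\<lambda>x. ennreal ((cmod (g x))\<^sup>2))) f h = l2ip M (\<lambda>x. f x * g x) (\<lambda>x. h x * g x)"
proof -
  have [measurable]: "cnj \<in> borel_measurable borel" by (intro borel_measurable_continuous_onI continuous_intros)
  note [measurable] = assms
  have "(cmod (g x))\<^sup>2 *\<^sub>R (f x * cnj (h x)) = f x * g x * cnj (h x * g x)" for x
    unfolding scaleR_conv_of_real complex_norm_square by (simp add: mult_ac)
  then show ?thesis unfolding l2ip_def by (subst integral_density) auto
qed

section \<open>The operators of a projective system and their adjoints\<close>

locale projective_system = row_finite_kgraph k G
  for k and G :: "'a kgraph" +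
  fixes M :: "'a ipath measure" and F :: "'a \<Rightarrow> 'a ipath \<Rightarrow> complex"
  assumes M: "path_measure k G M" and vertex_finite: "\<And>v. v \<in> obj G \<Longrightarrow> emeasure M (cyl k G v) < \<infinity>"
    and system: "std_proj_system k G M F"
begin

lemma weight_F:
  assumes "l \<in> mor G" shows "prefix_weight k G M l (F l)"
  using assms system M by unfold_locales (auto simp: std_proj_system_def)

text \<open>The zero set \<open>B\<close> of \<open>F l\<close> in Z(l) is the image of a set
  \<open>A\<close> under prefixing. The weight condition makes \<open>A\<close> null, because the
  integral of \<open>|F l|^2\<close> over \<open>B\<close> is 0; the composed measure has a density,
  so it vanishes on \<open>A\<close>, and its value there is the measure of
  \<open>B\<close>.\<close>

lemma F_nonzero:
  assumes l: "l \<in> mor G" shows "AE x in M. x \<in> cyl k G l \<longrightarrow> F l x \<noteq> 0"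
proof -
  interpret w: prefix_weight k G M l "F l" by (rule weight_F[OF l])
  define D where "D = cyl k G (src G l)"
  define B where "B = {x \<in> cyl k G l. F l x = 0}"
  have Bs: "B = cyl k G l \<inter> {x \<in> space M. F l x = 0}"
    using sets.sets_into_space[OF w.cyl_meas(1)] by (auto simp: B_def)
  have [measurable]: "B \<in> sets M" unfolding Bs by measurable
  define A where "A = D \<inter> prefix k G l -` B"
  have "prefix k G l -` B \<inter> space (restrict_space M D) \<in> sets (restrict_space M D)"
    using w.prefix_meas unfolding D_def by measurable
  then have AR: "A \<in> sets (restrict_space M D)" "A \<in> sets M" "A \<subseteq> D"
    unfolding A_def D_def by (auto simp: space_restrict_cyl[OF M] sets_restrict_cyl[OF M src_mor[OF l]] Int_commute)
  have im: "prefix k G l ` A = B"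
  proof (intro set_eqI iffI)
    fix y assume y: "y \<in> B"
    then have "y \<in> cyl k G l" by (simp add: B_def)
    then have "prefix k G l (shift k (deg G l) y) = y" "shift k (deg G l) y \<in> D"
      using prefix_eqI[OF l] shift_cyl_src[OF _ l] by (auto simp: D_def)
    then show "y \<in> prefix k G l ` A" using y by (intro image_eqI[of _ _ "shift k (deg G l) y"]) (auto simp: A_def)
  qed (auto simp: A_def)
  have "(\<integral>\<^sup>+x. ennreal ((cmod (F l x))\<^sup>2) * indicator B x \<partial>M) = (\<integral>\<^sup>+x. 0 \<partial>M)"
    by (intro nn_integral_cong) (auto simp: B_def indicator_def)
  moreover have "(\<integral>\<^sup>+x. ennreal ((cmod (F l x))\<^sup>2) * indicator B x \<partial>M) = (\<integral>\<^sup>+x. indicator B (prefix k G l x) \<partial>restrict_space M D)"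
    unfolding D_def by (rule w.nn_change) measurable
  moreover have "(\<integral>\<^sup>+x. indicator B (prefix k G l x) \<partial>restrict_space M D) = (\<integral>\<^sup>+x. indicator A x \<partial>restrict_space M D)"
    by (intro nn_integral_cong) (auto simp: A_def indicator_def D_def space_restrict_cyl[OF M])
  ultimately have A0: "emeasure (restrict_space M D) A = 0" using AR by simp
  have "sbfs M {l' \<in> mor G. deg G l' = deg G l} (\<lambda>l. cyl k G (src G l)) (prefix k G) (shift k (deg G l))"
    using system l by (simp add: std_proj_system_def std_lambda_sbfs_def)
  then have "\<forall>i\<in>{l' \<in> mor G. deg G l' = deg G l}. \<exists>g. g \<in> borel_measurable (restrict_space M (cyl k G (src G i))) \<and>
          density (restrict_space M (cyl k G (src G i))) g = comp_meas M (cyl k G (src G i)) (prefix k G i) \<and>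
          (AE x in restrict_space M (cyl k G (src G i)). g x > 0)"
    unfolding sbfs_def by (elim conjE)
  from bspec[OF this, of l] l obtain g where g: "g \<in> borel_measurable (restrict_space M D)"
      "density (restrict_space M D) g = comp_meas M D (prefix k G l)"
    by (auto simp: D_def)
  have "emeasure (density (restrict_space M D) g) A = 0"
    using A0 AR g by (subst emeasure_density) (auto simp: nn_integral_0_iff_AE intro!: AE_I'[of A] simp: null_sets_def)
  then have "emeasure M B = 0"
    using comp_meas_prefix(2)[OF M l AR(2)] AR(3) g(2) im by (simp add: D_def)
  then have "AE x in M. x \<notin> B" by (intro AE_not_in) (auto simp: null_sets_def)
  then show ?thesis by (rule eventually_mono) (auto simp: B_def)
qed

abbreviation S :: "'a \<Rightarrow> ('a ipath \<Rightarrow> complex) \<Rightarrow> 'a ipath \<Rightarrow> complex" where "S \<equiv> proj_rep k G F"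

text \<open>The quotient appears because the change of variables absorbs a factor
  \<open>|F l|^2\<close>: splitting it off \<open>F l * cnj g\<close> leaves
  \<open>cnj (g / F l)\<close>. At zeros of \<open>F l\<close> the quotient is 0 by
  convention.\<close>

definition Sadj :: "'a \<Rightarrow> ('a ipath \<Rightarrow> complex) \<Rightarrow> 'a ipath \<Rightarrow> complex" where
  "Sadj l g = (\<lambda>x. indicator (cyl k G (src G l)) x * (g (prefix k G l x) / F l (prefix k G l x)))"

lemma S_L2: "l \<in> mor G \<Longrightarrow> f \<in> L2 M \<Longrightarrow> S l f \<in> L2 M"
  using prefix_weight.S_L2(1)[OF weight_F] by (simp add: proj_rep_def)

lemma Sadj_L2:
  assumes l: "l \<in> mor G" and g: "g \<in> L2 M" shows "Sadj l g \<in> L2 M"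
proof -
  interpret w: prefix_weight k G M l "F l" by (rule weight_F[OF l])
  note [measurable] = L2D(1)[OF g]
  have "(\<lambda>x. g (prefix k G l x) / F l (prefix k G l x)) \<in> borel_measurable (restrict_space M (cyl k G (src G l)))"
    by measurable
  then have "(\<lambda>x. indicator (cyl k G (src G l)) x *\<^sub>R (g (prefix k G l x) / F l (prefix k G l x))) \<in> borel_measurable M"
    using w.cyl_meas(2) by (subst (asm) borel_measurable_restrict_space_iff) auto
  also have "(\<lambda>x. indicator (cyl k G (src G l)) x *\<^sub>R (g (prefix k G l x) / F l (prefix k G l x))) = Sadj l g"
    by (auto simp: Sadj_def indicator_def)
  finally have m [measurable]: "Sadj l g \<in> borel_measurable M" .
  have "(\<integral>\<^sup>+x. ennreal ((cmod (Sadj l g x))\<^sup>2) \<partial>M) =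
      (\<integral>\<^sup>+x. ennreal ((cmod (g (prefix k G l x) / F l (prefix k G l x)))\<^sup>2) * indicator (cyl k G (src G l)) x \<partial>M)"
    unfolding Sadj_def by (intro nn_integral_cong) (auto simp: indicator_def)
  also have "\<dots> = (\<integral>\<^sup>+x. ennreal ((cmod (g (prefix k G l x) / F l (prefix k G l x)))\<^sup>2) \<partial>restrict_space M (cyl k G (src G l)))"
    using w.cyl_meas by (subst nn_integral_restrict_space) auto
  also have "\<dots> = (\<integral>\<^sup>+x. ennreal ((cmod (F l x))\<^sup>2) * ennreal ((cmod (g x / F l x))\<^sup>2) \<partial>M)"
    by (rule w.nn_change[symmetric]) measurable
  also have "\<dots> \<le> (\<integral>\<^sup>+x. ennreal ((cmod (g x))\<^sup>2) \<partial>M)"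
  proof (intro nn_integral_mono)
    fix x
    show "ennreal ((cmod (F l x))\<^sup>2) * ennreal ((cmod (g x / F l x))\<^sup>2) \<le> ennreal ((cmod (g x))\<^sup>2)"
      by (cases "F l x = 0") (auto simp: ennreal_mult[symmetric] norm_divide power_divide)
  qed
  also have "\<dots> = ennreal (l2sq M g)" by (rule nn_integral_l2sq[OF g])
  finally show ?thesis by (rule L2_I_nn_integral(1)[OF m]) simp
qed

lemma Sadj_adjoint:
  assumes l: "l \<in> mor G" shows "l2_adjoint M (S l) (Sadj l)"
  unfolding l2_adjoint_def
proof (intro conjI ballI)
  interpret w: prefix_weight k G M l "F l" by (rule weight_F[OF l])
  show "Sadj l f \<in> L2 M" if "f \<in> L2 M" for f using Sadj_L2[OF l that] .
  fix f g assume fg: "f \<in> L2 M" "g \<in> L2 M"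
  have [measurable]: "cnj \<in> borel_measurable borel" by (intro borel_measurable_continuous_onI continuous_intros)
  note [measurable] = L2D(1)[OF fg(1)] L2D(1)[OF fg(2)]
  let ?h = "\<lambda>x. f (shift k (deg G l) x) * cnj (g x / F l x)"
  have "l2ip M (S l f) g = (\<integral>x. (cmod (F l x))\<^sup>2 *\<^sub>R ?h x \<partial>M)"
    unfolding l2ip_def proj_rep_def
  proof (intro Bochner_Integration.integral_cong refl)
    fix x
    show "F l x * f (shift k (deg G l) x) * cnj (g x) = (cmod (F l x))\<^sup>2 *\<^sub>R ?h x"
      by (cases "F l x = 0") (auto simp: scaleR_conv_of_real complex_norm_square[symmetric] field_simps)
  qed
  also have "\<dots> = (\<integral>x. indicator (cyl k G (src G l)) x * ?h (prefix k G l x) \<partial>M)"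
    by (rule w.integral_change) measurable
  also have "\<dots> = l2ip M f (Sadj l g)"
    unfolding l2ip_def Sadj_def
    by (intro Bochner_Integration.integral_cong refl) (auto simp: indicator_def prefix_cyl(2)[OF l])
  finally show "l2ip M (S l f) g = l2ip M f (Sadj l g)" .
qed

lemma S_Sadj:
  assumes l: "l \<in> mor G" shows "AE x in M. S l (Sadj l g) x = indicator (cyl k G l) x * g x"
proof -
  interpret w: prefix_weight k G M l "F l" by (rule weight_F[OF l])
  show ?thesis
    using w.support F_nonzero[OF l]
  proof eventually_elim
    fix x assume x: "x \<notin> cyl k G l \<longrightarrow> F l x = 0" "x \<in> cyl k G l \<longrightarrow> F l x \<noteq> 0"
    show "S l (Sadj l g) x = indicator (cyl k G l) x * g x"
    proof (cases "x \<in> cyl k G l")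
      case True
      then show ?thesis using x prefix_eqI[OF l True refl] shift_cyl_src[OF True l]
        by (simp add: proj_rep_def Sadj_def)
    qed (use x in \<open>simp add: proj_rep_def\<close>)
  qed
qed

text \<open>The shift takes Z(l) into Z(s(l)), so the indicator of the latter, square integrable
  because vertex cylinders have finite measure, is mapped to \<open>F l\<close> itself.\<close>

lemma S_nonzero:
  assumes l: "l \<in> mor G" shows "\<exists>f\<in>L2 M. \<not> (AE x in M. S l f x = 0)"
proof -
  interpret w: prefix_weight k G M l "F l" by (rule weight_F[OF l])
  let ?D = "cyl k G (src G l)"
  have "(\<lambda>x. (cmod (indicator ?D x))\<^sup>2) = (indicator ?D :: _ \<Rightarrow> real)" by (auto simp: indicator_def)
  moreover have "integrable M (indicator ?D :: _ \<Rightarrow> real)"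
    using w.cyl_meas(2) vertex_finite[of "src G l"] l by (intro integrable_real_indicator) auto
  ultimately have "(indicator ?D :: _ \<Rightarrow> complex) \<in> L2 M" using w.cyl_meas(2) by (simp add: L2_def)
  moreover have "AE x in M. S l (indicator ?D) x = F l x"
    using w.support by (rule eventually_mono) (use shift_cyl_src[OF _ l] in \<open>force simp: proj_rep_def indicator_def\<close>)
  moreover have "\<not> (AE x in M. F l x = 0)" using system l by (simp add: std_proj_system_def)
  moreover have "AE x in M. F l x = 0"
    if "AE x in M. S l (indicator ?D) x = F l x" "AE x in M. S l (indicator ?D) x = 0"
    using that by eventually_elim simp
  ultimately show ?thesis by blast
qed

text \<open>The monic vector: scaled down on the \<open>n\<close>-th vertex cylinder so that it is square integrable although \<open>M\<close> may be infinite.\<close>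

definition \<xi>sq :: "nat \<Rightarrow> real" where "\<xi>sq n = 1 / (2 ^ n * (1 + measure M (vertex_cyl n)))"

definition \<xi> :: "'a ipath \<Rightarrow> complex" where
  "\<xi> x = of_real (sqrt (\<xi>sq (to_nat_on (obj G) (x vzero vzero))))"

lemma \<xi>sq_pos: "\<xi>sq n > 0"
  by (simp add: \<xi>sq_def add_pos_nonneg)

lemma \<xi>_nonzero: "\<xi> x \<noteq> 0"
  using \<xi>sq_pos by (simp add: \<xi>_def less_imp_neq[symmetric])

lemma \<xi>_sq: "(cmod (\<xi> x))\<^sup>2 = \<xi>sq (to_nat_on (obj G) (x vzero vzero))"
  using \<xi>sq_pos by (simp add: \<xi>_def less_imp_le)

lemma \<xi>_meas [measurable]: "\<xi> \<in> borel_measurable M"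
proof -
  have "(\<lambda>x. to_nat_on (obj G) (x vzero vzero)) \<in> measurable M (count_space UNIV)"
  proof (rule measurableI)
    fix A :: "nat set"
    have "(\<lambda>x. to_nat_on (obj G) (x vzero vzero)) -` A \<inter> space M = (\<Union>n\<in>A. vertex_cyl n)"
    proof (intro set_eqI)
      fix x
      show "x \<in> (\<lambda>x. to_nat_on (obj G) (x vzero vzero)) -` A \<inter> space M \<longleftrightarrow> x \<in> (\<Union>n\<in>A. vertex_cyl n)"
        using vertex_cyl_subset mem_vertex_cyl_iff[of x] path_measure_space[OF M] by (cases "x \<in> infpaths k G") auto
    qed
    then show "(\<lambda>x. to_nat_on (obj G) (x vzero vzero)) -` A \<inter> space M \<in> sets M"
      using vertex_cyl_sets[OF M] by auto
  qed simp
  then show ?thesis unfolding \<xi>_def[abs_def] by measurable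
qed

lemma vertex_cyl_finite: "emeasure M (vertex_cyl n) = ennreal (measure M (vertex_cyl n))"
  by (rule vertex_cyl_cases[of n]) (use vertex_finite in \<open>auto simp: emeasure_eq_ennreal_measure less_top\<close>)

text \<open>On the n-th vertex cylinder, of measure m, the integral is
  \<open>m / (2^n * (1 + m))\<close>, at most \<open>2^-n\<close>. The summand 1 keeps the
  denominator positive when that set is empty or null.\<close>

lemma \<xi>_L2: "\<xi> \<in> L2 M"
proof -
  have "(\<integral>\<^sup>+x. ennreal ((cmod (\<xi> x))\<^sup>2) \<partial>M) = (\<integral>\<^sup>+x. (\<Sum>n. ennreal (\<xi>sq n) * indicator (vertex_cyl n) x) \<partial>M)"
  proof (intro nn_integral_cong)
    fix x assume "x \<in> space M"
    then have x: "x \<in> infpaths k G" using M by (simp add: path_measure_space)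
    let ?n = "to_nat_on (obj G) (x vzero vzero)"
    have "(\<Sum>n. ennreal (\<xi>sq n) * indicator (vertex_cyl n) x) = (\<Sum>n\<in>{?n}. ennreal (\<xi>sq n) * indicator (vertex_cyl n) x)"
      by (rule suminf_finite) (auto simp: mem_vertex_cyl_iff[OF x])
    then show "ennreal ((cmod (\<xi> x))\<^sup>2) = (\<Sum>n. ennreal (\<xi>sq n) * indicator (vertex_cyl n) x)"
      by (simp add: \<xi>_sq mem_vertex_cyl_iff[OF x])
  qed
  also have "\<dots> = (\<Sum>n. \<integral>\<^sup>+x. ennreal (\<xi>sq n) * indicator (vertex_cyl n) x \<partial>M)"
    using vertex_cyl_sets[OF M] by (intro nn_integral_suminf) auto
  also have "\<dots> = (\<Sum>n. ennreal (\<xi>sq n) * emeasure M (vertex_cyl n))"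
    using vertex_cyl_sets[OF M] by (simp add: nn_integral_cmult_indicator)
  also have "\<dots> \<le> (\<Sum>n. ennreal ((1/2)^n))"
  proof (rule suminf_le)
    fix n
    have "\<xi>sq n * measure M (vertex_cyl n) \<le> (1/2)^n"
    proof -
      have "measure M (vertex_cyl n) / (1 + measure M (vertex_cyl n)) \<le> 1"
        by (simp add: divide_le_eq_1 add_pos_nonneg)
      then have "(1/2)^n * (measure M (vertex_cyl n) / (1 + measure M (vertex_cyl n))) \<le> (1/2)^n * 1"
        by (intro mult_left_mono) auto
      then show ?thesis by (simp add: \<xi>sq_def power_one_over divide_simps mult_ac)
    qed
    then show "ennreal (\<xi>sq n) * emeasure M (vertex_cyl n) \<le> ennreal ((1/2)^n)"
      using \<xi>sq_pos[of n] unfolding vertex_cyl_finite by (simp add: ennreal_mult[symmetric] ennreal_leI less_imp_le)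
  qed auto
  also have "\<dots> = ennreal (\<Sum>n. (1/2)^n)"
    by (intro suminf_ennreal2) (auto intro: summable_geometric)
  finally show ?thesis by (rule L2_I_nn_integral(1)[OF \<xi>_meas]) (auto intro!: suminf_nonneg summable_geometric)
qed

text \<open>The measure \<mu>_\<pi> of the monic vector, as \<open>mu_pi_N\<close> confirms. It is
  finite even if \<open>M\<close> is not, so the density results apply to it.\<close>

definition N :: "'a ipath measure" where "N = density M (\<lambda>x. ennreal ((cmod (\<xi> x))\<^sup>2))"

lemma N_path: "path_measure k G N"
  using M by (simp add: path_measure_def N_def)

lemma N_finite: "finite_measure N"
proof
  have "emeasure N (space N) = (\<integral>\<^sup>+x. ennreal ((cmod (\<xi> x))\<^sup>2) \<partial>M)"
    unfolding N_def by (subst emeasure_density) (auto intro!: nn_integral_cong)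
  then show "emeasure N (space N) \<noteq> \<infinity>" using nn_integral_l2sq[OF \<xi>_L2] by simp
qed

lemma emeasure_N_cyl:
  assumes l: "l \<in> mor G" shows "emeasure N (cyl k G l) = ennreal (Re (l2ip M \<xi> (S l (Sadj l \<xi>))))"
proof -
  note [measurable] = cyl_sets[OF M l] L2D(1)[OF S_L2[OF l Sadj_L2[OF l \<xi>_L2]]]
  have [measurable]: "cnj \<in> borel_measurable borel" by (intro borel_measurable_continuous_onI continuous_intros)
  let ?f = "\<lambda>x. indicator (cyl k G l) x * \<xi> x"
  have "l2ip M \<xi> (S l (Sadj l \<xi>)) = (\<integral>x. \<xi> x * cnj (?f x) \<partial>M)"
    unfolding l2ip_def
  proof (rule integral_cong_AE)
    show "AE x in M. \<xi> x * cnj (S l (Sadj l \<xi>) x) = \<xi> x * cnj (?f x)"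
      using S_Sadj[OF l, of \<xi>] by (rule eventually_mono) simp
  qed measurable
  also have "\<dots> = (\<integral>x. ?f x * cnj (?f x) \<partial>M)"
    by (intro Bochner_Integration.integral_cong) (auto simp: indicator_def)
  also have "\<dots> = of_real (l2sq M ?f)" using l2ip_self[of M ?f] by (simp add: l2ip_def)
  finally have "ennreal (Re (l2ip M \<xi> (S l (Sadj l \<xi>)))) = ennreal (l2sq M ?f)" by simp
  also have "\<dots> = (\<integral>\<^sup>+x. ennreal ((cmod (?f x))\<^sup>2) \<partial>M)"
    using nn_integral_l2sq[OF L2_indicator_mult[OF \<xi>_L2 cyl_sets[OF M l]]] by simp
  also have "\<dots> = (\<integral>\<^sup>+x. ennreal ((cmod (\<xi> x))\<^sup>2) * indicator (cyl k G l) x \<partial>M)"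
    by (intro nn_integral_cong) (auto simp: indicator_def)
  also have "\<dots> = emeasure N (cyl k G l)" unfolding N_def by (subst emeasure_density) auto
  finally show ?thesis by simp
qed

text \<open>Up to null sets \<open>S l (Sadj l \<xi>)\<close> is the indicator of Z(l) times \<xi>.
  Approximating \<open>f\<close> in L2 of \<open>M\<close> is therefore the same as approximating
  \<open>f / \<xi>\<close> in L2 of \<open>N\<close> by combinations of cylinder indicators.\<close>

lemma monic_\<xi>: "l2_monic_vector G M S Sadj \<xi>"
  unfolding l2_monic_vector_def
proof (intro conjI ballI allI impI \<xi>_L2 Sadj_adjoint)
  fix f and e :: real assume f: "f \<in> L2 M" and e: "e > 0"
  note [measurable] = L2D(1)[OF f]
  have "(\<lambda>x. f x / \<xi> x) \<in> L2 N"
    unfolding N_def using f by (subst l2sq_density(2)) (auto simp: \<xi>_nonzero)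
  then have "(\<lambda>x. f x / \<xi> x) \<in> l2_closure N (lspan (mor G) (\<lambda>l. indicator (cyl k G l)))"
    by (rule L2_dense_cyl[OF N_path N_finite])
  moreover have "e\<^sup>2 > 0" using e by simp
  ultimately obtain \<phi> where "\<phi> \<in> lspan (mor G) (\<lambda>l. indicator (cyl k G l) :: 'a ipath \<Rightarrow> complex)"
      and \<phi>: "l2sq N (\<lambda>x. f x / \<xi> x - \<phi> x) < e\<^sup>2" unfolding l2_closure_def by blast
  from lspan_finite_sum[OF this(1)]
  obtain L c where L: "finite L" "L \<subseteq> mor G" "\<phi> = (\<lambda>x. \<Sum>l\<in>L. c l * indicator (cyl k G l) x)" by blast
  have L2l: "S l (Sadj l \<xi>) \<in> L2 M" if "l \<in> L" for l using that L S_L2 Sadj_L2 \<xi>_L2 by blast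
  have [measurable]: "\<phi> \<in> borel_measurable M"
    unfolding L(3) by (intro borel_measurable_sum borel_measurable_times borel_measurable_indicator) (use L cyl_sets[OF M] in auto)
  have "AE x in M. \<forall>l\<in>L. S l (Sadj l \<xi>) x = indicator (cyl k G l) x * \<xi> x"
    using L S_Sadj by (intro AE_finite_allI) auto
  then have AE: "AE x in M. f x - (\<Sum>l\<in>L. c l * S l (Sadj l \<xi>) x) = (f x / \<xi> x - \<phi> x) * \<xi> x"
  proof (rule eventually_mono)
    fix x assume "\<forall>l\<in>L. S l (Sadj l \<xi>) x = indicator (cyl k G l) x * \<xi> x"
    then have "(\<Sum>l\<in>L. c l * S l (Sadj l \<xi>) x) = \<phi> x * \<xi> x"
      unfolding L(3) sum_distrib_right by (intro sum.cong) auto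
    then show "f x - (\<Sum>l\<in>L. c l * S l (Sadj l \<xi>) x) = (f x / \<xi> x - \<phi> x) * \<xi> x"
      by (simp add: left_diff_distrib \<xi>_nonzero)
  qed
  have "l2sq M (\<lambda>x. f x - (\<Sum>l\<in>L. c l * S l (Sadj l \<xi>) x)) = l2sq M (\<lambda>x. (f x / \<xi> x - \<phi> x) * \<xi> x)"
    using AE L2D(1)[OF L2_diff[OF f L2_sum[OF L2_scale[OF L2l]]]] by (intro l2sq_cong_AE) auto
  also have "\<dots> = l2sq N (\<lambda>x. f x / \<xi> x - \<phi> x)" unfolding N_def by (subst l2sq_density(1)) auto
  finally have "l2norm M (\<lambda>x. f x - (\<Sum>l\<in>L. c l * S l (Sadj l \<xi>) x)) < e"
    using \<phi> e by (simp add: l2norm_eq real_less_lsqrt)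
  then show "\<exists>L c. finite L \<and> L \<subseteq> mor G \<and> l2norm M (\<lambda>x. f x - (\<Sum>l\<in>L. c l * S l (Sadj l \<xi>) x)) < e"
    using L by blast
qed

lemma mu_pi_N: "is_mu_pi_l2 k G M S Sadj \<xi> N"
  using N_path emeasure_N_cyl by (simp add: is_mu_pi_l2_def)

text \<open>Every measure with the prescribed values on cylinders has to be treated; since these
  values are finite they determine the measure, and only \<open>N\<close> remains.\<close>

lemma mu_pi_unique:
  assumes "is_mu_pi_l2 k G M S Sadj \<xi> N'" shows "N' = N"
proof (rule path_measure_eqI[OF _ N_path vzero_NK])
  show "path_measure k G N'" using assms by (simp add: is_mu_pi_l2_def)
qed (use assms mu_pi_N in \<open>simp_all add: is_mu_pi_l2_def\<close>)

lemma isometric_N: "l2_isometric M N"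
  unfolding l2_isometric_def
proof (intro exI[of _ "\<lambda>f x. f x / \<xi> x"] conjI ballI allI)
  show "(\<lambda>x. f x / \<xi> x) \<in> L2 N" if f: "f \<in> L2 M" for f
    unfolding N_def using L2D(1)[OF f] f by (subst l2sq_density(2)) (auto simp: \<xi>_nonzero)
  show "l2ip N (\<lambda>x. f x / \<xi> x) (\<lambda>x. g x / \<xi> x) = l2ip M f g" if "f \<in> L2 M" "g \<in> L2 M" for f g
    unfolding N_def using L2D(1)[OF that(1)] L2D(1)[OF that(2)] by (subst l2ip_density) (auto simp: \<xi>_nonzero)
  show "\<exists>f\<in>L2 M. AE y in N. f y / \<xi> y = h y" if h: "h \<in> L2 N" for h
  proof
    have "h \<in> borel_measurable M" using L2D(1)[OF h] by (simp add: N_def)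
    then show "(\<lambda>x. h x * \<xi> x) \<in> L2 M" using h l2sq_density(2)[OF \<xi>_meas] by (simp add: N_def)
  qed (simp add: \<xi>_nonzero)
qed (simp_all add: add_divide_distrib)

end

theorem theorem3p6:
  fixes k :: nat and G :: "'a kgraph"
  assumes "is_kgraph k G" and "row_finite k G" and "no_sources k G"
  shows
   "(\<forall>(sm :: complex \<Rightarrow> 'h::ab_group_add \<Rightarrow> 'h) ip t xi.
       is_hilbert sm ip \<and> CK_family k G sm ip t \<and> monic_rep G sm ip t \<and>
       monic_vector G sm ip t xi \<longrightarrow>
       (\<exists>M. is_mu_pi k G ip t xi M) \<and>
       (\<forall>M. is_mu_pi k G ip t xi M \<longrightarrow>
          (\<exists>F. std_proj_system k G M F \<and> unitarily_equiv G sm ip t M (proj_rep k G F))))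
    \<and>
    (\<forall>M F. path_measure k G M \<and> (\<forall>v\<in>obj G. emeasure M (cyl k G v) < \<infinity>) \<and>
       std_proj_system k G M F \<longrightarrow>
       (\<forall>l\<in>mor G. \<exists>f\<in>L2 M. \<not> (AE x in M. proj_rep k G F l f x = 0)) \<and>
       (\<exists>S' xi. l2_monic_vector G M (proj_rep k G F) S' xi \<and>
          (\<exists>N. is_mu_pi_l2 k G M (proj_rep k G F) S' xi N) \<and>
          (\<forall>N. is_mu_pi_l2 k G M (proj_rep k G F) S' xi N \<longrightarrow> l2_isometric M N)))"
proof (intro conjI[of "\<forall>sm. _ sm"] allI impI)
  interpret row_finite_kgraph k G using assms by unfold_locales
  fix sm :: "complex \<Rightarrow> 'h \<Rightarrow> 'h" and ip t \<xi>
  assume *: "is_hilbert sm ip \<and> CK_family k G sm ip t \<and> monic_rep G sm ip t \<and> monic_vector G sm ip t \<xi>"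
  then interpret ck_representation k G sm ip t by unfold_locales auto
  show "(\<exists>M. is_mu_pi k G ip t \<xi> M) \<and>
       (\<forall>M. is_mu_pi k G ip t \<xi> M \<longrightarrow>
          (\<exists>F. std_proj_system k G M F \<and> unitarily_equiv G sm ip t M (proj_rep k G F)))"
  proof (intro conjI allI impI mu_pi_exists)
    fix M assume "is_mu_pi k G ip t \<xi> M"
    then interpret monic_representation k G sm ip t \<xi> M using * by unfold_locales auto
    show "\<exists>F. std_proj_system k G M F \<and> unitarily_equiv G sm ip t M (proj_rep k G F)"
      using proj_system unitary by blast
  qed
next
  interpret row_finite_kgraph k G using assms by unfold_locales
  fix M F
  assume "path_measure k G M \<and> (\<forall>v\<in>obj G. emeasure M (cyl k G v) < \<infinity>) \<and> std_proj_system k G M F"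
  then interpret projective_system k G M F by unfold_locales auto
  show "(\<forall>l\<in>mor G. \<exists>f\<in>L2 M. \<not> (AE x in M. proj_rep k G F l f x = 0)) \<and>
       (\<exists>S' xi. l2_monic_vector G M (proj_rep k G F) S' xi \<and>
          (\<exists>N. is_mu_pi_l2 k G M (proj_rep k G F) S' xi N) \<and>
          (\<forall>N. is_mu_pi_l2 k G M (proj_rep k G F) S' xi N \<longrightarrow> l2_isometric M N))"
    using S_nonzero monic_\<xi> mu_pi_N mu_pi_unique isometric_N by blast
qed

end
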